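(* Let $G$ be a finite $2$-connected simple graph on $[n]$ with $e$ edges. Let $M$ be the cycle matroid of $G$. Unless $F(I_M)$ is a polynomial ring, one has $$3\leq \operatorname{reg}(F(I_M))\leq e-1.$$
   Context: $K$ is a field. A finite connected simple graph $G$ is called $2$-connected if it has no cut vertex, i.e. no vertex $i$ such that the induced subgraph on $[n]\setminus\{i\}$ is disconnected. The cycle matroid of a finite simple graph $G$ with edges $E(G)=\{e_1,\ldots,e_m\}$ (so $m=e$) is the matroid with ground set $E(G)$ whose bases are the edge sets of the spanning forests (maximal acyclic subgraphs) of $G$. The matroidal ideal of $M$ is the ideal $I_M\subset K[x_1,\ldots,x_m]$ generated by the monomials $\prod_{e_i\in E(F)}x_i$, with $F$ a spanning forest of $G$. The base ring of $M$ is the fiber cone $F(I_M)=\bigoplus_{k\ge 0}I_M^k/\mathfrak m I_M^k$, $\mathfrak m=(x_1,\ldots,x_m)$, a standard graded $K$-algebra. Its Hilbert series has the form $h(F(I_M);t)/(1-t)^{\dim F(I_M)}$ with a polynomial $h(F(I_M);t)$, the $h$-polynomial. Convention: $F(I_M)$ is Cohen--Macaulay, and its regularity is taken to be $\operatorname{reg}(F(I_M))=\deg h(F(I_M);t)+1$ (when $F(I_M)$ is not a polynomial ring, this is the Castelnuovo--Mumford regularity of the defining ideal $J$ in a presentation $F(I_M)=T/J$, where $T$ is a standard graded polynomial ring over $K$ and $J$ is contained in the square of its graded maximal ideal). *)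

theory Defs
  imports
    "HOL-Library.Poly_Mapping"
    "HOL-Library.Extended_Nat"
    "HOL-Computational_Algebra.Polynomial_FPS"
    "HOL-Algebra.Ideal_Product"
    "HOL-Algebra.QuotRing"
    "HOL-Algebra.UnivPoly"
    "HOL-Algebra.Embedded_Algebras"
begin

section \<open>Graphs and cycle matroids\<close>

text \<open>A simple graph is given by its vertex set and its set of two-element edges.\<close>

definition simple_graph :: "'v set \<Rightarrow> 'v set set \<Rightarrow> bool" where
  "simple_graph V E \<longleftrightarrow> finite V \<and> (\<forall>e\<in>E. e \<subseteq> V \<and> card e = 2)"

definition disconnected :: "'v set \<Rightarrow> 'v set set \<Rightarrow> bool" where
  "disconnected V E \<longleftrightarrow> (\<exists>u\<in>V. \<exists>v\<in>V. (u, v) \<notin> {(x, y). {x, y} \<in> E}\<^sup>*)"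

definition connected_graph :: "'v set \<Rightarrow> 'v set set \<Rightarrow> bool" where
  "connected_graph V E \<longleftrightarrow> V \<noteq> {} \<and> \<not> disconnected V E"

definition induced_edges :: "'v set set \<Rightarrow> 'v set \<Rightarrow> 'v set set" where
  "induced_edges E W = {e \<in> E. e \<subseteq> W}"

definition cut_vertex :: "'v set \<Rightarrow> 'v set set \<Rightarrow> 'v \<Rightarrow> bool" where
  "cut_vertex V E i \<longleftrightarrow> i \<in> V \<and> disconnected (V - {i}) (induced_edges E (V - {i}))"

text \<open>Under this convention the graphs with one vertex, or with two adjacent vertices, are
  2-connected.\<close>

definition two_connected :: "'v set \<Rightarrow> 'v set set \<Rightarrow> bool" where
  "two_connected V E \<longleftrightarrow> connected_graph V E \<and> (\<nexists>i. cut_vertex V E i)"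

definition is_cycle :: "'v set set \<Rightarrow> 'v list \<Rightarrow> bool" where
  "is_cycle E vs \<longleftrightarrow> 3 \<le> length vs \<and> distinct vs \<and>
     (\<forall>i < length vs. {vs ! i, vs ! (Suc i mod length vs)} \<in> E)"

definition acyclic_edges :: "'v set set \<Rightarrow> bool" where
  "acyclic_edges E \<longleftrightarrow> (\<nexists>vs. is_cycle E vs)"

definition spanning_forest :: "'v set set \<Rightarrow> 'v set set \<Rightarrow> bool" where
  "spanning_forest E F \<longleftrightarrow> F \<subseteq> E \<and> acyclic_edges F \<and>
     (\<forall>F'. F \<subseteq> F' \<and> F' \<subseteq> E \<and> acyclic_edges F' \<longrightarrow> F' = F)"

text \<open>A matroid is represented by the pair of its ground set and its set of bases.\<close>

definition cycle_matroid :: "'v set set \<Rightarrow> 'v set set \<times> 'v set set set" where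
  "cycle_matroid E = (E, {F. spanning_forest E F})"


section \<open>Polynomial rings\<close>

text \<open>Polynomials over \<open>'k\<close> in variables from \<open>'x\<close>: a monomial is a finitely supported exponent
  function, and a polynomial is a finitely supported function on monomials (with the convolution
  product of \<^theory>\<open>HOL-Library.Poly_Mapping\<close>).\<close>

type_synonym ('x, 'k) mpol = "('x \<Rightarrow>\<^sub>0 nat) \<Rightarrow>\<^sub>0 'k"

definition pvar :: "'x \<Rightarrow> ('x, 'k::field) mpol" where
  "pvar x = Poly_Mapping.single (Poly_Mapping.single x 1) 1"

definition pconst :: "'k::field \<Rightarrow> ('x, 'k) mpol" where
  "pconst c = Poly_Mapping.single 0 c"

definition poly_ring :: "'x set \<Rightarrow> ('x, 'k::field) mpol ring" where
  "poly_ring X = \<lparr>carrier = {p. \<forall>m \<in> Poly_Mapping.keys p. Poly_Mapping.keys m \<subseteq> X},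
     mult = (*), one = 1, zero = 0, add = (+)\<rparr>"


section \<open>Graded algebras\<close>

text \<open>A graded \<open>'k\<close>-algebra is a ring with a structure map \<open>embed\<close> and homogeneous
  components.\<close>

record ('a, 'k) graded_algebra = "'a ring" +
  embed :: "'k \<Rightarrow> 'a"
  component :: "nat \<Rightarrow> 'a set"

definition is_polynomial_ring :: "('a, 'k::field) graded_algebra \<Rightarrow> bool" where
  "is_polynomial_ring A \<longleftrightarrow> (\<exists>(r::nat) \<phi>.
     \<phi> \<in> ring_iso (poly_ring {..<r} :: (nat, 'k) mpol ring) A \<and>
     (\<forall>c. \<phi> (pconst c) = embed A c))"

definition krull_dim :: "('a, 'b) ring_scheme \<Rightarrow> enat" where
  "krull_dim R = Sup {enat l | l. \<exists>P :: nat \<Rightarrow> 'a set.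
     (\<forall>i\<le>l. primeideal (P i) R) \<and> (\<forall>i<l. P i \<subset> P (Suc i))}"

definition hilbert_function :: "('a, 'k::field) graded_algebra \<Rightarrow> nat \<Rightarrow> nat" where
  "hilbert_function A k = ring.dim A (range (embed A)) (component A k)"

definition hilbert_series :: "('a, 'k::field) graded_algebra \<Rightarrow> int fps" where
  "hilbert_series A = Abs_fps (\<lambda>k. int (hilbert_function A k))"

text \<open>The numerator \<open>h\<close> in \<open>hilbert_series A = h(t) / (1 - t)\<^sup>d\<close>, where \<open>d\<close> is the Krull
  dimension.\<close>

definition h_polynomial :: "('a, 'k::field) graded_algebra \<Rightarrow> int poly" where
  "h_polynomial A = (THE h. \<exists>d. krull_dim A = enat d \<and>
     hilbert_series A * (1 - fps_X) ^ d = fps_of_poly h)"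

text \<open>This is the convention for Cohen--Macaulay algebras; for \<open>A = T/J\<close> not a polynomial ring,
  with \<open>J\<close> contained in the square of the graded maximal ideal of \<open>T\<close>, it is the
  Castelnuovo--Mumford regularity of \<open>J\<close> (not of \<open>T/J\<close>).\<close>

definition reg :: "('a, 'k::field) graded_algebra \<Rightarrow> nat" where
  "reg A = Polynomial.degree (h_polynomial A) + 1"


section \<open>Fiber cones and base rings\<close>

primrec ideal_power :: "('a, 'b) ring_scheme \<Rightarrow> 'a set \<Rightarrow> nat \<Rightarrow> 'a set" where
  "ideal_power R I 0 = carrier R"
| "ideal_power R I (Suc k) = ideal_prod R I (ideal_power R I k)"

text \<open>The direct sum of the powers \<open>I\<^sup>k\<close>, as the subring of \<open>R[t]\<close> of all polynomials whose
  coefficient of \<open>t\<^sup>k\<close> lies in \<open>I\<^sup>k\<close>.\<close>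

definition rees_algebra :: "('a, 'b) ring_scheme \<Rightarrow> 'a set \<Rightarrow> ('a, nat \<Rightarrow> 'a) up_ring" where
  "rees_algebra R I = (UP R)\<lparr>carrier :=
     {p \<in> carrier (UP R). \<forall>k. up_ring.coeff (UP R) p k \<in> ideal_power R I k}\<rparr>"

text \<open>The direct sum of the \<open>\<mm>I\<^sup>k\<close> inside the Rees algebra.\<close>

definition fiber_ideal :: "('a, 'b) ring_scheme \<Rightarrow> 'a set \<Rightarrow> 'a set \<Rightarrow> (nat \<Rightarrow> 'a) set" where
  "fiber_ideal R \<mm> I = {p \<in> carrier (UP R).
     \<forall>k. up_ring.coeff (UP R) p k \<in> ideal_prod R \<mm> (ideal_power R I k)}"

text \<open>The direct sum of the quotients \<open>I\<^sup>k / \<mm>I\<^sup>k\<close>, formed as the quotient of the direct sum of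
  the \<open>I\<^sup>k\<close> by the direct sum of the \<open>\<mm>I\<^sup>k\<close>. Here \<open>\<iota>\<close> is the structure map of the
  \<open>'k\<close>-algebra \<open>R\<close>.\<close>

definition fiber_cone ::
    "('a, 'b) ring_scheme \<Rightarrow> ('k \<Rightarrow> 'a) \<Rightarrow> 'a set \<Rightarrow> 'a set \<Rightarrow> ((nat \<Rightarrow> 'a) set, 'k) graded_algebra"
  where
  "fiber_cone R \<iota> \<mm> I =
    (let S = rees_algebra R I;
         J = fiber_ideal R \<mm> I;
         cls = (\<lambda>a k. J +>\<^bsub>S\<^esub> up_ring.monom (UP R) a k)
     in ring.extend (S Quot J)
          \<lparr>embed = (\<lambda>c. cls (\<iota> c) 0),
           component = (\<lambda>k. {cls a k | a. a \<in> ideal_power R I k})\<rparr>)"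

text \<open>The variables of the polynomial ring are indexed by the ground set of the matroid itself,
  rather than by an enumeration of it.\<close>

definition matroidal_ideal :: "'x set \<times> 'x set set \<Rightarrow> ('x, 'k::field) mpol set" where
  "matroidal_ideal M = genideal (poly_ring (fst M)) {\<Prod>x\<in>B. pvar x | B. B \<in> snd M}"

definition base_ring ::
    "'x set \<times> 'x set set \<Rightarrow> ((nat \<Rightarrow> ('x, 'k::field) mpol) set, 'k) graded_algebra" where
  "base_ring M = fiber_cone (poly_ring (fst M)) pconst
     (genideal (poly_ring (fst M)) (pvar ` fst M)) (matroidal_ideal M)"

end

theory Submission
  imports Defs "HOL-Library.Function_Algebras"
begin

text \<open>The base ring of a matroid is the semigroup ring of its bases. All generators of \<open>I\<close> have the same
  degree \<open>r\<close>, so the ideal \<open>\<mm> I\<^sup>k\<close> consists of the elements of \<open>I\<^sup>k\<close> without a monomial of the least possible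
  degree \<open>k r\<close>. Taking the part of degree \<open>k r\<close> in the coefficient of \<open>t\<^sup>k\<close> therefore maps the Rees
  algebra onto the semigroup ring of all sums of indicator vectors of bases, graded by the number of
  summands, and its kernel is the ideal that defines the fiber cone (\<open>fiber_cone_iso\<close>). The value of the
  Hilbert function at \<open>k\<close> is the number of sums of \<open>k\<close> bases. By an exchange argument these are all lattice
  points of height \<open>k\<close> in the cone spanned by the bases (\<open>integer_decomposition\<close>), where the height of a
  vector is the sum of its entries divided by \<open>r\<close>.

  For a 2-connected graph the cycle matroid is connected, in the sense that any edge can be turned into
  any other by a chain of basis exchanges (\<open>two_connected_matroid\<close>). Each exchange writes a difference of
  two unit vectors as a difference of two bases, so \<open>r\<close> times every unit vector is an integer combination
  of bases (\<open>connected_unit_multiple\<close>). Hence the cone has dimension \<open>e\<close>, and \<open>e\<close> is also the Krull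
  dimension of the semigroup ring: a chain of primes of length \<open>e\<close> arises by setting more and more of the
  variables to \<open>1\<close>, and a longer chain would yield more than \<open>e\<close> algebraically independent elements, against
  the polynomial growth of the semigroup (\<open>chain_length_le\<close>).

  The \<open>h\<close>-polynomial is then the numerator of the Ehrhart series of the cone. A regular triangulation,
  given by generic weights, is made half-open by means of a generic interior vector \<open>q\<close>, so that its cells
  partition the cone. The lattice points of a half-open cell are uniquely the sums of a point of its
  fundamental box and of rays of the cell, and so the coefficients of \<open>h\<close> count the box points by their
  height (\<open>slice_series\<close>).

  Upper bound (\<open>degree_h_poly_le\<close>): a box point of height at least \<open>e - 1\<close> would have a complement in its cell
  of height \<open>0\<close> or \<open>1\<close>. The generic vector rules out height \<open>0\<close>. In height \<open>1\<close> the complement is a basis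
  vector, and it would be a positive combination of all bases, although a basis spans an extreme ray.

  Lower bound (\<open>degree_h_poly_ge\<close>): complements also turn a lattice point of height \<open>e - 2\<close> in the interior of
  the cone into a box point of height at least \<open>2\<close>. If there are at most as many bases as edges, then the
  bases are linearly independent, or there is only one, and the base ring is a polynomial ring. Otherwise
  some spanning forest misses two edges whose fundamental circuits overlap, and locally the matroid looks
  like a theta graph or, for more general vectors than those of a graph, like the uniform matroid of rank
  two on four elements. In the first case half the
  sum of six suitable bases is integral, in the second case a third of it (\<open>core_exists\<close>); this is a
  lattice point of height \<open>m = 3\<close> or \<open>m = 2\<close>, and \<open>m + 2\<close> of the six bases are linearly independent.
  Completing these to a basis of the whole space raises the height and the dimension equally
  (\<open>core_interior_point\<close>).\<close>

section \<open>Cones and generic vectors\<close>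

lemma generic_positive_real:
  fixes P :: "real poly set"
  assumes "finite P" "0 \<notin> P"
  obtains t where "t > 0" "\<And>p. p \<in> P \<Longrightarrow> poly p t \<noteq> 0"
proof -
  have "finite (\<Union>p\<in>P. {t. poly p t = 0})"
    using assms by (auto intro!: poly_roots_finite)
  moreover have "infinite {0::real<..}"
    by (rule infinite_Ioi)
  ultimately obtain t where "t \<in> {0<..}" "t \<notin> (\<Union>p\<in>P. {t. poly p t = 0})"
    by (meson finite_subset subsetI)
  then show thesis using that by auto
qed

lemma coord_eqI:
  fixes B :: "'v::real_vector set"
  assumes "finite B" "independent B" "w = (\<Sum>b\<in>B. f b *\<^sub>R b)" "b \<in> B"
  shows "representation B w b = f b"
proof -
  have "representation B w b = (\<Sum>a\<in>B. f a * representation B a b)"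
    unfolding assms(3)
    by (subst real_vector.representation_sum)
       (auto simp: assms span_base span_scale real_vector.representation_scale)
  also have "\<dots> = (\<Sum>a\<in>B. if a = b then f a else 0)"
    by (intro sum.cong) (auto simp: real_vector.representation_basis assms)
  also have "\<dots> = f b" using assms by simp
  finally show ?thesis .
qed

definition cone_hull :: "'v::real_vector set \<Rightarrow> 'v set" where
  "cone_hull A = {\<Sum>a\<in>A. l a *\<^sub>R a | l. \<forall>a\<in>A. 0 \<le> l a}"

lemma cone_hullI: "(\<And>a. a \<in> A \<Longrightarrow> 0 \<le> l a) \<Longrightarrow> (\<Sum>a\<in>A. l a *\<^sub>R a) \<in> cone_hull A"
  unfolding cone_hull_def by blast

lemma cone_hull_span: "u \<in> cone_hull A \<Longrightarrow> u \<in> span A"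
  unfolding cone_hull_def by clarify (intro span_sum span_scale span_base)

lemma cone_hull_add: "u \<in> cone_hull A \<Longrightarrow> v \<in> cone_hull A \<Longrightarrow> u + v \<in> cone_hull A"
  unfolding cone_hull_def
proof clarify
  fix l m :: "'a \<Rightarrow> real" assume "\<forall>a\<in>A. 0 \<le> l a" "\<forall>a\<in>A. 0 \<le> m a"
  then show "\<exists>k. (\<Sum>a\<in>A. l a *\<^sub>R a) + (\<Sum>a\<in>A. m a *\<^sub>R a) = (\<Sum>a\<in>A. k a *\<^sub>R a) \<and> (\<forall>a\<in>A. 0 \<le> k a)"
    by (intro exI[of _ "\<lambda>a. l a + m a"]) (auto simp: scaleR_add_left sum.distrib)
qed

lemma cone_hull_scale: "u \<in> cone_hull A \<Longrightarrow> 0 \<le> s \<Longrightarrow> s *\<^sub>R u \<in> cone_hull A"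
  unfolding cone_hull_def
proof clarify
  fix l :: "'a \<Rightarrow> real" assume "\<forall>a\<in>A. 0 \<le> l a" "0 \<le> s"
  then show "\<exists>k. s *\<^sub>R (\<Sum>a\<in>A. l a *\<^sub>R a) = (\<Sum>a\<in>A. k a *\<^sub>R a) \<and> (\<forall>a\<in>A. 0 \<le> k a)"
    by (intro exI[of _ "\<lambda>a. s * l a"]) (auto simp: scaleR_sum_right)
qed

lemma cone_hull_mono:
  assumes "B \<subseteq> A" "finite A" shows "cone_hull B \<subseteq> cone_hull A"
proof
  fix u assume "u \<in> cone_hull B"
  then obtain l where l: "\<forall>a\<in>B. 0 \<le> l a" "u = (\<Sum>a\<in>B. l a *\<^sub>R a)"
    unfolding cone_hull_def by blast
  have "u = (\<Sum>a\<in>A. (if a \<in> B then l a else 0) *\<^sub>R a)"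
    unfolding l(2) using assms by (intro sum.mono_neutral_cong_left) auto
  then show "u \<in> cone_hull A" using l(1) by (auto intro: cone_hullI)
qed

lemma cone_hull_base:
  assumes "finite A" "a \<in> A"
  shows "a \<in> cone_hull A"
proof -
  have "(\<Sum>b\<in>{a}. 1 *\<^sub>R b) \<in> cone_hull {a}" by (rule cone_hullI) simp
  then show ?thesis using cone_hull_mono[of "{a}" A] assms by auto
qed

lemma cone_hull_zero: "0 \<in> cone_hull A"
  using cone_hullI[of A "\<lambda>_. 0"] by simp

lemma cone_hull_sum: "(\<And>i. i \<in> K \<Longrightarrow> w i \<in> cone_hull A) \<Longrightarrow> (\<Sum>i\<in>K. w i) \<in> cone_hull A"
  by (induction K rule: infinite_finite_induct) (auto intro: cone_hull_zero cone_hull_add)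

text \<open>A positive combination with the least number of vectors uses independent vectors: a linear relation
  among them could be subtracted until a coefficient vanishes.\<close>

lemma caratheodory_cone:
  assumes "finite A" "w \<in> cone_hull A"
  obtains B l where "B \<subseteq> A" "independent B" "\<And>b. b \<in> B \<Longrightarrow> 0 < l b" "w = (\<Sum>b\<in>B. l b *\<^sub>R b)"
proof -
  define P where "P n \<longleftrightarrow> (\<exists>B l. B \<subseteq> A \<and> card B = n \<and> (\<forall>b\<in>B. 0 < l b) \<and> w = (\<Sum>b\<in>B. l b *\<^sub>R b))" for n
  have pos: "P (card {a\<in>B. 0 < l a})"
    if "B \<subseteq> A" "\<forall>b\<in>B. 0 \<le> l b" "w = (\<Sum>b\<in>B. l b *\<^sub>R b)" for B l
  proof -
    have "w = (\<Sum>b\<in>{a\<in>B. 0 < l a}. l b *\<^sub>R b)"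
      unfolding that(3) using that(1,2) assms(1) finite_subset
      by (intro sum.mono_neutral_right) force+
    then show ?thesis unfolding P_def using that(1)
      by (intro exI[of _ "{a\<in>B. 0 < l a}"] exI[of _ l]) auto
  qed
  have "\<exists>n. P n"
    using assms(2) pos[OF subset_refl] unfolding cone_hull_def by blast
  then obtain n where n: "P n" "\<And>m. m < n \<Longrightarrow> \<not> P m"
    by (metis exists_least_iff)
  then obtain B l where B: "B \<subseteq> A" "card B = n" "\<forall>b\<in>B. 0 < l b" "w = (\<Sum>b\<in>B. l b *\<^sub>R b)"
    unfolding P_def by blast
  have fB: "finite B" using B(1) assms(1) finite_subset by blast
  have "independent B"
  proof
    assume "dependent B"
    then obtain u where u: "\<exists>b\<in>B. u b \<noteq> 0" "(\<Sum>b\<in>B. u b *\<^sub>R b) = 0"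
      using fB real_vector.dependent_finite by blast
    obtain v where v: "\<exists>b\<in>B. 0 < v b" "(\<Sum>b\<in>B. v b *\<^sub>R b) = 0"
    proof (cases "\<exists>b\<in>B. 0 < u b")
      case True
      then show thesis using that u by blast
    next
      case False
      then have "\<exists>b\<in>B. 0 < - u b" using u(1) by (metis neg_0_less_iff_less linorder_neqE)
      moreover have "(\<Sum>b\<in>B. (- u b) *\<^sub>R b) = 0" using u(2) by (simp add: sum_negf)
      ultimately show thesis using that[of "\<lambda>b. - u b"] by blast
    qed
    define C where "C = {b\<in>B. 0 < v b}"
    have C: "finite C" "C \<noteq> {}" using v(1) fB by (auto simp: C_def)
    obtain b0 where b0: "b0 \<in> C" "\<And>b. b \<in> C \<Longrightarrow> l b0 / v b0 \<le> l b / v b"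
      using ex_min_if_finite[of "(\<lambda>b. l b / v b) ` C"] C by (auto simp: not_less)
    define t where "t = l b0 / v b0"
    have t: "0 < t" using b0(1) B(3) by (auto simp: t_def C_def)
    define m where "m b = l b - t * v b" for b
    have "\<forall>b\<in>B. 0 \<le> m b"
    proof
      fix b assume b: "b \<in> B"
      show "0 \<le> m b"
      proof (cases "0 < v b")
        case True
        then have "t \<le> l b / v b" using b0(2) b by (auto simp: C_def t_def)
        then show ?thesis using True by (simp add: m_def field_simps)
      next
        case False
        then have "t * v b \<le> 0" using t by (simp add: mult_nonneg_nonpos)
        then show ?thesis using B(3) b by (auto simp: m_def intro: less_imp_le order_trans[of _ "l b"])
      qed
    qed
    moreover have "w = (\<Sum>b\<in>B. m b *\<^sub>R b)"
    proof -
      have "(\<Sum>b\<in>B. m b *\<^sub>R b) = (\<Sum>b\<in>B. l b *\<^sub>R b) - t *\<^sub>R (\<Sum>b\<in>B. v b *\<^sub>R b)"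
        by (simp add: m_def scaleR_diff_left sum_subtractf scaleR_sum_right)
      then show ?thesis using v(2) B(4) by simp
    qed
    ultimately have "P (card {b\<in>B. 0 < m b})" using pos B(1) by blast
    moreover have "{b\<in>B. 0 < m b} \<subset> B"
      proof -
      have "b0 \<in> B" "m b0 = 0" using b0(1) by (auto simp: m_def t_def C_def)
      then show ?thesis by force
    qed
    then have "card {b\<in>B. 0 < m b} < n"
      using psubset_card_mono fB B(2) by blast
    ultimately show False using n(2) by blast
  qed
  then show thesis using that B by blast
qed

locale cone_frames =
  fixes A :: "'v::real_vector set"
  assumes finA: "finite A"
begin

definition frames :: "'v set set" where
  "frames = {\<sigma>. \<sigma> \<subseteq> A \<and> independent \<sigma> \<and> A \<subseteq> span \<sigma>}"

abbreviation coord :: "'v set \<Rightarrow> 'v \<Rightarrow> 'v \<Rightarrow> real" where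
  "coord \<equiv> representation"

lemma finite_frames: "finite frames"
  using finA by (auto simp: frames_def intro: finite_subset[of _ "Pow A"])

lemma frameD:
  assumes "\<sigma> \<in> frames"
  shows "\<sigma> \<subseteq> A" "independent \<sigma>" "finite \<sigma>" "span \<sigma> = span A" "card \<sigma> = dim A"
proof -
  show 1: "\<sigma> \<subseteq> A" "independent \<sigma>" using assms by (auto simp: frames_def)
  show "finite \<sigma>" using 1 finA finite_subset by blast
  show 2: "span \<sigma> = span A"
    using assms 1 by (metis (mono_tags, lifting) frames_def mem_Collect_eq span_eq span_superset subset_trans)
  show "card \<sigma> = dim A"
    using 1 2 by (metis real_vector.dim_eq_card)
qed

lemma coord_sum:
  assumes "\<sigma> \<in> frames" "v \<in> span A"
  shows "(\<Sum>b\<in>\<sigma>. coord \<sigma> v b *\<^sub>R b) = v"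
  using frameD[OF assms(1)] assms(2) by (intro real_vector.sum_representation_eq) auto

lemma coord_add:
  assumes "\<sigma> \<in> frames" "u \<in> span A" "v \<in> span A"
  shows "coord \<sigma> (u + v) b = coord \<sigma> u b + coord \<sigma> v b"
  using frameD(2,4)[OF assms(1)] assms(2,3) by (simp add: real_vector.representation_add)

lemma coord_diff:
  assumes "\<sigma> \<in> frames" "u \<in> span A" "v \<in> span A"
  shows "coord \<sigma> (u - v) b = coord \<sigma> u b - coord \<sigma> v b"
  using frameD(2,4)[OF assms(1)] assms(2,3) by (simp add: real_vector.representation_diff)

lemma coord_scale:
  assumes "\<sigma> \<in> frames" "u \<in> span A"
  shows "coord \<sigma> (s *\<^sub>R u) b = s * coord \<sigma> u b"
  using frameD(2,4)[OF assms(1)] assms(2) by (simp add: real_vector.representation_scale)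

lemma coord_lincomb:
  assumes "\<sigma> \<in> frames" "\<And>a. a \<in> I \<Longrightarrow> g a \<in> span A"
  shows "coord \<sigma> (\<Sum>a\<in>I. f a *\<^sub>R g a) b = (\<Sum>a\<in>I. f a * coord \<sigma> (g a) b)"
  using frameD(2,4)[OF assms(1)] assms(2)
  by (simp add: real_vector.representation_sum real_vector.representation_scale span_scale)

lemma coord_basis:
  assumes "\<sigma> \<in> frames" "a \<in> \<sigma>"
  shows "coord \<sigma> a b = (if b = a then 1 else 0)"
  using frameD(2)[OF assms(1)] assms(2) by (simp add: real_vector.representation_basis)

lemma coord_cone:
  assumes "\<sigma> \<in> frames" "u \<in> span A" "\<And>b. b \<in> \<sigma> \<Longrightarrow> 0 \<le> coord \<sigma> u b"
  shows "u \<in> cone_hull A"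
proof -
  have "(\<Sum>b\<in>\<sigma>. coord \<sigma> u b *\<^sub>R b) \<in> cone_hull \<sigma>" by (intro cone_hullI assms(3))
  then show ?thesis using coord_sum[OF assms(1,2)] cone_hull_mono[OF frameD(1)[OF assms(1)] finA] by auto
qed

lemma extend_to_frame:
  assumes "B \<subseteq> A" "independent B"
  obtains \<sigma> where "\<sigma> \<in> frames" "B \<subseteq> \<sigma>"
proof -
  obtain \<sigma> where "B \<subseteq> \<sigma>" "\<sigma> \<subseteq> A" "independent \<sigma>" "A \<subseteq> span \<sigma>"
    using real_vector.maximal_independent_subset_extend[OF assms] .
  then show thesis using that by (simp add: frames_def)
qed

text \<open>A vector in the span of \<open>A\<close> is generic if and only if it lies on no hyperplane of this space that is
  spanned by elements of \<open>A\<close>.\<close>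

definition generic :: "'v \<Rightarrow> bool" where
  "generic w \<longleftrightarrow> (\<forall>\<sigma>\<in>frames. \<forall>b\<in>\<sigma>. coord \<sigma> w b \<noteq> 0)"

text \<open>Both existence lemmas take powers of a real number \<open>t\<close> with distinct exponents. Every condition then
  excludes only the roots of one nonzero polynomial in \<open>t\<close>, and there are finitely many conditions.\<close>

lemma exists_generic_weights:
  obtains c :: "'v \<Rightarrow> real" where "\<And>\<sigma> v. \<sigma> \<in> frames \<Longrightarrow> v \<in> A - \<sigma> \<Longrightarrow> (\<Sum>b\<in>\<sigma>. coord \<sigma> v b * c b) \<noteq> c v"
proof -
  obtain idx :: "'v \<Rightarrow> nat" where idx: "inj_on idx A"
    using finite_imp_inj_to_nat_seg[OF finA] by blast
  define p where "p \<sigma> v = Polynomial.monom 1 (idx v) - (\<Sum>b\<in>\<sigma>. Polynomial.monom (coord \<sigma> v b) (idx b))" for \<sigma> v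
  define X where "X = (SIGMA \<sigma>:frames. A - \<sigma>)"
  have finX: "finite X"
    unfolding X_def using finite_frames finA by (intro finite_SigmaI) auto
  have "p \<sigma> v \<noteq> 0" if "\<sigma> \<in> frames" "v \<in> A - \<sigma>" for \<sigma> v
  proof -
    have "Polynomial.coeff (\<Sum>b\<in>\<sigma>. Polynomial.monom (coord \<sigma> v b) (idx b)) (idx v) = 0"
      using that frameD(1)[OF that(1)] idx
      by (auto simp: coeff_sum intro!: sum.neutral) (metis inj_onD subsetD)
    then have "Polynomial.coeff (p \<sigma> v) (idx v) = 1" by (simp add: p_def)
    then show ?thesis by auto
  qed
  then have "0 \<notin> (\<lambda>(\<sigma>, v). p \<sigma> v) ` X" by (auto simp: X_def)
  then obtain t where t: "\<And>r. r \<in> (\<lambda>(\<sigma>, v). p \<sigma> v) ` X \<Longrightarrow> poly r t \<noteq> 0"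
    using generic_positive_real[of "(\<lambda>(\<sigma>, v). p \<sigma> v) ` X"] finX by blast
  show thesis
  proof (rule that[of "\<lambda>v. t ^ idx v"])
    fix \<sigma> v assume "\<sigma> \<in> frames" "v \<in> A - \<sigma>"
    then show "(\<Sum>b\<in>\<sigma>. coord \<sigma> v b * t ^ idx b) \<noteq> t ^ idx v"
      using t[of "p \<sigma> v"] by (force simp: X_def p_def poly_sum poly_monom)
  qed
qed

lemma exists_generic_point:
  obtains g :: "'v \<Rightarrow> real" where "\<And>a. a \<in> A \<Longrightarrow> 0 < g a" "generic (\<Sum>a\<in>A. g a *\<^sub>R a)"
proof -
  obtain idx :: "'v \<Rightarrow> nat" where idx: "inj_on idx A"
    using finite_imp_inj_to_nat_seg[OF finA] by blast
  define p where "p \<sigma> b = (\<Sum>a\<in>A. Polynomial.monom (coord \<sigma> a b) (idx a))" for \<sigma> b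
  define X where "X = (SIGMA \<sigma>:frames. \<sigma>)"
  have finX: "finite X"
    unfolding X_def using finite_frames frameD(3) by (intro finite_SigmaI) auto
  have "p \<sigma> b \<noteq> 0" if "\<sigma> \<in> frames" "b \<in> \<sigma>" for \<sigma> b
  proof -
    have bA: "b \<in> A" using that frameD(1) by blast
    have "Polynomial.coeff (p \<sigma> b) (idx b) = (\<Sum>a\<in>A. if a = b then coord \<sigma> a b else 0)"
      unfolding p_def coeff_sum using idx bA by (intro sum.cong) (auto simp: inj_on_def)
    also have "\<dots> = 1" using bA finA coord_basis[OF that] by simp
    finally show ?thesis by auto
  qed
  then have "0 \<notin> (\<lambda>(\<sigma>, v). p \<sigma> v) ` X" by (auto simp: X_def)
  then obtain t where t: "0 < t" "\<And>r. r \<in> (\<lambda>(\<sigma>, v). p \<sigma> v) ` X \<Longrightarrow> poly r t \<noteq> 0"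
    using generic_positive_real[of "(\<lambda>(\<sigma>, v). p \<sigma> v) ` X"] finX by blast
  show thesis
  proof (rule that[of "\<lambda>v. t ^ idx v"])
    show "0 < t ^ idx a" for a using t(1) by simp
    show "generic (\<Sum>a\<in>A. t ^ idx a *\<^sub>R a)"
      unfolding generic_def
    proof (intro ballI)
      fix \<sigma> b assume *: "\<sigma> \<in> frames" "b \<in> \<sigma>"
      have "poly (p \<sigma> b) t = (\<Sum>a\<in>A. t ^ idx a * coord \<sigma> a b)"
        by (simp add: p_def poly_sum poly_monom mult.commute)
      then show "coord \<sigma> (\<Sum>a\<in>A. t ^ idx a *\<^sub>R a) b \<noteq> 0"
        using t(2)[of "p \<sigma> b"] * by (subst coord_lincomb) (force simp: X_def span_base)+
    qed
  qed
qed

end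

section \<open>Regular triangulations and half-open cells\<close>

locale weighted_cone = cone_frames A for A :: "'v::real_vector set" +
  fixes ht :: "'v \<Rightarrow> real" and c :: "'v \<Rightarrow> real"
  assumes ht_linear: "linear ht"
    and ht_one: "a \<in> A \<Longrightarrow> ht a = 1"
    and c_generic: "\<sigma> \<in> frames \<Longrightarrow> v \<in> A - \<sigma> \<Longrightarrow> (\<Sum>b\<in>\<sigma>. coord \<sigma> v b * c b) \<noteq> c v"
begin

definition cost :: "'v set \<Rightarrow> 'v \<Rightarrow> real" where
  "cost \<sigma> w = (\<Sum>b\<in>\<sigma>. coord \<sigma> w b * c b)"

text \<open>The linear function \<open>cost \<sigma>\<close> interpolates the weights \<open>c\<close> on the frame \<open>\<sigma>\<close>. The cells are the simplices
  of the regular triangulation of \<open>A\<close> with lifting heights \<open>c\<close>, that is, the lower facets of the lifted points.\<close>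

definition cells :: "'v set set" where
  "cells = {\<sigma>\<in>frames. \<forall>v\<in>A - \<sigma>. cost \<sigma> v < c v}"

lemma cells_frames: "\<sigma> \<in> cells \<Longrightarrow> \<sigma> \<in> frames"
  by (simp add: cells_def)

lemma ht_coord:
  assumes "\<sigma> \<in> frames" "w \<in> span A"
  shows "(\<Sum>b\<in>\<sigma>. coord \<sigma> w b) = ht w"
proof -
  have "ht w = ht (\<Sum>b\<in>\<sigma>. coord \<sigma> w b *\<^sub>R b)" using coord_sum[OF assms] by simp
  also have "\<dots> = (\<Sum>b\<in>\<sigma>. coord \<sigma> w b * ht b)"
    by (simp add: linear_sum[OF ht_linear] linear_scale[OF ht_linear])
  also have "\<dots> = (\<Sum>b\<in>\<sigma>. coord \<sigma> w b)"
    using frameD(1)[OF assms(1)] by (intro sum.cong) (auto simp: ht_one)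
  finally show ?thesis by simp
qed

lemma cost_lincomb:
  assumes "\<sigma> \<in> frames" "I \<subseteq> A"
  shows "cost \<sigma> (\<Sum>a\<in>I. f a *\<^sub>R a) = (\<Sum>a\<in>I. f a * cost \<sigma> a)"
proof -
  have "cost \<sigma> (\<Sum>a\<in>I. f a *\<^sub>R a) = (\<Sum>b\<in>\<sigma>. \<Sum>a\<in>I. f a * (coord \<sigma> a b * c b))"
    unfolding cost_def using assms
    by (subst coord_lincomb) (auto simp: sum_distrib_right mult.assoc intro: span_base)
  also have "\<dots> = (\<Sum>a\<in>I. f a * cost \<sigma> a)"
    unfolding cost_def by (subst sum.swap) (simp add: sum_distrib_left)
  finally show ?thesis .
qed

lemma cost_vertex: "\<sigma> \<in> frames \<Longrightarrow> a \<in> \<sigma> \<Longrightarrow> cost \<sigma> a = c a"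
  unfolding cost_def using frameD(3)[of \<sigma>] by (simp add: coord_basis if_distrib[of "\<lambda>x. x * _"] cong: if_cong)

text \<open>In the interior of the cone of \<open>\<tau>\<close>, the number \<open>cost \<tau> w\<close> is a positive combination of the weights of \<open>\<tau>\<close>, while
  \<open>cost \<sigma>\<close> is at most \<open>c\<close> on \<open>A\<close> and less than \<open>c\<close> outside \<open>\<sigma>\<close>.\<close>

lemma cell_unique_aux:
  assumes "\<sigma> \<in> cells" "\<tau> \<in> cells" "w \<in> span A" "\<And>b. b \<in> \<tau> \<Longrightarrow> 0 < coord \<tau> w b"
  shows "cost \<sigma> w \<le> cost \<tau> w" "\<not> \<tau> \<subseteq> \<sigma> \<Longrightarrow> cost \<sigma> w < cost \<tau> w"
proof -
  note F = cells_frames[OF assms(1)] cells_frames[OF assms(2)]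
  note T = frameD[OF F(2)]
  have w: "cost \<sigma> w = (\<Sum>b\<in>\<tau>. coord \<tau> w b * cost \<sigma> b)"
    using cost_lincomb[OF F(1) T(1), of "coord \<tau> w"] coord_sum[OF F(2) assms(3)] by simp
  have le: "cost \<sigma> b \<le> c b" if "b \<in> \<tau>" for b
    using that assms(1) T(1) cost_vertex[OF F(1)] by (cases "b \<in> \<sigma>") (auto simp: cells_def intro: less_imp_le)
  show "cost \<sigma> w \<le> cost \<tau> w"
    unfolding w cost_def[of \<tau>] using assms(4) le by (intro sum_mono mult_left_mono) (auto intro: less_imp_le)
  assume "\<not> \<tau> \<subseteq> \<sigma>"
  then obtain b where b: "b \<in> \<tau>" "b \<notin> \<sigma>" by blast
  then have "cost \<sigma> b < c b" using assms(1) T(1) by (auto simp: cells_def)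
  then have "coord \<tau> w b * cost \<sigma> b < coord \<tau> w b * c b" using assms(4) b by simp
  then show "cost \<sigma> w < cost \<tau> w"
    unfolding w cost_def[of \<tau>] using assms(4) le T(3) b(1)
    by (intro sum_strict_mono_ex1) (auto intro!: mult_left_mono less_imp_le)
qed

lemma cell_unique:
  assumes "\<sigma> \<in> cells" "\<tau> \<in> cells" "w \<in> span A"
    "\<And>b. b \<in> \<sigma> \<Longrightarrow> 0 < coord \<sigma> w b" "\<And>b. b \<in> \<tau> \<Longrightarrow> 0 < coord \<tau> w b"
  shows "\<sigma> = \<tau>"
proof -
  have "\<tau> \<subseteq> \<sigma>" using cell_unique_aux[OF assms(1,2,3,5)] cell_unique_aux(1)[OF assms(2,1,3,4)] by force
  moreover have "\<sigma> \<subseteq> \<tau>" using cell_unique_aux(1)[OF assms(1,2,3,5)] cell_unique_aux[OF assms(2,1,3,4)] by force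
  ultimately show ?thesis by simp
qed

text \<open>A pivot step of the simplex algorithm that minimizes the cost of writing \<open>w\<close> as a positive combination of \<open>A\<close>.
  Since \<open>v\<close> has height \<open>1\<close>, some of its coordinates are positive, and the ratio test chooses the vector \<open>b0\<close>
  that \<open>v\<close> replaces.\<close>

lemma pivot:
  assumes s: "\<sigma> \<in> frames" and w: "w \<in> span A" "generic w" "\<And>b. b \<in> \<sigma> \<Longrightarrow> 0 < coord \<sigma> w b"
    and v: "v \<in> A - \<sigma>" "c v < cost \<sigma> v"
  shows "\<exists>\<tau>\<in>frames. (\<forall>b\<in>\<tau>. 0 < coord \<tau> w b) \<and> cost \<tau> w < cost \<sigma> w"
proof -
  note S = frameD[OF s]
  have vA: "v \<in> span A" using v by (auto intro: span_base)
  have v_sum: "v = (\<Sum>b\<in>\<sigma>. coord \<sigma> v b *\<^sub>R b)" using coord_sum[OF s vA] by simp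
  have "(\<Sum>b\<in>\<sigma>. coord \<sigma> v b) = 1" using ht_coord[OF s vA] ht_one v by simp
  then have "\<exists>b\<in>\<sigma>. 0 < coord \<sigma> v b"
    by (metis not_less sum_nonpos zero_less_one)
  define C where "C = {b\<in>\<sigma>. 0 < coord \<sigma> v b}"
  have "finite C" "C \<noteq> {}" using \<open>\<exists>b\<in>\<sigma>. _\<close> S(3) by (auto simp: C_def)
  then obtain b0 where b0: "b0 \<in> C"
      "\<And>b. b \<in> C \<Longrightarrow> coord \<sigma> w b0 / coord \<sigma> v b0 \<le> coord \<sigma> w b / coord \<sigma> v b"
    using ex_min_if_finite[of "(\<lambda>b. coord \<sigma> w b / coord \<sigma> v b) ` C"] by (auto simp: not_less)
  define t where "t = coord \<sigma> w b0 / coord \<sigma> v b0"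
  define m where "m b = coord \<sigma> w b - t * coord \<sigma> v b" for b
  define \<tau> where "\<tau> = insert v (\<sigma> - {b0})"
  have b0s: "b0 \<in> \<sigma>" "0 < coord \<sigma> v b0" using b0(1) by (auto simp: C_def)
  have t: "0 < t" using b0s w(3) by (simp add: t_def)
  have m0: "m b0 = 0" using b0s by (simp add: m_def t_def)
  have m_nonneg: "0 \<le> m b" if b: "b \<in> \<sigma>" for b
  proof (cases "0 < coord \<sigma> v b")
    case True
    then have "t \<le> coord \<sigma> w b / coord \<sigma> v b" using b0(2) b by (auto simp: C_def t_def)
    then show ?thesis using True by (simp add: m_def field_simps)
  next
    case False
    then have "t * coord \<sigma> v b \<le> 0" using t by (simp add: mult_nonneg_nonpos)
    then show ?thesis using w(3)[OF b] by (simp add: m_def)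
  qed
  have v_notin: "v \<notin> span (\<sigma> - {b0})"
  proof
    assume *: "v \<in> span (\<sigma> - {b0})"
    have "coord \<sigma> v = representation (\<sigma> - {b0}) v"
      by (rule real_vector.representation_extend) (use S(2) * in auto)
    then have "coord \<sigma> v b0 = 0"
      using real_vector.representation_ne_zero by fastforce
    then show False using b0s by simp
  qed
  have ind: "independent \<tau>"
    unfolding \<tau>_def
    by (intro real_vector.independent_insertI v_notin real_vector.independent_mono[OF S(2)]) auto
  have "b0 \<in> span \<tau>"
  proof -
    have "v = coord \<sigma> v b0 *\<^sub>R b0 + (\<Sum>b\<in>\<sigma> - {b0}. coord \<sigma> v b *\<^sub>R b)"
      using v_sum b0s S(3) by (simp add: sum.remove)
    then have "coord \<sigma> v b0 *\<^sub>R b0 = v - (\<Sum>b\<in>\<sigma> - {b0}. coord \<sigma> v b *\<^sub>R b)"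
      by (metis add_diff_cancel_right')
    also have "\<dots> \<in> span \<tau>"
      by (intro span_diff span_sum span_scale span_base) (auto simp: \<tau>_def)
    finally have "(1 / coord \<sigma> v b0) *\<^sub>R (coord \<sigma> v b0 *\<^sub>R b0) \<in> span \<tau>" by (rule span_scale)
    then show ?thesis using b0s by simp
  qed
  moreover have "\<sigma> - {b0} \<subseteq> span \<tau>" by (auto simp: \<tau>_def intro: span_base)
  ultimately have "\<sigma> \<subseteq> span \<tau>" by blast
  then have "span \<sigma> \<subseteq> span \<tau>" by (rule span_minimal) (rule subspace_span)
  then have tau: "\<tau> \<in> frames"
    using S(1,4) ind v(1) span_superset[of A] by (auto simp: frames_def \<tau>_def)
  define l where "l = m(v := t)"
  have finT: "finite \<tau>" using S(3) by (simp add: \<tau>_def)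
  have vs: "v \<notin> \<sigma> - {b0}" using v by simp
  have w_tau: "w = (\<Sum>b\<in>\<tau>. l b *\<^sub>R b)"
  proof -
    have "(\<Sum>b\<in>\<tau>. l b *\<^sub>R b) = t *\<^sub>R v + (\<Sum>b\<in>\<sigma> - {b0}. l b *\<^sub>R b)"
      unfolding \<tau>_def using S(3) vs by (subst sum.insert) (auto simp: l_def)
    also have "(\<Sum>b\<in>\<sigma> - {b0}. l b *\<^sub>R b) = (\<Sum>b\<in>\<sigma> - {b0}. m b *\<^sub>R b)"
      using vs by (intro sum.cong) (auto simp: l_def)
    also have "\<dots> = (\<Sum>b\<in>\<sigma>. m b *\<^sub>R b)" using b0s S(3) m0 by (simp add: sum.remove)
    also have "\<dots> = w - t *\<^sub>R v"
      using coord_sum[OF s w(1)] v_sum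
      by (simp add: m_def scaleR_diff_left sum_subtractf scaleR_sum_right[symmetric] scaleR_scaleR[symmetric] del: scaleR_scaleR)
    finally show ?thesis by simp
  qed
  have coord_tau: "coord \<tau> w b = l b" if "b \<in> \<tau>" for b
    using coord_eqI[OF finT ind w_tau that] .
  have pos: "\<forall>b\<in>\<tau>. 0 < coord \<tau> w b"
  proof
    fix b assume b: "b \<in> \<tau>"
    have "0 \<le> l b" using b t m_nonneg by (auto simp: l_def \<tau>_def)
    moreover have "coord \<tau> w b \<noteq> 0" using w(2) tau b by (auto simp: generic_def)
    ultimately show "0 < coord \<tau> w b" using coord_tau[OF b] by simp
  qed
  have "cost \<tau> w = (\<Sum>b\<in>\<tau>. l b * c b)" unfolding cost_def using coord_tau by simp
  also have "\<dots> = t * c v + (\<Sum>b\<in>\<sigma> - {b0}. l b * c b)"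
    unfolding \<tau>_def using S(3) vs by (subst sum.insert) (auto simp: l_def)
  also have "(\<Sum>b\<in>\<sigma> - {b0}. l b * c b) = (\<Sum>b\<in>\<sigma> - {b0}. m b * c b)"
    using vs by (intro sum.cong) (auto simp: l_def)
  also have "\<dots> = (\<Sum>b\<in>\<sigma>. m b * c b)" using b0s S(3) m0 by (simp add: sum.remove)
  also have "\<dots> = cost \<sigma> w - t * cost \<sigma> v"
    by (simp add: m_def cost_def left_diff_distrib sum_subtractf sum_distrib_left mult.assoc)
  finally have "cost \<tau> w = cost \<sigma> w - t * (cost \<sigma> v - c v)" by (simp add: algebra_simps)
  then have "cost \<tau> w < cost \<sigma> w" using t v(2) by simp
  then show ?thesis using tau pos by blast
qed

text \<open>Among the frames whose open cone contains \<open>w\<close>, one of least cost is a cell, as otherwise a pivot step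
  would decrease the cost.\<close>

lemma cell_exists:
  assumes "w \<in> cone_hull A" "generic w"
  shows "\<exists>\<sigma>\<in>cells. \<forall>b\<in>\<sigma>. 0 < coord \<sigma> w b"
proof -
  note wA = cone_hull_span[OF assms(1)]
  define X where "X = {\<sigma>\<in>frames. \<forall>b\<in>\<sigma>. 0 < coord \<sigma> w b}"
  have "finite X" using finite_frames by (simp add: X_def)
  moreover have "X \<noteq> {}"
  proof -
    obtain B l where B: "B \<subseteq> A" "independent B" "\<And>b. b \<in> B \<Longrightarrow> 0 < l b" "w = (\<Sum>b\<in>B. l b *\<^sub>R b)"
      using caratheodory_cone[OF finA assms(1)] by blast
    obtain \<sigma> where s: "\<sigma> \<in> frames" "B \<subseteq> \<sigma>" using extend_to_frame[OF B(1,2)] .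
    note S = frameD[OF s(1)]
    have "w = (\<Sum>b\<in>\<sigma>. (if b \<in> B then l b else 0) *\<^sub>R b)"
      unfolding B(4) using s(2) S(3) by (intro sum.mono_neutral_cong_left) auto
    from coord_eqI[OF S(3,2) this]
    have co: "coord \<sigma> w b = (if b \<in> B then l b else 0)" if "b \<in> \<sigma>" for b using that .
    have "\<forall>b\<in>\<sigma>. 0 < coord \<sigma> w b"
      using co assms(2) s(1) B(3) unfolding generic_def by (metis)
    then show ?thesis using s(1) by (auto simp: X_def)
  qed
  ultimately obtain \<sigma> where \<sigma>: "\<sigma> \<in> X" "\<And>\<tau>. \<tau> \<in> X \<Longrightarrow> cost \<sigma> w \<le> cost \<tau> w"
    using ex_min_if_finite[of "(\<lambda>\<sigma>. cost \<sigma> w) ` X"] by (auto simp: not_less)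
  have "\<sigma> \<in> cells"
  proof -
    have "cost \<sigma> v < c v" if v: "v \<in> A - \<sigma>" for v
    proof (rule ccontr)
      assume "\<not> cost \<sigma> v < c v"
      then have "c v < cost \<sigma> v" using c_generic[of \<sigma> v] v \<sigma>(1) by (auto simp: X_def cost_def)
      then obtain \<tau> where "\<tau> \<in> X" "cost \<tau> w < cost \<sigma> w"
        using pivot[of \<sigma> w v] v \<sigma>(1) wA assms(2) by (auto simp: X_def)
      then show False using \<sigma>(2)[of \<tau>] by simp
    qed
    then show ?thesis using \<sigma>(1) by (auto simp: cells_def X_def)
  qed
  then show ?thesis using \<sigma>(1) by (auto simp: X_def)
qed

text \<open>In other words, \<open>u + e p\<close> lies in the interior of the cone of \<open>\<sigma>\<close> for all small \<open>e > 0\<close>.\<close>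

definition half_open :: "'v \<Rightarrow> 'v set \<Rightarrow> 'v \<Rightarrow> bool" where
  "half_open p \<sigma> u \<longleftrightarrow> (\<forall>b\<in>\<sigma>. 0 < coord \<sigma> u b \<or> coord \<sigma> u b = 0 \<and> 0 < coord \<sigma> p b)"

lemma half_open_unique_cell:
  assumes p: "generic p" "p \<in> span A"
    and u: "\<forall>\<^sub>F e in at_right 0. u + e *\<^sub>R p \<in> cone_hull A"
  shows "\<exists>!\<sigma>. \<sigma> \<in> cells \<and> half_open p \<sigma> u"
proof -
  have "\<exists>e>0. u + e *\<^sub>R p \<in> cone_hull A"
    using eventually_happens[OF eventually_conj[OF u eventually_at_right_less]] by auto
  then obtain e where "u + e *\<^sub>R p \<in> cone_hull A" by blast
  then have "(u + e *\<^sub>R p) - e *\<^sub>R p \<in> span A"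
    by (intro span_diff span_scale cone_hull_span p)
  then have uA: "u \<in> span A" by simp
  \<comment> \<open>\<open>good e \<sigma> b\<close>: the coordinate of \<open>u + e p\<close> at \<open>b\<close> is nonzero and has the sign that \<open>half_open\<close> predicts.\<close>
  define good where "good e \<sigma> b \<longleftrightarrow> coord \<sigma> u b + e * coord \<sigma> p b \<noteq> 0 \<and>
     (0 < coord \<sigma> u b + e * coord \<sigma> p b \<longleftrightarrow> 0 < coord \<sigma> u b \<or> coord \<sigma> u b = 0 \<and> 0 < coord \<sigma> p b)" for e \<sigma> b
  have "\<forall>\<^sub>F e in at_right 0. good e \<sigma> b" if sb: "\<sigma> \<in> frames" "b \<in> \<sigma>" for \<sigma> b
  proof -
    let ?x = "coord \<sigma> u b" and ?y = "coord \<sigma> p b"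
    have y: "?y \<noteq> 0" using p(1) sb by (auto simp: generic_def)
    have lim: "((\<lambda>e. ?x + e * ?y) \<longlongrightarrow> ?x + 0 * ?y) (at_right 0)"
      by (intro tendsto_intros)
    consider "?x < 0" | "?x = 0" | "0 < ?x" by linarith
    then show ?thesis
    proof cases
      case 1
      then have "\<forall>\<^sub>F e in at_right 0. ?x + e * ?y < 0" using order_tendstoD(2)[OF lim, of 0] by simp
      then show ?thesis by eventually_elim (use 1 in \<open>auto simp: good_def\<close>)
    next
      case 2
      have "\<forall>\<^sub>F e in at_right (0::real). 0 < e" by (rule eventually_at_right_less)
      then show ?thesis by eventually_elim (use 2 y in \<open>auto simp: good_def zero_less_mult_iff\<close>)
    next
      case 3
      then have "\<forall>\<^sub>F e in at_right 0. 0 < ?x + e * ?y" using order_tendstoD(1)[OF lim, of 0] by simp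
      then show ?thesis by eventually_elim (use 3 in \<open>auto simp: good_def\<close>)
    qed
  qed
  then have "\<forall>\<^sub>F e in at_right 0. \<forall>\<sigma>\<in>frames. \<forall>b\<in>\<sigma>. good e \<sigma> b"
    using finite_frames frameD(3) by (intro eventually_ball_finite ballI) auto
  then have "\<forall>\<^sub>F e in at_right 0. (\<forall>\<sigma>\<in>frames. \<forall>b\<in>\<sigma>. good e \<sigma> b) \<and> u + e *\<^sub>R p \<in> cone_hull A"
    using u by (rule eventually_conj)
  from eventually_happens[OF this] obtain e where
    e: "\<And>\<sigma> b. \<sigma> \<in> frames \<Longrightarrow> b \<in> \<sigma> \<Longrightarrow> good e \<sigma> b" "u + e *\<^sub>R p \<in> cone_hull A"
    by auto
  let ?w = "u + e *\<^sub>R p"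
  have wA: "?w \<in> span A" by (rule cone_hull_span[OF e(2)])
  have co: "coord \<sigma> ?w b = coord \<sigma> u b + e * coord \<sigma> p b" if "\<sigma> \<in> frames" for \<sigma> b
    using that uA p(2) by (simp add: coord_add coord_scale span_scale)
  have "generic ?w" using e(1) co by (auto simp: generic_def good_def)
  have iff: "half_open p \<sigma> u \<longleftrightarrow> (\<forall>b\<in>\<sigma>. 0 < coord \<sigma> ?w b)" if "\<sigma> \<in> frames" for \<sigma>
    using e(1) that co unfolding half_open_def good_def by metis
  obtain \<sigma> where "\<sigma> \<in> cells" "\<forall>b\<in>\<sigma>. 0 < coord \<sigma> ?w b"
    using cell_exists[OF e(2) \<open>generic ?w\<close>] by blast
  then show ?thesis
    using iff cells_frames cell_unique[OF _ _ wA] by (metis (no_types, lifting))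
qed

end

section \<open>Lattice points and the Ehrhart series\<close>

locale lattice_cone = weighted_cone A ht c for A :: "'v::real_vector set" and ht c +
  fixes L :: "'v set" and g :: "'v \<Rightarrow> real"
  assumes A_lattice: "A \<subseteq> L"
    and zero_lattice: "0 \<in> L"
    and diff_lattice: "u \<in> L \<Longrightarrow> v \<in> L \<Longrightarrow> u - v \<in> L"
    and ht_int: "u \<in> L \<Longrightarrow> ht u \<in> \<int>"
    and finite_slice: "finite {u \<in> L \<inter> cone_hull A. ht u = real k}"
    and g_pos: "a \<in> A \<Longrightarrow> 0 < g a"
    and g_generic: "generic (\<Sum>a\<in>A. g a *\<^sub>R a)"
begin

definition q :: 'v where "q = (\<Sum>a\<in>A. g a *\<^sub>R a)"

definition slice :: "nat \<Rightarrow> 'v set" where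
  "slice k = {u \<in> L \<inter> cone_hull A. ht u = real k}"

text \<open>For \<open>\<tau> = {}\<close> these are all lattice points of height \<open>k\<close> in the half-open cell, for \<open>\<tau> = \<sigma>\<close> those of its
  fundamental box. The sets in between allow the rays of the cell to be split off one at a time.\<close>

definition cell_points :: "'v set \<Rightarrow> 'v set \<Rightarrow> nat \<Rightarrow> 'v set" where
  "cell_points \<sigma> \<tau> k =
     {u \<in> L \<inter> span A. ht u = real k \<and> half_open q \<sigma> u \<and> (\<forall>v\<in>\<tau>. \<not> half_open q \<sigma> (u - v))}"

lemma q_span: "q \<in> span A"
  unfolding q_def by (intro span_sum span_scale span_base)

lemma q_cone: "q \<in> cone_hull A"
  unfolding q_def using g_pos by (intro cone_hullI less_imp_le)

lemma q_generic: "generic q"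
  unfolding q_def by (rule g_generic)

lemma add_lattice: "u \<in> L \<Longrightarrow> v \<in> L \<Longrightarrow> u + v \<in> L"
  using diff_lattice[of u "0 - v"] diff_lattice[OF zero_lattice, of v] by simp

lemma sum_lattice: "(\<And>i. i \<in> I \<Longrightarrow> f i \<in> L) \<Longrightarrow> (\<Sum>i\<in>I. f i) \<in> L"
  by (induction I rule: infinite_finite_induct) (auto intro: add_lattice zero_lattice)

lemma int_scale_lattice:
  assumes "u \<in> L" "z \<in> \<int>"
  shows "z *\<^sub>R u \<in> L"
proof -
  have nat: "real n *\<^sub>R u \<in> L" for n
    by (induction n) (auto simp: scaleR_add_left zero_lattice assms intro: add_lattice)
  obtain i where i: "z = of_int i" using assms(2) by (auto elim: Ints_cases)
  show ?thesis
  proof (cases "0 \<le> i")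
    case True
    then show ?thesis using nat[of "nat i"] i by simp
  next
    case False
    then have "z *\<^sub>R u = 0 - real (nat (- i)) *\<^sub>R u" using i by simp
    then show ?thesis using diff_lattice[OF zero_lattice nat] by simp
  qed
qed

lemma half_open_nonneg: "half_open p \<sigma> u \<Longrightarrow> b \<in> \<sigma> \<Longrightarrow> 0 \<le> coord \<sigma> u b"
  unfolding half_open_def by (metis less_eq_real_def)

lemma half_open_cone: "\<sigma> \<in> frames \<Longrightarrow> u \<in> span A \<Longrightarrow> half_open p \<sigma> u \<Longrightarrow> u \<in> cone_hull A"
  using coord_cone half_open_nonneg by blast

lemma half_open_height: 
  assumes "\<sigma> \<in> frames" "u \<in> span A" "half_open p \<sigma> u" shows "0 \<le> ht u"
  unfolding ht_coord[OF assms(1,2), symmetric] using half_open_nonneg[OF assms(3)] by (rule sum_nonneg)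

lemma finite_cell_points: "\<sigma> \<in> frames \<Longrightarrow> finite (cell_points \<sigma> \<tau> k)"
  by (rule finite_subset[OF _ finite_slice[of k]]) (auto simp: cell_points_def intro: half_open_cone)

lemma slice_partition: "slice k = (\<Union>\<sigma>\<in>cells. cell_points \<sigma> {} k)"
proof (intro equalityI subsetI)
  fix u assume u: "u \<in> slice k"
  then have "u \<in> cone_hull A" by (simp add: slice_def)
  have "\<forall>\<^sub>F e in at_right 0. u + e *\<^sub>R q \<in> cone_hull A"
    using eventually_at_right_less[of "0::real"]
    by eventually_elim (intro cone_hull_add cone_hull_scale \<open>u \<in> cone_hull A\<close> q_cone less_imp_le)
  from half_open_unique_cell[OF q_generic q_span this]
  obtain \<sigma> where "\<sigma> \<in> cells" "half_open q \<sigma> u" by blast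
  then show "u \<in> (\<Union>\<sigma>\<in>cells. cell_points \<sigma> {} k)"
    using u cone_hull_span by (auto simp: slice_def cell_points_def)
next
  fix u assume "u \<in> (\<Union>\<sigma>\<in>cells. cell_points \<sigma> {} k)"
  then show "u \<in> slice k" using half_open_cone[OF cells_frames] by (auto simp: slice_def cell_points_def)
qed

lemma finite_cells: "finite cells"
  using finite_frames by (simp add: cells_def)

lemma card_slice: "card (slice k) = (\<Sum>\<sigma>\<in>cells. card (cell_points \<sigma> {} k))"
  unfolding slice_partition
proof (rule card_UN_disjoint[OF finite_cells])
  show "\<forall>\<sigma>\<in>cells. finite (cell_points \<sigma> {} k)" using finite_cell_points cells_frames by blast
  show "\<forall>\<sigma>\<in>cells. \<forall>\<tau>\<in>cells. \<sigma> \<noteq> \<tau> \<longrightarrow> cell_points \<sigma> {} k \<inter> cell_points \<tau> {} k = {}"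
  proof (intro ballI impI)
    fix \<sigma> \<tau> assume st: "\<sigma> \<in> cells" "\<tau> \<in> cells" "\<sigma> \<noteq> \<tau>"
    have False if u: "u \<in> cell_points \<sigma> {} k" "u \<in> cell_points \<tau> {} k" for u
    proof -
      have "u \<in> cone_hull A" using u(1) half_open_cone[OF cells_frames[OF st(1)]] by (auto simp: cell_points_def)
      then have "\<forall>\<^sub>F e in at_right 0. u + e *\<^sub>R q \<in> cone_hull A"
        using eventually_at_right_less[of "0::real"]
        by (auto elim!: eventually_mono intro!: cone_hull_add cone_hull_scale q_cone)
      from half_open_unique_cell[OF q_generic q_span this] show False
        using st u by (auto simp: cell_points_def)
    qed
    then show "cell_points \<sigma> {} k \<inter> cell_points \<tau> {} k = {}" by blast
  qed
qed

lemma coord_shift: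
  assumes "\<sigma> \<in> frames" "u \<in> span A" "v \<in> \<sigma>"
  shows "coord \<sigma> (u - v) b = coord \<sigma> u b - (if b = v then 1 else 0)"
    "coord \<sigma> (u + v) b = coord \<sigma> u b + (if b = v then 1 else 0)"
proof -
  have "v \<in> span A" using assms frameD(1) by (meson span_base subsetD)
  then show "coord \<sigma> (u - v) b = coord \<sigma> u b - (if b = v then 1 else 0)"
    "coord \<sigma> (u + v) b = coord \<sigma> u b + (if b = v then 1 else 0)"
    using assms by (simp_all add: coord_diff coord_add coord_basis)
qed

text \<open>Either subtracting \<open>v\<close> leads out of the half-open cell, or it leads to a point of the cell that is lower
  by one.\<close>

lemma cell_points_split:
  assumes s: "\<sigma> \<in> frames" and v: "v \<in> \<sigma>" "v \<notin> \<tau>" and t: "\<tau> \<subseteq> \<sigma>"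
  shows "card (cell_points \<sigma> \<tau> 0) = card (cell_points \<sigma> (insert v \<tau>) 0)"
    and "card (cell_points \<sigma> \<tau> (Suc k)) = card (cell_points \<sigma> (insert v \<tau>) (Suc k)) + card (cell_points \<sigma> \<tau> k)"
proof -
  have vA: "v \<in> A" "v \<in> span A" "v \<in> L" using v frameD(1)[OF s] A_lattice by (auto intro: span_base)
  have htv: "ht (u - v) = ht u - 1" "ht (u + v) = ht u + 1" for u
    using ht_one[OF vA(1)] linear_diff[OF ht_linear] linear_add[OF ht_linear] by auto
  have "cell_points \<sigma> \<tau> 0 = cell_points \<sigma> (insert v \<tau>) 0"
  proof -
    have "\<not> half_open q \<sigma> (u - v)" if "u \<in> cell_points \<sigma> \<tau> 0" for u
      using half_open_height[OF s, of "u - v" q] that htv vA by (auto simp: cell_points_def span_diff)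
    then show ?thesis by (auto simp: cell_points_def)
  qed
  then show "card (cell_points \<sigma> \<tau> 0) = card (cell_points \<sigma> (insert v \<tau>) 0)" by simp
  \<comment> \<open>Membership in the half-open cell is a condition on each coordinate separately, and a shift by
     \<open>v\<close> affects only the coordinate of \<open>v\<close>.\<close>
  have indep_shift: "half_open q \<sigma> (u - w) \<longleftrightarrow> half_open q \<sigma> (u + v - w)"
    if u: "u \<in> span A" "half_open q \<sigma> u" and w: "w \<in> \<tau>" for u w
  proof -
    have ws: "w \<in> \<sigma>" "w \<noteq> v" using w t v by auto
    have "coord \<sigma> (u + v - w) b = coord \<sigma> u b + (if b = v then 1 else 0) - (if b = w then 1 else 0)" for b
      using coord_shift(1)[OF s _ ws(1), of "u + v"] coord_shift(2)[OF s u(1) v(1)] u(1) vA by (simp add: span_add)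
    moreover have "coord \<sigma> (u - w) b = coord \<sigma> u b - (if b = w then 1 else 0)" for b
      using coord_shift(1)[OF s u(1) ws(1)] .
    ultimately have "0 < coord \<sigma> (u - w) b \<or> coord \<sigma> (u - w) b = 0 \<and> 0 < coord \<sigma> q b \<longleftrightarrow>
        0 < coord \<sigma> (u + v - w) b \<or> coord \<sigma> (u + v - w) b = 0 \<and> 0 < coord \<sigma> q b" if "b \<in> \<sigma>" for b
      using ws half_open_nonneg[OF u(2) that] u(2) that by (cases "b = v") (auto simp: half_open_def)
    then show ?thesis by (auto simp: half_open_def)
  qed
  have step: "half_open q \<sigma> (u + v)" if u: "u \<in> span A" "half_open q \<sigma> u" for u
    using u coord_shift(2)[OF s u(1) v(1)] unfolding half_open_def by auto
  have eq: "cell_points \<sigma> \<tau> (Suc k) = cell_points \<sigma> (insert v \<tau>) (Suc k) \<union> (\<lambda>u. u + v) ` cell_points \<sigma> \<tau> k"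
    (is "?l = ?r1 \<union> ?r2")
  proof (intro equalityI subsetI)
    fix u assume u: "u \<in> ?l"
    show "u \<in> ?r1 \<union> ?r2"
    proof (cases "half_open q \<sigma> (u - v)")
      case True
      have uv: "u - v \<in> span A" using u vA by (auto simp: cell_points_def span_diff)
      have "u - v \<in> cell_points \<sigma> \<tau> k"
        using u vA htv True indep_shift[OF uv True] uv
        by (auto simp: cell_points_def diff_lattice)
      then show ?thesis by (intro UnI2 image_eqI[of _ _ "u - v"]) auto
    next
      case False
      then show ?thesis using u by (auto simp: cell_points_def)
    qed
  next
    fix u assume "u \<in> ?r1 \<union> ?r2"
    then show "u \<in> ?l"
    proof
      assume "u \<in> ?r2"
      then obtain x where x: "u = x + v" "x \<in> cell_points \<sigma> \<tau> k" by blast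
      then show ?thesis using vA htv step indep_shift[of x]
        by (auto simp: cell_points_def add_lattice span_add)
    qed (auto simp: cell_points_def)
  qed
  have disj: "?r1 \<inter> ?r2 = {}" by (auto simp: cell_points_def)
  show "card ?l = card ?r1 + card (cell_points \<sigma> \<tau> k)"
    unfolding eq using finite_cell_points[OF s] disj
    by (subst card_Un_disjoint) (auto simp: card_image)
qed

abbreviation cell_series :: "'v set \<Rightarrow> 'v set \<Rightarrow> int fps" where
  "cell_series \<sigma> \<tau> \<equiv> Abs_fps (\<lambda>k. int (card (cell_points \<sigma> \<tau> k)))"

lemma cell_series_step:
  assumes "\<sigma> \<in> frames" "v \<in> \<sigma>" "v \<notin> \<tau>" "\<tau> \<subseteq> \<sigma>"
  shows "cell_series \<sigma> \<tau> * (1 - fps_X) = cell_series \<sigma> (insert v \<tau>)"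
proof (rule fps_ext)
  fix k
  show "fps_nth (cell_series \<sigma> \<tau> * (1 - fps_X)) k = fps_nth (cell_series \<sigma> (insert v \<tau>)) k"
    using cell_points_split[OF assms] by (cases k) (simp_all add: right_diff_distrib)
qed

lemma cell_series_box:
  assumes "\<sigma> \<in> frames"
  shows "cell_series \<sigma> {} * (1 - fps_X) ^ dim A = cell_series \<sigma> \<sigma>"
proof -
  have "cell_series \<sigma> {} * (1 - fps_X) ^ card \<tau> = cell_series \<sigma> \<tau>" if "finite \<tau>" "\<tau> \<subseteq> \<sigma>" for \<tau>
    using that
  proof (induction \<tau> rule: finite_induct)
    case (insert v \<tau>)
    have "cell_series \<sigma> {} * (1 - fps_X) ^ card (insert v \<tau>) = (cell_series \<sigma> {} * (1 - fps_X) ^ card \<tau>) * (1 - fps_X)"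
      using insert.hyps by (simp add: mult_ac)
    also have "cell_series \<sigma> {} * (1 - fps_X) ^ card \<tau> = cell_series \<sigma> \<tau>"
      using insert by blast
    also have "cell_series \<sigma> \<tau> * (1 - fps_X) = cell_series \<sigma> (insert v \<tau>)"
      using insert by (intro cell_series_step[OF assms]) auto
    finally show ?case .
  qed simp
  then show ?thesis using frameD(3,5)[OF assms] by (metis subset_refl)
qed

text \<open>In a box, a coordinate lies in \<open>[0, 1)\<close> or in \<open>(0, 1]\<close>, according to the side of the facet on
  which the generic point \<open>q\<close> lies.\<close>

lemma box_iff:
  assumes s: "\<sigma> \<in> frames" and u: "u \<in> L" "u \<in> span A"
  shows "u \<in> cell_points \<sigma> \<sigma> k \<longleftrightarrow> ht u = real k \<and>
     (\<forall>b\<in>\<sigma>. if 0 < coord \<sigma> q b then 0 \<le> coord \<sigma> u b \<and> coord \<sigma> u b < 1 else 0 < coord \<sigma> u b \<and> coord \<sigma> u b \<le> 1)"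
    (is "_ \<longleftrightarrow> _ \<and> (\<forall>b\<in>\<sigma>. ?I b)")
proof -
  have "half_open q \<sigma> u \<and> (\<forall>v\<in>\<sigma>. \<not> half_open q \<sigma> (u - v)) \<longleftrightarrow> (\<forall>b\<in>\<sigma>. ?I b)"
  proof
    assume a: "half_open q \<sigma> u \<and> (\<forall>v\<in>\<sigma>. \<not> half_open q \<sigma> (u - v))"
    show "\<forall>b\<in>\<sigma>. ?I b"
    proof
      fix b assume b: "b \<in> \<sigma>"
      then obtain d where d: "d \<in> \<sigma>" "\<not> (0 < coord \<sigma> (u - b) d \<or> coord \<sigma> (u - b) d = 0 \<and> 0 < coord \<sigma> q d)"
        using a unfolding half_open_def by blast
      have "d = b" using d a coord_shift(1)[OF s u(2) b, of d] unfolding half_open_def by (auto split: if_splits)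
      then show "?I b" using d a b coord_shift(1)[OF s u(2) b, of b] unfolding half_open_def by auto
    qed
  next
    assume a: "\<forall>b\<in>\<sigma>. ?I b"
    have "\<not> half_open q \<sigma> (u - v)" if v: "v \<in> \<sigma>" for v
    proof
      assume "half_open q \<sigma> (u - v)"
      then show False using a v coord_shift(1)[OF s u(2) v, of v] unfolding half_open_def
        by (auto split: if_splits dest!: bspec[of _ _ v])
    qed
    moreover have "half_open q \<sigma> u" using a unfolding half_open_def by (fastforce split: if_splits)
    ultimately show "half_open q \<sigma> u \<and> (\<forall>v\<in>\<sigma>. \<not> half_open q \<sigma> (u - v))" by blast
  qed
  then show ?thesis using u by (auto simp: cell_points_def)
qed

lemma box_height_le:
  assumes s: "\<sigma> \<in> frames" and "cell_points \<sigma> \<sigma> k \<noteq> {}"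
  shows "k \<le> dim A"
proof -
  obtain u where u: "u \<in> cell_points \<sigma> \<sigma> k" using assms(2) by blast
  then have uL: "u \<in> L" "u \<in> span A" by (auto simp: cell_points_def)
  have "real k = (\<Sum>b\<in>\<sigma>. coord \<sigma> u b)"
    using ht_coord[OF s uL(2)] box_iff[OF s uL] u by simp
  also have "\<dots> \<le> (\<Sum>b\<in>\<sigma>. 1)"
    using box_iff[OF s uL] u by (intro sum_mono) (auto split: if_splits dest!: bspec)
  also have "\<dots> = real (dim A)" using frameD(5)[OF s] by simp
  finally show ?thesis by simp
qed

definition h_poly :: "int poly" where
  "h_poly = (\<Sum>k\<le>dim A. Polynomial.monom (\<Sum>\<sigma>\<in>cells. int (card (cell_points \<sigma> \<sigma> k))) k)"

lemma coeff_h_poly: "Polynomial.coeff h_poly k = (\<Sum>\<sigma>\<in>cells. int (card (cell_points \<sigma> \<sigma> k)))"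
proof -
  have "Polynomial.coeff h_poly k = (if k \<le> dim A then \<Sum>\<sigma>\<in>cells. int (card (cell_points \<sigma> \<sigma> k)) else 0)"
    by (simp add: h_poly_def coeff_sum)
  also have "\<dots> = (\<Sum>\<sigma>\<in>cells. int (card (cell_points \<sigma> \<sigma> k)))"
  proof (cases "k \<le> dim A")
    case False
    then have "cell_points \<sigma> \<sigma> k = {}" if "\<sigma> \<in> cells" for \<sigma>
      using box_height_le[OF cells_frames[OF that]] by blast
    then show ?thesis using False by simp
  qed simp
  finally show ?thesis .
qed

text \<open>The half-open cells partition the lattice points of the cone, and each cell contributes the generating
  function of its box, divided by \<open>1 - t\<close> once for each ray.\<close>

theorem slice_series:
  "Abs_fps (\<lambda>k. int (card (slice k))) * (1 - fps_X) ^ dim A = fps_of_poly h_poly"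
proof -
  have "Abs_fps (\<lambda>k. int (card (slice k))) = (\<Sum>\<sigma>\<in>cells. cell_series \<sigma> {})"
    by (intro fps_ext) (simp add: card_slice fps_sum_nth)
  then have "Abs_fps (\<lambda>k. int (card (slice k))) * (1 - fps_X) ^ dim A = (\<Sum>\<sigma>\<in>cells. cell_series \<sigma> \<sigma>)"
    using cell_series_box[OF cells_frames] by (simp add: sum_distrib_right)
  also have "\<dots> = fps_of_poly h_poly"
    by (intro fps_ext) (simp add: fps_sum_nth coeff_h_poly)
  finally show ?thesis .
qed

text \<open>The point \<open>u\<close> stays in the cone when it is moved against \<open>q\<close>, so it lies in a half-open cell with respect to
  \<open>- q\<close>. Rounding up its coordinates in this cell, strictly
  where \<open>q\<close> has a negative coordinate, and subtracting \<open>u\<close> gives a point in the box of the same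
  cell with respect to \<open>q\<close>. As every coordinate is rounded up to at least \<open>1\<close>, its height is at least \<open>dim A - m\<close>.\<close>

theorem degree_h_poly_ge:
  assumes u: "u \<in> L" "ht u = real m" and "m \<le> dim A"
    and int: "\<forall>\<^sub>F e in at_right 0. u - e *\<^sub>R q \<in> cone_hull A"
  shows "dim A - m \<le> Polynomial.degree h_poly"
proof -
  have "generic (- q)" using q_generic q_span unfolding generic_def
    by (metis coord_scale neg_equal_0_iff_equal scaleR_minus1_left mult_minus1)
  moreover have "\<forall>\<^sub>F e in at_right 0. u + e *\<^sub>R (- q) \<in> cone_hull A" using int by simp
  ultimately obtain \<sigma> where \<sigma>: "\<sigma> \<in> cells" "half_open (- q) \<sigma> u"
    using half_open_unique_cell[of "- q" u] q_span by (metis span_neg)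
  note s = cells_frames[OF \<sigma>(1)]
  note S = frameD[OF s]
  have "\<exists>e. u - e *\<^sub>R q \<in> cone_hull A"
    using eventually_happens[OF int] by auto
  then obtain e where "u - e *\<^sub>R q \<in> cone_hull A" by blast
  then have "(u - e *\<^sub>R q) + e *\<^sub>R q \<in> span A"
    by (intro span_add span_scale cone_hull_span q_span)
  then have uA: "u \<in> span A" by simp
  have cq: "coord \<sigma> (- q) b = - coord \<sigma> q b" for b
    using coord_scale[OF s q_span, of "-1"] by simp
  have q0: "coord \<sigma> q b \<noteq> 0" if "b \<in> \<sigma>" for b using q_generic s that by (auto simp: generic_def)
  define z where "z b = (if 0 < coord \<sigma> q b then \<lceil>coord \<sigma> u b\<rceil> - 1 else \<lfloor>coord \<sigma> u b\<rfloor>)" for b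
  have z: "0 \<le> z b" if "b \<in> \<sigma>" for b
    using \<sigma>(2) that q0[OF that] unfolding half_open_def cq z_def by fastforce
  define x where "x = (\<Sum>b\<in>\<sigma>. (1 + of_int (z b)) *\<^sub>R b) - u"
  have xL: "x \<in> L"
    unfolding x_def using S(1) A_lattice by (intro diff_lattice sum_lattice int_scale_lattice u) auto
  have sA: "(\<Sum>b\<in>\<sigma>. (1 + of_int (z b)) *\<^sub>R b) \<in> span A"
    using S(1) by (intro span_sum span_scale span_base) auto
  then have xA: "x \<in> span A" unfolding x_def by (intro span_diff uA)
  have cx: "coord \<sigma> x b = 1 + of_int (z b) - coord \<sigma> u b" if "b \<in> \<sigma>" for b
    unfolding x_def using coord_diff[OF s sA uA] coord_eqI[OF S(3,2) refl that] by simp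
  have ht_x: "ht x = (\<Sum>b\<in>\<sigma>. 1 + of_int (z b)) - real m"
    using ht_coord[OF s xA] ht_coord[OF s uA] cx u(2) by (simp add: sum_subtractf)
  define k where "k = dim A - m + (\<Sum>b\<in>\<sigma>. nat (z b))"
  have "(\<Sum>b\<in>\<sigma>. real_of_int (z b)) = real (\<Sum>b\<in>\<sigma>. nat (z b))"
    unfolding of_nat_sum using z by (intro sum.cong) auto
  then have "ht x = real k"
    using ht_x \<open>m \<le> dim A\<close> S(5) by (simp add: k_def sum.distrib of_nat_diff)
  moreover have "if 0 < coord \<sigma> q b then 0 \<le> coord \<sigma> x b \<and> coord \<sigma> x b < 1 else 0 < coord \<sigma> x b \<and> coord \<sigma> x b \<le> 1"
    if "b \<in> \<sigma>" for b
    unfolding cx[OF that] z_def by (simp; linarith)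
  ultimately have "x \<in> cell_points \<sigma> \<sigma> k" using box_iff[OF s xL xA] by blast
  then have "0 < card (cell_points \<sigma> \<sigma> k)" using finite_cell_points[OF s] by (auto simp: card_gt_0_iff)
  then have "0 < Polynomial.coeff h_poly k" unfolding coeff_h_poly
    using \<sigma>(1) finite_cells by (intro sum_pos2[of _ \<sigma>]) auto
  then have "k \<le> Polynomial.degree h_poly" by (intro le_degree) simp
  then show ?thesis by (simp add: k_def)
qed

text \<open>Subtracting a box point of height at least \<open>dim A - 1\<close> from the sum of the rays of its cell leaves a point \<open>x\<close>
  of the closed cell, of height at most \<open>1\<close>. If \<open>x = 0\<close>, all coordinates of \<open>q\<close> in the cell are negative,
  although \<open>q\<close> has positive height. If \<open>x\<close> has height \<open>1\<close>, it is an element of \<open>A\<close>, hence by extremality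
  a ray of the cell, and the signs of the coordinates of \<open>q\<close> contradict the extremality of \<open>x\<close>.\<close>

theorem degree_h_poly_le:
  assumes level_one: "\<And>u. u \<in> L \<Longrightarrow> u \<in> cone_hull A \<Longrightarrow> ht u = 1 \<Longrightarrow> u \<in> A"
    and extreme: "\<And>a m s b. a \<in> A \<Longrightarrow> (\<And>b. b \<in> A \<Longrightarrow> 0 \<le> m b) \<Longrightarrow> (\<Sum>b\<in>A. m b *\<^sub>R b) = s *\<^sub>R a
        \<Longrightarrow> b \<in> A \<Longrightarrow> b \<noteq> a \<Longrightarrow> m b = 0"
    and two: "a1 \<in> A" "a2 \<in> A" "a1 \<noteq> a2"
  shows "Polynomial.degree h_poly + 2 \<le> dim A"
proof -
  have ht_q: "0 < ht q"
  proof -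
    have "ht q = (\<Sum>a\<in>A. g a)"
      unfolding q_def by (simp add: linear_sum[OF ht_linear] linear_scale[OF ht_linear] ht_one)
    then show ?thesis using g_pos two finA by (auto intro!: sum_pos)
  qed
  have main: "k + 2 \<le> dim A" if s: "\<sigma> \<in> frames" and ne: "cell_points \<sigma> \<sigma> k \<noteq> {}" for \<sigma> k
  proof (rule ccontr)
    assume "\<not> k + 2 \<le> dim A"
    note S = frameD[OF s]
    obtain u where u: "u \<in> cell_points \<sigma> \<sigma> k" using ne by blast
    then have uL: "u \<in> L" "u \<in> span A" by (auto simp: cell_points_def)
    note ub = u[unfolded box_iff[OF s uL]]
    have q0: "coord \<sigma> q b \<noteq> 0" if "b \<in> \<sigma>" for b using q_generic s that by (auto simp: generic_def)
    define x where "x = (\<Sum>b\<in>\<sigma>. 1 *\<^sub>R b) - u"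
    have sA: "(\<Sum>b\<in>\<sigma>. 1 *\<^sub>R b) \<in> span A"
      using S(1) by (intro span_sum span_scale span_base) auto
    have xL: "x \<in> L" unfolding x_def using S(1) A_lattice by (intro diff_lattice sum_lattice uL) auto
    have xA: "x \<in> span A" unfolding x_def by (intro span_diff uL sA)
    have cx: "coord \<sigma> x b = 1 - coord \<sigma> u b" if "b \<in> \<sigma>" for b
      unfolding x_def using coord_diff[OF s sA uL(2)] coord_eqI[OF S(3,2) refl that, of "\<lambda>_. 1"] by simp
    have cx0: "0 \<le> coord \<sigma> x b" if "b \<in> \<sigma>" for b
      using cx[OF that] ub that by (auto split: if_splits dest!: bspec)
    have ht_x: "ht x = real (dim A) - real k"
      using ht_coord[OF s xA] ht_coord[OF s uL(2)] cx ub S(5) by (simp add: sum_subtractf)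
    moreover have "k \<le> dim A" using box_height_le[OF s ne] .
    ultimately consider "ht x = 0" | "ht x = 1" using \<open>\<not> k + 2 \<le> dim A\<close> by force
    then show False
    proof cases
      case 1
      then have "coord \<sigma> x b = 0" if "b \<in> \<sigma>" for b
        using ht_coord[OF s xA] cx0 that S(3) by (simp add: sum_nonneg_eq_0_iff)
      then have "coord \<sigma> q b < 0" if "b \<in> \<sigma>" for b
        using ub cx that q0[OF that] by (force split: if_splits dest!: bspec)
      then have "(\<Sum>b\<in>\<sigma>. coord \<sigma> q b) \<le> 0" by (intro sum_nonpos) (auto intro: less_imp_le)
      then show False using ht_coord[OF s q_span] ht_q by simp
    next
      case 2
      have x_cone: "x \<in> cone_hull A" using coord_cone[OF s xA cx0] .
      have x_in: "x \<in> A" using level_one[OF xL x_cone 2] .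
      have "x = (\<Sum>b\<in>A. (if b \<in> \<sigma> then coord \<sigma> x b else 0) *\<^sub>R b)"
        using coord_sum[OF s xA] S(1) finA
        by (subst sum.mono_neutral_cong_right[of A \<sigma> _ "\<lambda>b. coord \<sigma> x b *\<^sub>R b"]) auto
      then have x_only: "coord \<sigma> x b = 0" if "b \<in> \<sigma>" "b \<noteq> x" for b
        using extreme[of x "\<lambda>b. if b \<in> \<sigma> then coord \<sigma> x b else 0" 1 b] x_in cx0 that S(1)
        by (auto split: if_splits)
      have xs: "x \<in> \<sigma>"
      proof (rule ccontr)
        assume "x \<notin> \<sigma>"
        then have "(\<Sum>b\<in>\<sigma>. coord \<sigma> x b) = 0" using x_only by (intro sum.neutral) metis
        then show False using ht_coord[OF s xA] 2 by simp
      qed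
      have neg: "coord \<sigma> q b < 0" if "b \<in> \<sigma>" "b \<noteq> x" for b
        using ub cx x_only that q0[OF that(1)] by (force split: if_splits dest!: bspec)
      \<comment> \<open>So \<open>q\<close> lies beyond every facet except the one opposite to \<open>x\<close>, which makes \<open>x\<close> a positive
         combination of all of \<open>A\<close>.\<close>
      define m where "m b = g b + (if b \<in> \<sigma> \<and> b \<noteq> x then - coord \<sigma> q b else 0)" for b
      have m_pos: "0 < m b" if "b \<in> A" for b using g_pos[OF that] neg[of b] by (auto simp: m_def)
      have "(\<Sum>b\<in>A. m b *\<^sub>R b) = q + (\<Sum>b\<in>A. (if b \<in> \<sigma> \<and> b \<noteq> x then - coord \<sigma> q b else 0) *\<^sub>R b)"
        by (simp add: m_def q_def scaleR_add_left sum.distrib)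
      also have "(\<Sum>b\<in>A. (if b \<in> \<sigma> \<and> b \<noteq> x then - coord \<sigma> q b else 0) *\<^sub>R b) = (\<Sum>b\<in>\<sigma> - {x}. (- coord \<sigma> q b) *\<^sub>R b)"
        using S(1) finA by (intro sum.mono_neutral_cong_right) auto
      also have "\<dots> = coord \<sigma> q x *\<^sub>R x - q"
        using coord_sum[OF s q_span] S(3) xs by (simp add: sum.remove[of \<sigma> x] sum_negf algebra_simps)
      finally have "(\<Sum>b\<in>A. m b *\<^sub>R b) = coord \<sigma> q x *\<^sub>R x" by simp
      then have "m b = 0" if "b \<in> A" "b \<noteq> x" for b
        using extreme[of x m "coord \<sigma> q x" b] x_in m_pos that by (auto intro: less_imp_le)
      then have "b = x" if "b \<in> A" for b using m_pos that by force
      then show False using two by blast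
    qed
  qed
  show ?thesis
  proof (cases "h_poly = 0")
    case True
    have "2 \<le> dim A"
    proof -
      have "independent {a1, a2}"
      proof (rule independent_if_scalars_zero)
        fix f v assume z: "(\<Sum>x\<in>{a1, a2}. f x *\<^sub>R x) = 0" and v: "v \<in> {a1, a2}"
        have "f a1 *\<^sub>R a1 + f a2 *\<^sub>R a2 = 0" using z two by simp
        moreover have "ht (f a1 *\<^sub>R a1 + f a2 *\<^sub>R a2) = f a1 + f a2"
          by (simp add: linear_add[OF ht_linear] linear_scale[OF ht_linear] ht_one two)
        ultimately have h: "f a1 + f a2 = 0" using linear_0[OF ht_linear] by simp
        then have "f a2 = - f a1" by simp
        then have "f a1 *\<^sub>R (a1 - a2) = 0"
          using \<open>f a1 *\<^sub>R a1 + f a2 *\<^sub>R a2 = 0\<close> by (simp add: scaleR_diff_right)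
        then show "f v = 0" using two(3) h v by auto
      qed simp
      obtain \<tau> where t: "\<tau> \<in> frames" "{a1, a2} \<subseteq> \<tau>"
        using extend_to_frame[OF _ \<open>independent {a1, a2}\<close>] two by blast
      then show ?thesis using card_mono[OF frameD(3)[OF t(1)] t(2)] frameD(5)[OF t(1)] two(3) by simp
    qed
    then show ?thesis using True by simp
  next
    case False
    then have "Polynomial.coeff h_poly (Polynomial.degree h_poly) \<noteq> 0" by simp
    then obtain \<sigma> where "\<sigma> \<in> cells" "cell_points \<sigma> \<sigma> (Polynomial.degree h_poly) \<noteq> {}"
      unfolding coeff_h_poly by (metis (no_types, lifting) card.empty of_nat_0 sum.neutral)
    then show ?thesis using main cells_frames by blast
  qed
qed

end

section \<open>Matroids of vectors\<close>

locale linear_matroid =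
  fixes E :: "'x set" and \<rho> :: "'x \<Rightarrow> 'v::real_vector"
  assumes finE: "finite E" and inj: "inj_on \<rho> E"
begin

definition indep :: "'x set \<Rightarrow> bool" where
  "indep I \<longleftrightarrow> I \<subseteq> E \<and> independent (\<rho> ` I)"

abbreviation cl :: "'x set \<Rightarrow> 'v set" where
  "cl X \<equiv> span (\<rho> ` X)"

definition basis :: "'x set \<Rightarrow> bool" where
  "basis B \<longleftrightarrow> indep B \<and> \<rho> ` E \<subseteq> cl B"

definition bases :: "'x set set" where
  "bases = {B. basis B}"

lemma indep_subset: "indep I \<Longrightarrow> J \<subseteq> I \<Longrightarrow> indep J"
  unfolding indep_def using real_vector.independent_mono[of "\<rho> ` I" "\<rho> ` J"] by blast

lemma cl_mono: "X \<subseteq> Y \<Longrightarrow> cl X \<subseteq> cl Y"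
  by (intro span_mono image_mono)

lemma cl_base: "x \<in> X \<Longrightarrow> \<rho> x \<in> cl X"
  by (simp add: span_base)

lemma cl_trans: "\<rho> ` X \<subseteq> cl Y \<Longrightarrow> cl X \<subseteq> cl Y"
  by (intro span_minimal subspace_span)

lemma indep_finite: "indep I \<Longrightarrow> finite I"
  unfolding indep_def using finE finite_subset by blast

lemma indep_card_le:
  assumes "indep J" "I \<subseteq> E" "\<rho> ` J \<subseteq> cl I"
  shows "card J \<le> card I"
proof -
  have "card (\<rho> ` J) \<le> card (\<rho> ` I)"
    using real_vector.independent_span_bound[of "\<rho> ` I" "\<rho> ` J"] assms
      finite_subset[OF assms(2) finE]
    by (auto simp: indep_def)
  moreover have "card (\<rho> ` J) = card J" "card (\<rho> ` I) = card I"
    using card_image[OF inj_on_subset[OF inj]] assms(1,2) unfolding indep_def by blast+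
  ultimately show ?thesis by simp
qed

lemma indep_insert:
  assumes "indep I" "x \<in> E" "x \<notin> I"
  shows "indep (insert x I) \<longleftrightarrow> \<rho> x \<notin> cl I"
proof -
  have "\<rho> x \<notin> \<rho> ` I" using assms inj unfolding indep_def inj_on_def by blast
  then show ?thesis using assms real_vector.independent_insert[of "\<rho> x" "\<rho> ` I"]
    by (simp add: indep_def)
qed

lemma extend_indep:
  assumes "indep I" "I \<subseteq> X" "X \<subseteq> E"
  obtains J where "I \<subseteq> J" "J \<subseteq> X" "indep J" "\<rho> ` X \<subseteq> cl J"
proof -
  obtain B where B: "\<rho> ` I \<subseteq> B" "B \<subseteq> \<rho> ` X" "independent B" "\<rho> ` X \<subseteq> span B"
    using real_vector.maximal_independent_subset_extend[of "\<rho> ` I" "\<rho> ` X"] assms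
    unfolding indep_def by (metis image_mono)
  have "\<rho> ` {x\<in>X. \<rho> x \<in> B} = B" using B(2) by auto
  moreover have "I \<subseteq> {x\<in>X. \<rho> x \<in> B}" "{x\<in>X. \<rho> x \<in> B} \<subseteq> E" using B(1) assms by auto
  ultimately show thesis using that[of "{x\<in>X. \<rho> x \<in> B}"] B unfolding indep_def by auto
qed

lemma basis_indep: "basis B \<Longrightarrow> indep B"
  and basis_subset: "basis B \<Longrightarrow> B \<subseteq> E"
  and basis_span: "basis B \<Longrightarrow> \<rho> ` E \<subseteq> cl B"
  by (auto simp: basis_def indep_def)

lemma basis_finite: "basis B \<Longrightarrow> finite B"
  using basis_subset finE finite_subset by blast

lemma indep_card_le_basis: "indep I \<Longrightarrow> basis B \<Longrightarrow> card I \<le> card B"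
  by (rule indep_card_le[OF _ basis_subset]) (use basis_span[of B] in \<open>auto simp: indep_def\<close>)

lemma basis_card: "basis B \<Longrightarrow> basis C \<Longrightarrow> card B = card C"
  by (intro antisym indep_card_le_basis basis_indep)

lemma basisI_card:
  assumes "indep I" "basis B" "card B \<le> card I"
  shows "basis I"
proof -
  have "\<rho> x \<in> cl I" if x: "x \<in> E" for x
  proof (rule ccontr)
    assume n: "\<rho> x \<notin> cl I"
    then have "x \<notin> I" by (auto intro: cl_base)
    then have "indep (insert x I)" using indep_insert[OF assms(1) x] n by simp
    then show False using indep_card_le_basis[OF _ assms(2)] assms(3) \<open>x \<notin> I\<close> indep_finite[OF assms(1)]
      by force
  qed
  then show ?thesis using assms(1) by (auto simp: basis_def)
qed

lemma ex_basis: "\<exists>B. basis B"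
  using extend_indep[of "{}" E] by (metis basis_def empty_subsetI indep_def image_empty real_vector.independent_empty subset_refl)

lemma finite_bases: "finite bases"
  using finE basis_subset by (auto simp: bases_def intro: finite_subset[of _ "Pow E"])

text \<open>For \<open>x\<close> outside \<open>I\<close> in the span of \<open>I\<close>, this is the fundamental circuit of \<open>x\<close> with respect to \<open>I\<close>,
  without \<open>x\<close> itself.\<close>

definition supp :: "'x set \<Rightarrow> 'x \<Rightarrow> 'x set" where
  "supp I x = {y\<in>I. indep (insert x (I - {y}))}"

lemma supp_subset: "supp I x \<subseteq> I"
  by (auto simp: supp_def)

lemma supp_span:
  assumes "indep I" "x \<in> E" "x \<notin> I" "\<rho> x \<in> cl I"
  shows "\<rho> x \<in> cl (supp I x)"
proof -
  let ?c = "representation (\<rho> ` I) (\<rho> x)"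
  have I: "independent (\<rho> ` I)" "finite I" "inj_on \<rho> I"
    using assms(1) indep_finite inj by (auto simp: indep_def intro: inj_on_subset)
  have mem: "y \<in> supp I x" if y: "y \<in> I" "?c (\<rho> y) \<noteq> 0" for y
  proof -
    have img: "\<rho> ` (I - {y}) = \<rho> ` I - {\<rho> y}" using I(3) y by (auto simp: inj_on_def)
    have "\<rho> x \<notin> cl (I - {y})"
    proof
      assume *: "\<rho> x \<in> cl (I - {y})"
      have "?c = representation (\<rho> ` I - {\<rho> y}) (\<rho> x)"
        by (rule real_vector.representation_extend) (use I * img in auto)
      then show False using y(2) real_vector.representation_ne_zero by fastforce
    qed
    then show ?thesis using indep_insert[of "I - {y}" x] indep_subset[OF assms(1), of "I - {y}"] assms y
      by (auto simp: supp_def)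
  qed
  have "\<rho> x = (\<Sum>v\<in>\<rho> ` I. ?c v *\<^sub>R v)"
    using real_vector.sum_representation_eq[of "\<rho> ` I" "\<rho> x" "\<rho> ` I"] I assms(4) by auto
  also have "\<dots> = (\<Sum>v\<in>\<rho> ` supp I x. ?c v *\<^sub>R v)"
    using I mem supp_subset[of I x] by (intro sum.mono_neutral_right) auto
  also have "\<dots> \<in> cl (supp I x)" by (intro span_sum span_scale span_base)
  finally show ?thesis .
qed

lemma supp_minimal:
  assumes "indep I" "x \<in> E" "x \<notin> I" "X \<subseteq> I" "\<rho> x \<in> cl X"
  shows "supp I x \<subseteq> X"
proof
  fix y assume y: "y \<in> supp I x"
  show "y \<in> X"
  proof (rule ccontr)
    assume "y \<notin> X"
    then have "X \<subseteq> I - {y}" using assms(4) by blast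
    then have "\<rho> x \<in> cl (I - {y})" using assms(5) cl_mono by blast
    moreover have "\<rho> x \<notin> cl (I - {y})"
      using y indep_insert[of "I - {y}" x] indep_subset[OF assms(1), of "I - {y}"] assms(2,3)
      by (auto simp: supp_def)
    ultimately show False by simp
  qed
qed

section \<open>Integer decomposition\<close>

definition cover :: "nat \<Rightarrow> (nat \<Rightarrow> 'x set) \<Rightarrow> 'x \<Rightarrow> nat" where
  "cover k I x = (\<Sum>i<k. of_bool (x \<in> I i))"

text \<open>The states of an augmentation: \<open>I\<close> is the current family of independent sets, and \<open>x\<close> is an element
  that waits to be inserted into one of them. A step inserts it and throws out an element \<open>y\<close> of its
  circuit, which waits next.\<close>

inductive reach :: "nat \<Rightarrow> (nat \<Rightarrow> 'x set) \<Rightarrow> 'x \<Rightarrow> (nat \<Rightarrow> 'x set) \<Rightarrow> 'x \<Rightarrow> bool"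
  for k I0 x0 where
  start: "reach k I0 x0 I0 x0"
| step: "reach k I0 x0 I x \<Longrightarrow> i < k \<Longrightarrow> x \<notin> I i \<Longrightarrow> y \<in> supp (I i) x \<Longrightarrow>
    reach k I0 x0 (I(i := insert x (I i - {y}))) y"

lemma cover_upd:
  assumes "i < k"
  shows "cover k (I(i := X)) z + of_bool (z \<in> I i) = cover k I z + of_bool (z \<in> X)"
proof -
  have split: "cover k J z = of_bool (z \<in> J i) + (\<Sum>j\<in>{..<k} - {i}. of_bool (z \<in> J j))" for J
    unfolding cover_def using assms by (intro sum.remove) auto
  have "(\<Sum>j\<in>{..<k} - {i}. of_bool (z \<in> (I(i := X)) j)) = (\<Sum>j\<in>{..<k} - {i}. of_bool (z \<in> I j) :: nat)"
    by (intro sum.cong) auto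
  then show ?thesis unfolding split[of "I(i := X)"] split[of I] by (simp only: fun_upd_same ac_simps)
qed

lemma reach_invariant:
  assumes "reach k I0 x0 I x" "\<And>i. i < k \<Longrightarrow> indep (I0 i)" "x0 \<in> E"
  shows "(\<forall>i<k. indep (I i)) \<and> x \<in> E \<and> (\<forall>z. cover k I z + of_bool (z = x) = cover k I0 z + of_bool (z = x0))"
  using assms(1)
proof induction
  case start
  then show ?case using assms by simp
next
  case (step I x i y)
  have y: "y \<in> I i" "indep (insert x (I i - {y}))" using step.hyps(4) by (auto simp: supp_def)
  have "cover k (I(i := insert x (I i - {y}))) z + of_bool (z = y) = cover k I z + of_bool (z = x)" for z
    using cover_upd[OF step.hyps(2), of I "insert x (I i - {y})" z] y(1) step.hyps(3)
    by (cases "z = x"; cases "z = y"; cases "z \<in> I i") auto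
  then have "cover k (I(i := insert x (I i - {y}))) z + of_bool (z = y) = cover k I0 z + of_bool (z = x0)" for z
    using step.IH by metis
  moreover have "y \<in> E" using y step.IH step.hyps(2) unfolding indep_def by blast
  moreover have "\<forall>j<k. indep ((I(i := insert x (I i - {y}))) j)" using step.IH y(2) by simp
  ultimately show ?case by blast
qed

text \<open>Choose \<open>k\<close> independent sets that cover every \<open>x\<close> at most \<open>u x\<close> times and are as large as possible in
  total. Suppose that \<open>x0\<close> is covered too few times, and let \<open>R\<close> be the set of elements that can be made to
  wait, starting from \<open>x0\<close>. By maximality no waiting element can be inserted without throwing out another
  one, so each of the \<open>k\<close> sets spans \<open>R\<close> by its elements in \<open>R\<close>, and no basis has more elements in \<open>R\<close> than
  any of them. Averaging over the bases with the weights \<open>l\<close> bounds the sum of \<open>u\<close> over \<open>R\<close> by the number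
  of times that \<open>R\<close> is covered, contrary to the choice of \<open>x0\<close>. So every \<open>x\<close> is covered \<open>u x\<close> times,
  and by counting elements all \<open>k\<close> sets are bases.\<close>

theorem integer_decomposition:
  fixes u :: "'x \<Rightarrow> nat" and l :: "'x set \<Rightarrow> real"
  assumes l: "\<And>B. B \<in> bases \<Longrightarrow> 0 \<le> l B" "(\<Sum>B\<in>bases. l B) = real k"
    and u: "\<And>x. x \<in> E \<Longrightarrow> real (u x) = (\<Sum>B\<in>bases. l B * of_bool (x \<in> B))"
  shows "\<exists>I. (\<forall>i<k. I i \<in> bases) \<and> (\<forall>x\<in>E. u x = cover k I x)"
proof -
  define ok where "ok I \<longleftrightarrow> (\<forall>i<k. indep (I i)) \<and> (\<forall>x\<in>E. cover k I x \<le> u x)" for I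
  have "ok (\<lambda>_. {})" by (auto simp: ok_def indep_def cover_def real_vector.independent_empty)
  moreover have "ok I \<Longrightarrow> (\<Sum>x\<in>E. cover k I x) < Suc (\<Sum>x\<in>E. u x)" for I
    unfolding ok_def by (intro le_imp_less_Suc sum_mono) auto
  ultimately obtain I0 where I0: "ok I0" "\<And>I. ok I \<Longrightarrow> (\<Sum>x\<in>E. cover k I x) \<le> (\<Sum>x\<in>E. cover k I0 x)"
    using ex_has_greatest_nat[of ok "\<lambda>_. {}" "\<lambda>I. \<Sum>x\<in>E. cover k I x" "Suc (\<Sum>x\<in>E. u x)"] by (metis less_or_eq_imp_le)
  have full: "cover k I0 x0 = u x0" if x0: "x0 \<in> E" for x0
  proof (rule ccontr)
    assume "cover k I0 x0 \<noteq> u x0"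
    then have lt: "cover k I0 x0 < u x0" using I0(1) x0 by (auto simp: ok_def le_less)
    note inv = reach_invariant[OF _ _ x0, of k I0]
    have ind0: "\<And>i. i < k \<Longrightarrow> indep (I0 i)" using I0(1) by (auto simp: ok_def)
    \<comment> \<open>Otherwise the uncovered element could be added, against the choice of \<open>I0\<close>.\<close>
    have stuck: "\<rho> x \<in> cl (I i)" if r: "reach k I0 x0 I x" and i: "i < k" "x \<notin> I i" for I x i
    proof (rule ccontr)
      assume "\<rho> x \<notin> cl (I i)"
      note v = inv[OF r ind0]
      have ins: "indep (insert x (I i))" using v i \<open>\<rho> x \<notin> cl (I i)\<close> by (subst indep_insert) auto
      let ?J = "I(i := insert x (I i))"
      have cJ: "cover k ?J z = cover k I0 z + of_bool (z = x0)" for z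
      proof -
        have "cover k I z + of_bool (z = x) = cover k I0 z + of_bool (z = x0)" using v by blast
        then show ?thesis using cover_upd[OF i(1), of I "insert x (I i)" z] i(2) by (cases "z = x") auto
      qed
      have "ok ?J" unfolding ok_def cJ using v ins lt I0(1) by (auto simp: ok_def)
      then have "(\<Sum>x\<in>E. cover k ?J x) \<le> (\<Sum>x\<in>E. cover k I0 x)" by (rule I0(2))
      moreover have "(\<Sum>x\<in>E. cover k ?J x) = (\<Sum>x\<in>E. cover k I0 x) + 1"
        unfolding cJ using x0 finE by (simp add: sum.distrib of_bool_def)
      ultimately show False by simp
    qed
    define R where "R = {x. \<exists>I. reach k I0 x0 I x}"
    have R_E: "R \<subseteq> E" using inv ind0 by (auto simp: R_def)
    have x0R: "x0 \<in> R" by (auto simp: R_def intro: reach.start)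
    have claim: "\<rho> x \<in> cl (I i \<inter> R)" if r: "reach k I0 x0 I x" and i: "i < k" for I x i
    proof (cases "x \<in> I i")
      case True
      then show ?thesis using r by (intro cl_base) (auto simp: R_def)
    next
      case False
      note v = inv[OF r ind0]
      have "\<rho> x \<in> cl (supp (I i) x)" using supp_span stuck[OF r i False] v i False by blast
      moreover have "supp (I i) x \<subseteq> I i \<inter> R"
        unfolding R_def using supp_subset[of "I i" x] reach.step[OF r i False] by blast
      ultimately show ?thesis using cl_mono by blast
    qed
    have same: "cl (I i \<inter> R) = cl (I0 i \<inter> R)" if "reach k I0 x0 I x" "i < k" for I x i
      using that
    proof (induction arbitrary: i)
      case (step I x j y)
      show ?case
      proof (cases "i = j")
        case True
        let ?J = "I(j := insert x (I j - {y}))"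
        have rJ: "reach k I0 x0 ?J y" using reach.step step.hyps by blast
        have "?J j \<inter> R \<subseteq> insert x (I j \<inter> R)" by auto
        then have "\<rho> ` (?J j \<inter> R) \<subseteq> cl (I j \<inter> R)" using claim[OF step.hyps(1,2)] by (auto intro: cl_base)
        moreover have "I j \<inter> R \<subseteq> insert y (?J j \<inter> R)" by auto
        then have "\<rho> ` (I j \<inter> R) \<subseteq> cl (?J j \<inter> R)" using claim[OF rJ step.hyps(2)] by (auto intro: cl_base)
        ultimately have "cl (?J j \<inter> R) = cl (I j \<inter> R)" by (intro antisym cl_trans)
        then show ?thesis using True step by simp
      qed (use step in simp)
    qed simp
    have spans: "\<rho> ` R \<subseteq> cl (I0 i \<inter> R)" if i: "i < k" for i
      using claim[OF _ i] same[OF _ i] by (force simp: R_def)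
    define N where "N = (\<Sum>x\<in>R. cover k I0 x)"
    have finR: "finite R" using R_E finE finite_subset by blast
    have N: "N = (\<Sum>i<k. card (I0 i \<inter> R))"
      unfolding N_def cover_def by (subst sum.swap) (simp add: finR of_bool_def sum.If_cases Int_commute)
    have B_le: "real k * real (card (B \<inter> R)) \<le> real N" if B: "B \<in> bases" for B
    proof -
      have "card (B \<inter> R) \<le> card (I0 i \<inter> R)" if i: "i < k" for i
      proof (rule indep_card_le)
        show "indep (B \<inter> R)" using B indep_subset[of B "B \<inter> R"] basis_indep by (auto simp: bases_def)
      qed (use R_E spans[OF i] in auto)
      then have "(\<Sum>i<k. card (B \<inter> R)) \<le> N" unfolding N by (intro sum_mono) auto
      then show ?thesis by (simp flip: of_nat_mult)
    qed
    have uR: "(\<Sum>x\<in>R. real (u x)) = (\<Sum>B\<in>bases. l B * real (card (B \<inter> R)))"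
    proof -
      have "(\<Sum>x\<in>R. real (u x)) = (\<Sum>x\<in>R. \<Sum>B\<in>bases. l B * of_bool (x \<in> B))"
        using u R_E by (intro sum.cong) auto
      also have "\<dots> = (\<Sum>B\<in>bases. l B * (\<Sum>x\<in>R. of_bool (x \<in> B)))"
        by (subst sum.swap) (simp add: sum_distrib_left)
      also have "\<dots> = (\<Sum>B\<in>bases. l B * real (card (B \<inter> R)))"
        by (simp add: finR of_bool_def sum.If_cases Int_commute)
      finally show ?thesis .
    qed
    have "real k * (\<Sum>x\<in>R. real (u x)) = (\<Sum>B\<in>bases. l B * (real k * real (card (B \<inter> R))))"
      unfolding uR by (simp add: sum_distrib_left mult_ac)
    also have "\<dots> \<le> (\<Sum>B\<in>bases. l B * real N)"
      using B_le l(1) by (intro sum_mono mult_left_mono)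
    also have "\<dots> = real k * real N" using l(2) by (simp flip: sum_distrib_right)
    finally have le: "real k * (\<Sum>x\<in>R. real (u x)) \<le> real k * real N" .
    have "N < (\<Sum>x\<in>R. u x)"
      unfolding N_def using finR x0R lt I0(1) R_E
      by (intro sum_strict_mono_ex1) (auto simp: ok_def)
    then have "real N < (\<Sum>x\<in>R. real (u x))" by (simp flip: of_nat_sum)
    moreover have "k \<noteq> 0"
    proof
      assume "k = 0"
      then have "\<forall>B\<in>bases. l B = 0" using l finite_bases by (simp add: sum_nonneg_eq_0_iff)
      then have "real (u x0) = 0" unfolding u[OF x0] by simp
      then show False using lt by simp
    qed
    ultimately show False using le by simp
  qed
  obtain B0 where B0: "basis B0" using ex_basis by blast
  have le: "card (I0 i) \<le> card B0" if "i < k" for i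
    using indep_card_le_basis[OF _ B0] I0(1) that by (auto simp: ok_def)
  have tot: "(\<Sum>i<k. card (I0 i)) = (\<Sum>i<k. card B0)"
  proof -
    have card_sum: "(\<Sum>x\<in>E. of_bool (x \<in> I)) = card I" if "I \<subseteq> E" for I
      using that finE by (simp add: of_bool_def sum.If_cases Int_absorb1)
    have "(\<Sum>i<k. card (I0 i)) = (\<Sum>i<k. \<Sum>x\<in>E. of_bool (x \<in> I0 i))"
      using I0(1) card_sum by (intro sum.cong) (auto simp: ok_def indep_def)
    also have "\<dots> = (\<Sum>x\<in>E. u x)" using full unfolding cover_def by (subst sum.swap) simp
    finally have "real (\<Sum>i<k. card (I0 i)) = (\<Sum>x\<in>E. real (u x))" by simp
    also have "\<dots> = (\<Sum>x\<in>E. \<Sum>B\<in>bases. l B * of_bool (x \<in> B))" using u by simp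
    also have "\<dots> = (\<Sum>B\<in>bases. l B * (\<Sum>x\<in>E. of_bool (x \<in> B)))"
      by (subst sum.swap) (simp add: sum_distrib_left)
    also have "\<dots> = (\<Sum>B\<in>bases. l B * real (card B0))"
    proof (intro sum.cong refl)
      fix B assume "B \<in> bases"
      then have "B \<subseteq> E" "card B = card B0" using basis_subset basis_card[OF _ B0] by (auto simp: bases_def)
      then show "l B * (\<Sum>x\<in>E. of_bool (x \<in> B)) = l B * real (card B0)"
        using finE by (simp add: of_bool_def sum.If_cases Int_absorb1)
    qed
    also have "\<dots> = real (\<Sum>i<k. card B0)" using l(2) by (simp flip: sum_distrib_right)
    finally show ?thesis by (simp only: of_nat_eq_iff)
  qed
  have "card (I0 i) = card B0" if i: "i < k" for i
  proof (rule ccontr)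
    assume "card (I0 i) \<noteq> card B0"
    then have "card (I0 i) < card B0" using le[OF i] by simp
    then have "(\<Sum>i<k. card (I0 i)) < (\<Sum>i<k. card B0)"
      using le i by (intro sum_strict_mono_ex1) auto
    then show False using tot by simp
  qed
  then have "\<forall>i<k. I0 i \<in> bases"
    using basisI_card[OF _ B0] I0(1) by (auto simp: bases_def ok_def)
  then show ?thesis using full by (intro exI[of _ I0]) auto
qed

section \<open>Connected matroids and cores\<close>

lemma basis_exchange:
  assumes "basis B" "g \<in> E - B"
  shows "f \<in> supp B g \<longleftrightarrow> f \<in> B \<and> basis (insert g (B - {f}))"
proof -
  have "basis (insert g (B - {f}))" if "f \<in> B" "indep (insert g (B - {f}))"
  proof (rule basisI_card[OF that(2) assms(1)])
    show "card B \<le> card (insert g (B - {f}))"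
      using that(1) assms(2) basis_finite[OF assms(1)] card_Suc_Diff1[of B f] by simp
  qed
  then show ?thesis unfolding supp_def using basis_indep by blast
qed

lemma basis_supp_span: "basis B \<Longrightarrow> g \<in> E - B \<Longrightarrow> \<rho> g \<in> cl (supp B g)"
  using supp_span[of B g] basis_indep basis_span by blast

lemma basis_supp_minimal: "basis B \<Longrightarrow> g \<in> E - B \<Longrightarrow> X \<subseteq> B \<Longrightarrow> \<rho> g \<in> cl X \<Longrightarrow> supp B g \<subseteq> X"
  using supp_minimal[of B g X] basis_indep by blast

lemma basis_double_exchange:
  assumes B: "basis B" and g: "g1 \<in> E - B" "g2 \<in> E - B" "g1 \<noteq> g2"
    and f: "f1 \<in> supp B g1" "f2 \<in> supp B g2" "f1 \<notin> supp B g2"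
  shows "basis (insert g2 (insert g1 (B - {f1}) - {f2}))"
proof -
  let ?B = "insert g1 (B - {f1})"
  have B': "basis ?B" using f(1) basis_exchange[OF B g(1)] by blast
  have g2: "g2 \<in> E - ?B" using g by blast
  have sub: "supp B g2 \<subseteq> ?B" using f(3) supp_subset[of B g2] by blast
  have le: "supp ?B g2 \<subseteq> supp B g2"
    by (rule basis_supp_minimal[OF B' g2 sub basis_supp_span[OF B g(2)]])
  have "f2 \<in> supp ?B g2"
  proof (rule ccontr)
    assume "f2 \<notin> supp ?B g2"
    then have "supp ?B g2 \<subseteq> supp B g2 - {f2}" using le by blast
    then have "\<rho> g2 \<in> cl (supp B g2 - {f2})" using basis_supp_span[OF B' g2] cl_mono by blast
    then have "supp B g2 \<subseteq> supp B g2 - {f2}"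
      by (rule basis_supp_minimal[OF B g(2), rotated]) (use supp_subset[of B g2] in blast)
    then show False using f(2) by blast
  qed
  then show ?thesis using basis_exchange[OF B' g2] by blast
qed

definition exchange_rel :: "('x \<times> 'x) set" where
  "exchange_rel = {(f, g). f \<in> E \<and> g \<in> E \<and> (\<exists>B. basis B \<and> f \<in> B \<and> g \<notin> B \<and> basis (insert g (B - {f})))}"

text \<open>Equivalent to the usual condition that any two elements lie in a common circuit: distinct \<open>f\<close> and \<open>g\<close> are
  related by \<open>exchange_rel\<close> if and only if some circuit contains both.\<close>

definition connected :: bool where
  "connected \<longleftrightarrow> E \<times> E \<subseteq> exchange_rel\<^sup>*"

definition lattice :: "('x \<Rightarrow> int) set" where
  "lattice = {v. \<exists>m. \<forall>x. v x = (\<Sum>B\<in>bases. m B * of_bool (x \<in> B))}"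

lemma lattice_add: "v \<in> lattice \<Longrightarrow> w \<in> lattice \<Longrightarrow> (\<lambda>x. v x + w x) \<in> lattice"
  unfolding lattice_def
proof clarify
  fix m n assume "\<forall>x. v x = (\<Sum>B\<in>bases. m B * of_bool (x \<in> B))" "\<forall>x. w x = (\<Sum>B\<in>bases. n B * of_bool (x \<in> B))"
  then show "\<exists>k. \<forall>x. v x + w x = (\<Sum>B\<in>bases. k B * of_bool (x \<in> B))"
    by (intro exI[of _ "\<lambda>B. m B + n B"]) (auto simp: algebra_simps sum.distrib)
qed

lemma lattice_uminus: "v \<in> lattice \<Longrightarrow> (\<lambda>x. - v x) \<in> lattice"
  unfolding lattice_def
proof clarify
  fix m assume "\<forall>x. v x = (\<Sum>B\<in>bases. m B * of_bool (x \<in> B))"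
  then show "\<exists>k. \<forall>x. - v x = (\<Sum>B\<in>bases. k B * of_bool (x \<in> B))"
    by (intro exI[of _ "\<lambda>B. - m B"]) (auto simp: sum_negf)
qed

lemma lattice_zero: "(\<lambda>_. 0) \<in> lattice"
  unfolding lattice_def by (auto intro!: exI[of _ "\<lambda>_. 0"])

lemma lattice_basis: "basis B \<Longrightarrow> (\<lambda>x. of_bool (x \<in> B)) \<in> lattice"
  unfolding lattice_def
proof (clarify, rule exI[of _ "\<lambda>C. of_bool (C = B)"], rule allI)
  fix x assume "basis B"
  have "(\<Sum>C\<in>bases. of_bool (C = B) * of_bool (x \<in> C)) = (\<Sum>C\<in>bases. if C = B then of_bool (x \<in> C) else (0::int))"
    by (intro sum.cong) auto
  also have "\<dots> = of_bool (x \<in> B)" using \<open>basis B\<close> finite_bases by (simp add: bases_def)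
  finally show "of_bool (x \<in> B) = (\<Sum>C\<in>bases. of_bool (C = B) * of_bool (x \<in> C) :: int)" by simp
qed

lemma lattice_sum: "(\<And>i. i \<in> I \<Longrightarrow> (\<lambda>x. v i x) \<in> lattice) \<Longrightarrow> (\<lambda>x. \<Sum>i\<in>I. v i x) \<in> lattice"
  by (induction I rule: infinite_finite_induct) (auto intro: lattice_zero lattice_add)

text \<open>An exchange of \<open>f\<close> for \<open>g\<close> writes \<open>e_f - e_g\<close> as a difference of two bases; connectedness then
  allows every element of a basis to be replaced by \<open>f\<close>.\<close>

lemma connected_unit_multiple:
  assumes "connected" "f \<in> E" "basis B"
  shows "(\<lambda>x. int (card B) * of_bool (x = f)) \<in> lattice"
proof -
  have diff: "(\<lambda>x. of_bool (x = f) - of_bool (x = g) :: int) \<in> lattice" if "g \<in> E" for g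
  proof -
    have "(f, g) \<in> exchange_rel\<^sup>*" using assms(1,2) that by (auto simp: connected_def)
    then show ?thesis
    proof induction
      case base
      then show ?case using lattice_zero by simp
    next
      case (step g h)
      then obtain C where C: "basis C" "g \<in> C" "h \<notin> C" "basis (insert h (C - {g}))"
        by (auto simp: exchange_rel_def)
      have "(\<lambda>x. of_bool (x \<in> C) + - of_bool (x \<in> insert h (C - {g})) :: int) \<in> lattice"
        by (intro lattice_add lattice_uminus lattice_basis C)
      moreover have "(of_bool (x \<in> C) + - of_bool (x \<in> insert h (C - {g})) :: int) = of_bool (x = g) - of_bool (x = h)" for x
        using C(2,3) by (cases "x = g"; cases "x = h") auto
      ultimately have "(\<lambda>x. of_bool (x = g) - of_bool (x = h) :: int) \<in> lattice" by simp
      from lattice_add[OF step.IH this] show ?case by simp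
    qed
  qed
  have "(\<lambda>x. of_bool (x \<in> B) + (\<Sum>g\<in>B. of_bool (x = f) - of_bool (x = g)) :: int) \<in> lattice"
    using basis_subset[OF assms(3)] by (intro lattice_add lattice_basis lattice_sum diff assms(3)) auto
  moreover have "(of_bool (x \<in> B) + (\<Sum>g\<in>B. of_bool (x = f) - of_bool (x = g)) :: int) = int (card B) * of_bool (x = f)" for x
  proof -
    have "(\<Sum>g\<in>B. of_bool (x = g) :: int) = of_bool (x \<in> B)"
      using basis_finite[OF assms(3)] by (simp add: of_bool_def sum.If_cases)
    then show ?thesis by (simp add: sum_subtractf)
  qed
  ultimately show ?thesis by simp
qed

text \<open>The values of \<open>\<phi>\<close> on all integer combinations of bases are zero, and \<open>card B\<close> times a unit vector is one.\<close>

lemma connected_orthogonal: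
  fixes \<phi> :: "'x \<Rightarrow> real"
  assumes "connected" "basis B" "f \<in> E" "\<And>C. basis C \<Longrightarrow> (\<Sum>x\<in>C. \<phi> x) = 0"
  shows "real (card B) * \<phi> f = 0"
proof -
  obtain m where m: "\<And>x. int (card B) * of_bool (x = f) = (\<Sum>C\<in>bases. m C * of_bool (x \<in> C))"
    using connected_unit_multiple[OF assms(1,3,2)] unfolding lattice_def by blast
  have "real (card B) * \<phi> f = (\<Sum>x\<in>E. real_of_int (int (card B) * of_bool (x = f)) * \<phi> x)"
  proof -
    have "(\<Sum>x\<in>E. real_of_int (int (card B) * of_bool (x = f)) * \<phi> x) = (\<Sum>x\<in>E. if x = f then real (card B) * \<phi> x else 0)"
      by (intro sum.cong) auto
    then show ?thesis using assms(3) finE by simp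
  qed
  also have "\<dots> = (\<Sum>x\<in>E. \<Sum>C\<in>bases. real_of_int (m C) * (of_bool (x \<in> C) * \<phi> x))"
    unfolding m by (simp add: sum_distrib_right mult.assoc)
  also have "\<dots> = (\<Sum>C\<in>bases. real_of_int (m C) * (\<Sum>x\<in>E. of_bool (x \<in> C) * \<phi> x))"
    by (subst sum.swap) (simp add: sum_distrib_left)
  also have "\<dots> = (\<Sum>C\<in>bases. real_of_int (m C) * (\<Sum>x\<in>C. \<phi> x))"
  proof (rule sum.cong[OF refl])
    fix C assume "C \<in> bases"
    then have "C \<subseteq> E" using basis_subset by (auto simp: bases_def)
    then have "(\<Sum>x\<in>E. of_bool (x \<in> C) * \<phi> x) = (\<Sum>x\<in>C. \<phi> x)"
      using finE by (intro sum.mono_neutral_cong_right) auto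
    then show "real_of_int (m C) * (\<Sum>x\<in>E. of_bool (x \<in> C) * \<phi> x) = real_of_int (m C) * (\<Sum>x\<in>C. \<phi> x)"
      by simp
  qed
  also have "\<dots> = 0" using assms(4) by (auto simp: bases_def intro!: sum.neutral)
  finally show ?thesis .
qed

text \<open>Otherwise every basis meets the fundamental circuit of \<open>g1\<close> in the same number of elements, because this
  circuit and its complement span complementary subspaces. Then some nonzero function that is constant on the
  circuit and constant outside sums to zero over every basis, against \<open>connected_orthogonal\<close>.\<close>

lemma overlapping_circuits:
  assumes con: "connected" and B: "basis B" and g: "g1 \<in> E - B" "g2 \<in> E - B" "g1 \<noteq> g2"
    and nonzero: "\<rho> g1 \<noteq> 0"
  shows "\<exists>g\<in>E - B. g \<noteq> g1 \<and> supp B g1 \<inter> supp B g \<noteq> {}"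
proof (rule ccontr)
  assume "\<not> ?thesis"
  then have disj: "supp B g1 \<inter> supp B g = {}" if "g \<in> E - B" "g \<noteq> g1" for g using that by blast
  let ?P = "supp B g1" and ?X = "insert g1 (supp B g1)"
  have P: "?P \<subseteq> B" by (rule supp_subset)
  have finB: "finite B" using basis_finite[OF B] .
  have finP: "finite ?P" using finite_subset[OF P finB] .
  have P0: "?P \<noteq> {}" using basis_supp_span[OF B g(1)] nonzero by auto
  have out: "\<rho> x \<in> cl (B - ?P)" if x: "x \<in> E - ?X" for x
  proof (cases "x \<in> B")
    case True
    then show ?thesis using x by (intro cl_base) auto
  next
    case False
    then have "supp B x \<subseteq> B - ?P" using disj[of x] x supp_subset[of B x] by blast
    then show ?thesis using basis_supp_span[OF B] x False cl_mono by blast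
  qed
  have card_X: "card (C \<inter> ?X) = card ?P" if C: "basis C" for C
  proof -
    have finC: "finite C" using basis_finite[OF C] .
    have "card (C \<inter> ?X) \<le> card ?P"
    proof (rule indep_card_le)
      show "indep (C \<inter> ?X)" using indep_subset[OF basis_indep[OF C]] by blast
      show "?P \<subseteq> E" using P basis_subset[OF B] by blast
      show "\<rho> ` (C \<inter> ?X) \<subseteq> cl ?P" using basis_supp_span[OF B g(1)] by (auto intro: cl_base)
    qed
    moreover have "card (C - ?X) \<le> card (B - ?P)"
    proof (rule indep_card_le)
      show "indep (C - ?X)" using indep_subset[OF basis_indep[OF C]] by blast
      show "B - ?P \<subseteq> E" using basis_subset[OF B] by blast
      show "\<rho> ` (C - ?X) \<subseteq> cl (B - ?P)" using out basis_subset[OF C] by blast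
    qed
    moreover have "card (C \<inter> ?X) + card (C - ?X) = card C"
      using card_Un_disjoint[of "C \<inter> ?X" "C - ?X"] finC by (simp add: Int_Diff_Un Int_Diff_disjoint)
    moreover have "card ?P + card (B - ?P) = card B"
      using card_Un_disjoint[of ?P "B - ?P"] finB finP P by (simp add: Un_absorb1)
    ultimately show ?thesis using basis_card[OF B C] by linarith
  qed
  define \<phi> where "\<phi> x = real (card B) * of_bool (x \<in> ?X) - real (card ?P)" for x
  have "(\<Sum>x\<in>C. \<phi> x) = 0" if C: "basis C" for C
  proof -
    have "(\<Sum>x\<in>C. of_bool (x \<in> ?X) :: real) = real (card (C \<inter> ?X))"
      using basis_finite[OF C] by (simp add: of_bool_def sum.If_cases Int_def)
    then have "(\<Sum>x\<in>C. \<phi> x) = real (card B) * real (card ?P) - real (card C) * real (card ?P)"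
      using card_X[OF C] by (simp add: \<phi>_def sum_subtractf flip: sum_distrib_left)
    then show ?thesis using basis_card[OF B C] by simp
  qed
  from connected_orthogonal[OF con B _ this, of g2]
  have "real (card B) * \<phi> g2 = 0" using g by blast
  moreover have "g2 \<notin> ?X" using g P by blast
  ultimately have "card B = 0 \<or> card ?P = 0" by (simp add: \<phi>_def)
  then show False using P0 P finB finP by auto
qed

text \<open>The sum of the six bases, scaled by \<open>m / 6\<close>, is a lattice point of height \<open>m\<close> in the relative interior of
  a cone of dimension at least \<open>m + 2\<close>.\<close>

definition core :: "(nat \<Rightarrow> 'x set) \<Rightarrow> nat \<Rightarrow> bool" where
  "core b m \<longleftrightarrow> (\<forall>i<6. basis (b i)) \<and> m + 2 \<le> 6 \<and> 0 < m \<and>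
     (\<forall>x. 6 dvd m * (\<Sum>i<6. of_bool (x \<in> b i))) \<and>
     (\<forall>c::nat \<Rightarrow> real. (\<forall>x. (\<Sum>i<m + 2. c i * of_bool (x \<in> b i)) = 0) \<longrightarrow> (\<forall>i<m + 2. c i = 0))"

lemma sum_lessThan_6: "(\<Sum>i<6. f i) = f 0 + f 1 + f 2 + f 3 + f 4 + (f (5::nat)::'c::comm_monoid_add)"
  by (simp add: eval_nat_numeral ac_simps)

lemma sum_lessThan_5: "(\<Sum>i<5. f i) = f 0 + f 1 + f 2 + f 3 + (f (4::nat)::'c::comm_monoid_add)"
  by (simp add: eval_nat_numeral ac_simps)

lemma sum_lessThan_4: "(\<Sum>i<4. f i) = f 0 + f 1 + f 2 + (f (3::nat)::'c::comm_monoid_add)"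
  by (simp add: eval_nat_numeral ac_simps)

lemma all_less_6: "(\<forall>i<6. P i) \<longleftrightarrow> P 0 \<and> P 1 \<and> P 2 \<and> P 3 \<and> P 4 \<and> P (5::nat)"
  by (auto simp add: eval_nat_numeral All_less_Suc)

lemma all_less_5: "(\<forall>i<5. P i) \<longleftrightarrow> P 0 \<and> P 1 \<and> P 2 \<and> P 3 \<and> P (4::nat)"
  by (auto simp add: eval_nat_numeral All_less_Suc)

lemma all_less_4: "(\<forall>i<4. P i) \<longleftrightarrow> P 0 \<and> P 1 \<and> P 2 \<and> P (3::nat)"
  by (auto simp add: eval_nat_numeral All_less_Suc)

text \<open>The two circuits behave like two triangles with the common edge \<open>z\<close>. Of the eight bases of this graph with
  five edges the six chosen ones contain \<open>z\<close> twice and every other edge four times, so half of their sum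
  is integral.\<close>

lemma theta_core:
  assumes B: "basis B" and g: "g1 \<in> E - B" "g2 \<in> E - B" "g1 \<noteq> g2"
    and z: "z \<in> supp B g1" "z \<in> supp B g2"
    and x: "x \<in> supp B g1" "x \<notin> supp B g2"
    and y: "y \<in> supp B g2" "y \<notin> supp B g1"
  shows "\<exists>b m. core b m"
proof -
  have inB: "x \<in> B" "y \<in> B" "z \<in> B" using x y z supp_subset by blast+
  have ne: "x \<noteq> y" "x \<noteq> z" "y \<noteq> z" using x y z by auto
  have gB: "g1 \<notin> B" "g2 \<notin> B" using g by auto
  define C where "C = B - {x, y, z}"
  \<comment> \<open>Listed in an order that makes the first five linearly independent.\<close>
  define b where "b = (\<lambda>i. C \<union> [{x, y, z}, {x, y, g1}, {x, g1, g2}, {x, y, g2}, {y, g1, g2}, {z, g1, g2}] ! i)"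
  have bs: "b 0 = C \<union> {x, y, z}" "b 1 = C \<union> {x, y, g1}" "b 2 = C \<union> {x, g1, g2}" "b 3 = C \<union> {x, y, g2}"
      "b 4 = C \<union> {y, g1, g2}" "b 5 = C \<union> {z, g1, g2}"
    by (simp_all add: b_def)
  have "b 0 = B" using inB unfolding bs C_def by auto
  moreover have "b 1 = insert g1 (B - {z})" "b 3 = insert g2 (B - {z})"
    using inB ne gB unfolding bs C_def by auto
  moreover have "b 2 = insert g1 (insert g2 (B - {y}) - {z})" "b 4 = insert g2 (insert g1 (B - {x}) - {z})"
      "b 5 = insert g2 (insert g1 (B - {x}) - {y})"
    using inB ne gB unfolding bs C_def by auto
  moreover have "basis (insert g1 (B - {z}))" "basis (insert g2 (B - {z}))"
    using basis_exchange[OF B g(1)] basis_exchange[OF B g(2)] z by blast+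
  moreover have "basis (insert g1 (insert g2 (B - {y}) - {z}))" "basis (insert g2 (insert g1 (B - {x}) - {z}))"
      "basis (insert g2 (insert g1 (B - {x}) - {y}))"
    using basis_double_exchange[OF B] g x y z by metis+
  ultimately have bas: "\<forall>i<6. basis (b i)" using B by (simp add: all_less_6)
  have notC: "x \<notin> C" "y \<notin> C" "z \<notin> C" "g1 \<notin> C" "g2 \<notin> C" using gB by (auto simp: C_def)
  have gne: "g1 \<noteq> x" "g1 \<noteq> y" "g1 \<noteq> z" "g2 \<noteq> x" "g2 \<noteq> y" "g2 \<noteq> z" using gB inB by auto
  have dvd: "6 dvd (3::nat) * (\<Sum>i<6. of_bool (v \<in> b i))" for v
  proof -
    consider "v \<in> C" | "v = x" | "v = y" | "v = z" | "v = g1" | "v = g2" | "v \<notin> C \<union> {x, y, z, g1, g2}" by blast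
    then show ?thesis
      unfolding sum_lessThan_6 bs using notC ne gne g(3) by cases auto
  qed
  have ind: "\<forall>i<5. c i = 0" if c: "\<forall>v. (\<Sum>i<5. c i * of_bool (v \<in> b i)) = 0" for c :: "nat \<Rightarrow> real"
    using c[rule_format, of z] c[rule_format, of x] c[rule_format, of y] c[rule_format, of g1] c[rule_format, of g2]
      notC ne gne g(3) unfolding sum_lessThan_5 bs all_less_5 by (simp; linarith)
  show ?thesis
    using bas dvd ind by (intro exI[of _ b] exI[of _ 3]) (simp add: core_def)
qed

text \<open>Every pair from \<open>{x, z, g1, g2}\<close> completes \<open>B - {x, z}\<close> to a basis, as in the uniform matroid of rank two
  on four elements. Each of the four occurs in three of the six pairs, so a third of the sum is integral.\<close>

lemma square_core:
  assumes B: "basis B" and g: "g1 \<in> E - B" "g2 \<in> E - B" "g1 \<noteq> g2"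
    and x: "x \<in> supp B g1" "x \<in> supp B g2" and z: "z \<in> supp B g1" "z \<in> supp B g2" and "x \<noteq> z"
    and both: "basis (insert g1 (insert g2 (B - {x, z})))"
  shows "\<exists>b m. core b m"
proof -
  have inB: "x \<in> B" "z \<in> B" using x z supp_subset by blast+
  have gB: "g1 \<notin> B" "g2 \<notin> B" using g by auto
  define C where "C = B - {x, z}"
  \<comment> \<open>Listed in an order that makes the first four linearly independent.\<close>
  define b where "b = (\<lambda>i. C \<union> [{x, z}, {x, g1}, {x, g2}, {z, g1}, {z, g2}, {g1, g2}] ! i)"
  have bs: "b 0 = C \<union> {x, z}" "b 1 = C \<union> {x, g1}" "b 2 = C \<union> {x, g2}" "b 3 = C \<union> {z, g1}"
      "b 4 = C \<union> {z, g2}" "b 5 = C \<union> {g1, g2}"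
    by (simp_all add: b_def)
  have "b 0 = B" "b 1 = insert g1 (B - {z})" "b 2 = insert g2 (B - {z})" "b 3 = insert g1 (B - {x})"
      "b 4 = insert g2 (B - {x})" "b 5 = insert g1 (insert g2 (B - {x, z}))"
    using inB \<open>x \<noteq> z\<close> gB unfolding bs C_def by auto
  moreover have "basis (insert g1 (B - {z}))" "basis (insert g2 (B - {z}))" "basis (insert g1 (B - {x}))" "basis (insert g2 (B - {x}))"
    using basis_exchange[OF B g(1)] basis_exchange[OF B g(2)] x z by blast+
  ultimately have bas: "\<forall>i<6. basis (b i)" using B both by (simp add: all_less_6)
  have notC: "x \<notin> C" "z \<notin> C" "g1 \<notin> C" "g2 \<notin> C" using gB by (auto simp: C_def)
  have gne: "g1 \<noteq> x" "g1 \<noteq> z" "g2 \<noteq> x" "g2 \<noteq> z" using gB inB by auto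
  have dvd: "6 dvd (2::nat) * (\<Sum>i<6. of_bool (v \<in> b i))" for v
  proof -
    consider "v \<in> C" | "v = x" | "v = z" | "v = g1" | "v = g2" | "v \<notin> C \<union> {x, z, g1, g2}" by blast
    then show ?thesis
      unfolding sum_lessThan_6 bs using notC \<open>x \<noteq> z\<close> gne g(3) by cases auto
  qed
  have ind: "\<forall>i<4. c i = 0" if c: "\<forall>v. (\<Sum>i<4. c i * of_bool (v \<in> b i)) = 0" for c :: "nat \<Rightarrow> real"
    using c[rule_format, of z] c[rule_format, of x] c[rule_format, of g1] c[rule_format, of g2]
      notC \<open>x \<noteq> z\<close> gne g(3) unfolding sum_lessThan_4 bs all_less_4 by (simp; linarith)
  show ?thesis
    using bas dvd ind by (intro exI[of _ b] exI[of _ 2]) (simp add: core_def)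
qed

text \<open>Either \<open>g1\<close> and \<open>g2\<close> form a uniform matroid with \<open>z\<close> and another element of the smaller circuit, or the
  exchange of \<open>z\<close> for \<open>g1\<close> turns the nested pair of circuits into a theta. In the one remaining case
  \<open>g1\<close> and \<open>g2\<close> would be parallel.\<close>

lemma nested_core:
  assumes simple: "\<And>f g. f \<in> E \<Longrightarrow> g \<in> E \<Longrightarrow> f \<noteq> g \<Longrightarrow> \<rho> g \<notin> cl {f}"
    and B: "basis B" and g: "g1 \<in> E - B" "g2 \<in> E - B" "g1 \<noteq> g2"
    and z: "z \<in> supp B g1" and sub: "supp B g1 \<subseteq> supp B g2"
  shows "\<exists>b m. core b m"
proof -
  note BE = basis_subset[OF B]
  have zB: "z \<in> B" using z supp_subset by blast
  obtain x where x: "x \<in> supp B g1" "x \<noteq> z"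
  proof (rule ccontr)
    assume "\<not> thesis"
    then have "supp B g1 \<subseteq> {z}" using that by blast
    then have "\<rho> g1 \<in> cl {z}" using basis_supp_span[OF B g(1)] cl_mono by blast
    then show False using simple[of z g1] g(1) zB BE by blast
  qed
  have xB: "x \<in> B" using x supp_subset by blast
  show ?thesis
  proof (cases "\<exists>x\<in>supp B g1 - {z}. basis (insert g1 (insert g2 (B - {x, z})))")
    case True
    then obtain w where "w \<in> supp B g1" "w \<noteq> z" "basis (insert g1 (insert g2 (B - {w, z})))" by blast
    then show ?thesis using square_core[OF B g, of w z] z sub by blast
  next
    case False
    let ?B = "insert g1 (B - {z})"
    have B': "basis ?B" using z basis_exchange[OF B g(1)] by blast
    have g': "z \<in> E - ?B" "g2 \<in> E - ?B" "z \<noteq> g2" using g zB BE by auto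
    have undo: "insert z (?B - {g1}) = B" using zB g(1) by auto
    have in_supp: "f \<in> supp ?B z \<longleftrightarrow> f \<in> supp B g1" if f: "f \<in> B" "f \<noteq> z" for f
    proof -
      have "insert z (?B - {f}) = insert g1 (B - {f})" using zB f g(1) by auto
      then show ?thesis using basis_exchange[OF B' g'(1)] basis_exchange[OF B g(1)] f by auto
    qed
    have g1z: "g1 \<in> supp ?B z" using basis_exchange[OF B' g'(1)] undo B by auto
    have g1g2: "g1 \<in> supp ?B g2"
    proof -
      have "insert g2 (?B - {g1}) = insert g2 (B - {z})" using g(1) by auto
      then show ?thesis using basis_exchange[OF B' g'(2)] basis_exchange[OF B g(2)] z sub by auto
    qed
    have not_supp: "w \<notin> supp ?B g2" if w: "w \<in> supp B g1" "w \<noteq> z" for w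
    proof
      assume "w \<in> supp ?B g2"
      then have "basis (insert g2 (?B - {w}))" using basis_exchange[OF B' g'(2)] by blast
      moreover have "insert g2 (?B - {w}) = insert g1 (insert g2 (B - {w, z}))"
        using w g(1) supp_subset[of B g1] by auto
      ultimately show False using False w by auto
    qed
    show ?thesis
    proof (cases "\<exists>y. y \<in> supp B g2 - supp B g1")
      case True
      then obtain y where y: "y \<in> supp B g2" "y \<notin> supp B g1" by blast
      have yB: "y \<in> B" "y \<noteq> z" using y z supp_subset by blast+
      have "basis (insert g1 (insert g2 (B - {y}) - {z}))"
        using basis_double_exchange[OF B g(2,1) g(3)[symmetric] y(1) z y(2)] .
      moreover have "insert g1 (insert g2 (B - {y}) - {z}) = insert g2 (?B - {y})"
        using g yB zB by auto
      ultimately have "y \<in> supp ?B g2" using basis_exchange[OF B' g'(2)] yB by auto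
      moreover have "y \<notin> supp ?B z" using in_supp[OF yB] y by blast
      moreover have "x \<in> supp ?B z" using in_supp[OF xB x(2)] x by blast
      ultimately show ?thesis
        using theta_core[OF B' g'(1,2) g'(3) g1z g1g2 _ not_supp[OF x]] by blast
    next
      case False
      then have eq: "supp B g2 = supp B g1" using sub by blast
      have "supp ?B g2 \<subseteq> {g1}"
      proof
        fix y assume y: "y \<in> supp ?B g2"
        show "y \<in> {g1}"
        proof (rule ccontr)
          assume "y \<notin> {g1}"
          then have yB: "y \<in> B" "y \<noteq> z" using y supp_subset[of ?B g2] by auto
          then have yn: "y \<notin> supp B g1" using not_supp y by blast
          \<comment> \<open>Both new elements would lie in the span of \<open>B - {y}\<close>, which has one element too few.\<close>
          have bas: "basis (insert g2 (?B - {y}))" using basis_exchange[OF B' g'(2)] y by blast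
          have "\<rho> ` (insert g2 (?B - {y})) \<subseteq> cl (B - {y})"
          proof -
            have "supp B g1 \<subseteq> B - {y}" using yn supp_subset[of B g1] by blast
            then have "\<rho> g1 \<in> cl (B - {y})" "\<rho> g2 \<in> cl (B - {y})"
              using basis_supp_span[OF B g(1)] basis_supp_span[OF B g(2)] eq cl_mono by blast+
            then show ?thesis by (auto intro: cl_base)
          qed
          then have "card (insert g2 (?B - {y})) \<le> card (B - {y})"
            using BE by (intro indep_card_le basis_indep bas) auto
          moreover have "card (B - {y}) < card B" using yB basis_finite[OF B] by (meson card_Diff1_less)
          ultimately show False using basis_card[OF B bas] by simp
        qed
      qed
      then have "\<rho> g2 \<in> cl {g1}" using basis_supp_span[OF B' g'(2)] cl_mono by blast
      then show ?thesis using simple[of g1 g2] g by blast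
    qed
  qed
qed

theorem core_exists:
  assumes simple: "\<And>f g. f \<in> E \<Longrightarrow> g \<in> E \<Longrightarrow> f \<noteq> g \<Longrightarrow> \<rho> g \<notin> cl {f}" "\<And>f. f \<in> E \<Longrightarrow> \<rho> f \<noteq> 0"
    and con: "connected" and B: "basis B" and "card B + 2 \<le> card E"
  shows "\<exists>b m. core b m"
proof -
  have "card (E - B) = card E - card B" using basis_subset[OF B] basis_finite[OF B] by (rule card_Diff_subset[rotated])
  then have "2 \<le> card (E - B)" using assms(5) by simp
  then obtain g1 g2 where g: "g1 \<in> E - B" "g2 \<in> E - B" "g1 \<noteq> g2"
    by (meson card_2_iff' obtain_subset_with_card_n subsetD)
  obtain g where h: "g \<in> E - B" "g \<noteq> g1" "supp B g1 \<inter> supp B g \<noteq> {}"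
    using overlapping_circuits[OF con B g simple(2)] g(1) by blast
  then obtain z where z: "z \<in> supp B g1" "z \<in> supp B g" by blast
  show ?thesis
  proof (cases "supp B g1 \<subseteq> supp B g \<or> supp B g \<subseteq> supp B g1")
    case True
    then show ?thesis
      using nested_core[OF simple(1) B g(1) h(1) _ z(1)] nested_core[OF simple(1) B h(1) g(1) _ z(2)] h(2) by metis
  next
    case False
    then obtain x y where "x \<in> supp B g1" "x \<notin> supp B g" "y \<in> supp B g" "y \<notin> supp B g1" by blast
    then show ?thesis using theta_core[OF B g(1) h(1) _ z] h(2) by metis
  qed
qed

text \<open>If \<open>E\<close> has just one element more than a basis, then a basis is determined by the element that it misses.\<close>

lemma few_bases:
  assumes B: "basis B" and "card E \<le> card B + 1"
  shows "card bases \<le> 1 \<or> card bases \<le> card E"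
proof (cases "E = B")
  case True
  have "C = B" if "basis C" for C
    using that basis_card[OF B that] basis_subset[OF that] True finE by (metis card_subset_eq)
  then have "bases = {B}" using B unfolding bases_def by blast
  then show ?thesis by simp
next
  case False
  then obtain g where g: "g \<in> E" "g \<notin> B" using basis_subset[OF B] by blast
  have "card (insert g B) = card B + 1" using g basis_finite[OF B] by simp
  then have EB: "E = insert g B"
    using assms(2) g basis_subset[OF B] finE by (intro card_seteq[symmetric]) auto
  have "bases \<subseteq> (\<lambda>f. E - {f}) ` E"
  proof
    fix C assume "C \<in> bases"
    then have C: "C \<subseteq> E" "card C = card B" using basis_subset basis_card[OF B] by (auto simp: bases_def)
    then have "card (E - C) = 1"
      using EB g basis_finite[OF B] finite_subset[OF C(1) finE] by (simp add: card_Diff_subset)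
    then obtain f where "E - C = {f}" by (rule card_1_singletonE)
    then show "C \<in> (\<lambda>f. E - {f}) ` E" using C(1) by (intro image_eqI[of _ _ f]) auto
  qed
  then have "card bases \<le> card E" using surj_card_le[OF finE] by blast
  then show ?thesis by simp
qed

end

section \<open>Cycle matroids of graphs\<close>

instantiation "fun" :: (type, real_vector) real_vector
begin

definition scaleR_fun :: "real \<Rightarrow> ('a \<Rightarrow> 'b) \<Rightarrow> 'a \<Rightarrow> 'b" where
  "scaleR_fun r f = (\<lambda>x. r *\<^sub>R f x)"

instance
  by standard (auto simp: scaleR_fun_def fun_eq_iff scaleR_add_left scaleR_add_right)

end

lemma scaleR_fun_apply [simp]: "(r *\<^sub>R f) x = r *\<^sub>R f x"
  by (simp add: scaleR_fun_def)

lemma sum_fun_apply: "(\<Sum>i\<in>I. f i) x = (\<Sum>i\<in>I. f i x)"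
  by (induction I rule: infinite_finite_induct) auto

definition vertex_vector :: "'v \<Rightarrow> 'v \<Rightarrow> real" where
  "vertex_vector x = (\<lambda>y. of_bool (y = x))"

text \<open>The sign, given by the order of the vertices, is an arbitrary orientation of the edge.\<close>

definition incidence :: "'v::linorder set \<Rightarrow> 'v \<Rightarrow> real" where
  "incidence e = vertex_vector (Max e) - vertex_vector (Min e)"

lemma incidence_pair:
  assumes "a \<noteq> b"
  shows "incidence {a, b} = vertex_vector a - vertex_vector b \<or> incidence {a, b} = vertex_vector b - vertex_vector a"
  using assms by (cases "a < b") (auto simp: incidence_def max_def min_def)

lemma incidence_nonzero_iff:
  assumes "card e = 2"
  shows "incidence e x \<noteq> 0 \<longleftrightarrow> x \<in> e"
proof -
  obtain a b where "e = {a, b}" "a \<noteq> b" using assms by (auto simp: card_2_iff)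
  then show ?thesis using incidence_pair[of a b] by (auto simp: vertex_vector_def)
qed

lemma telescope: "(x - y) + (y - z) = (x - z :: 'a::ab_group_add)"
  by simp

abbreviation edge_rel :: "'v set set \<Rightarrow> ('v \<times> 'v) set" where
  "edge_rel F \<equiv> {(x, y). {x, y} \<in> F}"

lemma incidence_span_iff:
  assumes "a \<noteq> b" 
  shows "incidence {a, b} \<in> span S \<longleftrightarrow> vertex_vector a - vertex_vector b \<in> span S"
proof -
  have neg: "- u \<in> span S \<longleftrightarrow> u \<in> span S" for u :: "'a \<Rightarrow> real"
    using span_neg[of u S] span_neg[of "- u" S] by (auto simp only: minus_minus)
  have "vertex_vector b - vertex_vector a = - (vertex_vector a - vertex_vector b :: 'a \<Rightarrow> real)"
    by (simp only: minus_diff_eq)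
  then show ?thesis using incidence_pair[OF assms] neg[of "vertex_vector a - vertex_vector b"] by presburger
qed

lemma edge_path_span:
  assumes "(x, y) \<in> (edge_rel F)\<^sup>*" "\<And>e. e \<in> F \<Longrightarrow> card e = 2"
  shows "vertex_vector x - vertex_vector y \<in> span (incidence ` F)"
  using assms(1)
proof induction
  case (step y z)
  have "{y, z} \<in> F" using step by simp
  moreover have "y \<noteq> z" using assms(2)[OF \<open>{y, z} \<in> F\<close>] by auto
  ultimately have "vertex_vector y - vertex_vector z \<in> span (incidence ` F)"
    using incidence_span_iff[of y z] by (metis imageI span_base)
  from span_add[OF step.IH this] show ?case unfolding telescope .
next
  case base
  show ?case by (metis diff_self span_zero)
qed

text \<open>Summing coordinates over the vertices reachable from \<open>a\<close> kills every edge of \<open>F\<close>, but not an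
  edge that leaves this component.\<close>

lemma span_edge_path:
  assumes "vertex_vector a - vertex_vector b \<in> span (incidence ` F)" "\<And>e. e \<in> F \<Longrightarrow> card e = 2" "finite F"
  shows "(a, b) \<in> (edge_rel F)\<^sup>*"
proof (rule ccontr)
  assume n: "(a, b) \<notin> (edge_rel F)\<^sup>*"
  define W where "W = insert a (insert b (\<Union>F))"
  have "finite e" if "e \<in> F" for e using assms(2)[OF that] by (simp add: card_ge_0_finite)
  then have finW: "finite W" using assms(3) by (simp add: W_def)
  define K where "K = {y\<in>W. (a, y) \<in> (edge_rel F)\<^sup>*}"
  have finK: "finite K" using finW by (simp add: K_def)
  define \<phi> where "\<phi> v = (\<Sum>y\<in>K. v y)" for v :: "'a \<Rightarrow> real"
  have \<phi>_vertex: "\<phi> (vertex_vector x) = of_bool (x \<in> K)" for x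
    using finK by (simp add: \<phi>_def vertex_vector_def of_bool_def)
  have \<phi>_diff: "\<phi> (u - v) = \<phi> u - \<phi> v" for u v by (simp add: \<phi>_def sum_subtractf)
  have "subspace {v. \<phi> v = 0}"
    by (rule subspaceI) (simp_all add: \<phi>_def sum.distrib flip: sum_distrib_left)
  moreover have "incidence ` F \<subseteq> {v. \<phi> v = 0}"
  proof clarify
    fix e assume e: "e \<in> F"
    obtain x y where xy: "e = {x, y}" "x \<noteq> y" using assms(2)[OF e] by (auto simp: card_2_iff)
    have "(x, y) \<in> edge_rel F" "(y, x) \<in> edge_rel F" using e xy by (auto simp: insert_commute)
    then have "x \<in> K \<longleftrightarrow> y \<in> K" using e xy by (auto simp: K_def W_def intro: rtrancl_into_rtrancl)
    then show "\<phi> (incidence e) = 0"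
      using incidence_pair[OF xy(2)] xy(1) by (auto simp: \<phi>_diff \<phi>_vertex)
  qed
  ultimately have "\<phi> (vertex_vector a - vertex_vector b) = 0"
    using span_minimal[of "incidence ` F" "{v. \<phi> v = 0}"] assms(1) by blast
  moreover have "a \<in> K" "b \<notin> K" using n by (auto simp: K_def W_def)
  ultimately show False by (simp add: \<phi>_diff \<phi>_vertex)
qed

lemma simple_path_exists:
  assumes "(x, y) \<in> (edge_rel F)\<^sup>*"
  shows "\<exists>vs. vs \<noteq> [] \<and> distinct vs \<and> hd vs = x \<and> last vs = y \<and>
    (\<forall>i. Suc i < length vs \<longrightarrow> {vs ! i, vs ! Suc i} \<in> F)"
  using assms
proof induction
  case base
  show ?case by (rule exI[of _ "[x]"]) simp
next
  case (step y z)
  then obtain vs where vs: "vs \<noteq> []" "distinct vs" "hd vs = x" "last vs = y"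
    "\<And>i. Suc i < length vs \<Longrightarrow> {vs ! i, vs ! Suc i} \<in> F" by blast
  show ?case
  proof (cases "z \<in> set vs")
    case True
    then obtain j where j: "j < length vs" "vs ! j = z" by (auto simp: in_set_conv_nth)
    then have "last (take (Suc j) vs) = z" by (simp add: take_Suc_conv_app_nth)
    then show ?thesis using vs j by (intro exI[of _ "take (Suc j) vs"]) auto
  next
    case False
    have "{(vs @ [z]) ! i, (vs @ [z]) ! Suc i} \<in> F" if i: "Suc i < length (vs @ [z])" for i
    proof (cases "Suc i < length vs")
      case True
      then show ?thesis using vs(5) by (simp add: nth_append)
    next
      case False
      then have "i = length vs - 1" "i < length vs" using i by auto
      then have "vs ! i = y" using vs(1,4) by (simp add: last_conv_nth)
      then show ?thesis using step.hyps(2) False i \<open>i < length vs\<close> by (auto simp: nth_append)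
    qed
    then show ?thesis using vs False by (intro exI[of _ "vs @ [z]"]) auto
  qed
qed

locale simple_graph_matroid =
  fixes V :: "'v::linorder set" and E :: "'v set set"
  assumes graph: "simple_graph V E"
begin

lemma card_edge: "e \<in> E \<Longrightarrow> card e = 2" and edge_subset: "e \<in> E \<Longrightarrow> e \<subseteq> V" and finite_V: "finite V"
  using graph by (auto simp: simple_graph_def)

lemma finite_E: "finite E"
  using finite_V edge_subset by (intro finite_subset[of E "Pow V"]) auto

lemma incidence_inj: "inj_on incidence E"
proof (rule inj_onI)
  fix e f assume "e \<in> E" "f \<in> E" "incidence e = incidence f"
  then have "x \<in> e \<longleftrightarrow> x \<in> f" for x
    using incidence_nonzero_iff[OF card_edge, of e x] incidence_nonzero_iff[OF card_edge, of f x] by simp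
  then show "e = f" by blast
qed

sublocale linear_matroid E incidence
  using finite_E incidence_inj by unfold_locales

lemma incidence_not_parallel:
  assumes "f \<in> E" "g \<in> E" "f \<noteq> g"
  shows "incidence g \<notin> cl {f}"
proof
  assume "incidence g \<in> cl {f}"
  then obtain k where k: "incidence g = k *\<^sub>R incidence f" by (auto simp: span_singleton)
  have "g \<subseteq> f"
  proof
    fix x assume "x \<in> g"
    then have "incidence g x \<noteq> 0" using incidence_nonzero_iff card_edge assms by blast
    then have "incidence f x \<noteq> 0" unfolding k by auto
    then show "x \<in> f" using incidence_nonzero_iff card_edge assms by blast
  qed
  moreover have "finite f" "card f = card g" using card_edge assms by (auto intro: card_ge_0_finite)
  ultimately show False using assms(3) card_subset_eq by metis
qed

lemma incidence_nonzero: "f \<in> E \<Longrightarrow> incidence f \<noteq> 0"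
proof
  assume f: "f \<in> E" "incidence f = 0"
  obtain x where "x \<in> f" using card_edge[OF f(1)] by (auto simp: card_2_iff)
  then have "incidence f x \<noteq> 0" using incidence_nonzero_iff card_edge f by blast
  then show False using f(2) by simp
qed

text \<open>The incidence vectors of all edges of the cycle but one add up, with signs, to that of the remaining edge.\<close>

lemma cycle_dependent:
  assumes "F \<subseteq> E" "is_cycle F vs"
  shows "\<not> indep F"
proof -
  define m where "m = length vs"
  have c: "3 \<le> m" "distinct vs" "\<And>i. i < m \<Longrightarrow> {vs ! i, vs ! (Suc i mod m)} \<in> F"
    using assms(2) by (auto simp: is_cycle_def m_def)
  have ne: "vs ! i \<noteq> vs ! j" if "i < m" "j < m" "i \<noteq> j" for i j
    using nth_eq_iff_index_eq[OF c(2)] that by (simp add: m_def)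
  define e where "e = {vs ! 0, vs ! 1}"
  have e: "e \<in> F" using c(3)[of 0] c(1) by (simp add: e_def)
  let ?S = "cl (F - {e})"
  have other: "{vs ! i, vs ! (Suc i mod m)} \<in> F - {e}" if i: "1 \<le> i" "i < m" for i
  proof -
    have "{vs ! i, vs ! (Suc i mod m)} \<noteq> e"
    proof (cases "i = 1")
      case True
      then have "Suc i mod m = 2" using c(1) by simp
      then have "vs ! (Suc i mod m) \<notin> e" using ne[of 2 0] ne[of 2 1] c(1) by (auto simp: e_def)
      then show ?thesis by auto
    next
      case False
      then have "vs ! i \<notin> e" using ne[of i 0] ne[of i 1] c(1) i by (auto simp: e_def)
      then show ?thesis by auto
    qed
    then show ?thesis using c(3) i by blast
  qed
  have step: "vertex_vector (vs ! i) - vertex_vector (vs ! (Suc i mod m)) \<in> ?S" if i: "1 \<le> i" "i < m" for i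
  proof -
    have "Suc i mod m \<noteq> i" "Suc i mod m < m" using i c(1) by (cases "Suc i = m"; simp)+
    then have "vs ! i \<noteq> vs ! (Suc i mod m)" using ne i by metis
    from incidence_span_iff[OF this] cl_base[OF other[OF i]] show ?thesis by blast
  qed
  have path: "vertex_vector (vs ! 1) - vertex_vector (vs ! Suc i) \<in> ?S" if "Suc i < m" for i
    using that
  proof (induction i)
    case 0
    have "vertex_vector (vs ! 1) - vertex_vector (vs ! Suc 0) = (0 :: 'v \<Rightarrow> real)" by simp
    then show ?case by (simp only: span_zero)
  next
    case (Suc i)
    have "vertex_vector (vs ! Suc i) - vertex_vector (vs ! Suc (Suc i)) \<in> ?S"
      using step[of "Suc i"] Suc.prems by simp
    then have "(vertex_vector (vs ! 1) - vertex_vector (vs ! Suc i)) +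
        (vertex_vector (vs ! Suc i) - vertex_vector (vs ! Suc (Suc i))) \<in> ?S"
      by (rule span_add[OF Suc.IH[OF Suc_lessD[OF Suc.prems]]])
    then show ?case unfolding telescope .
  qed
  obtain j where j: "m = Suc (Suc j)" using c(1) that[of "m - 2"] by simp
  have "(vertex_vector (vs ! 1) - vertex_vector (vs ! Suc j)) +
      (vertex_vector (vs ! Suc j) - vertex_vector (vs ! (Suc (Suc j) mod m))) \<in> ?S"
    by (rule span_add[OF path step]) (use j in auto)
  then have "vertex_vector (vs ! 1) - vertex_vector (vs ! 0) \<in> ?S" unfolding telescope using j by simp
  moreover have "vs ! 1 \<noteq> vs ! 0" using ne[of 1 0] c(1) by simp
  ultimately have "incidence e \<in> ?S" using incidence_span_iff[of "vs ! 1" "vs ! 0"] by (simp add: e_def insert_commute)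
  moreover have "insert e (F - {e}) = F" using e by blast
  ultimately show ?thesis
    using indep_insert[of "F - {e}" e] indep_subset[of F "F - {e}"] e assms(1) by auto
qed

text \<open>An edge in the span of other edges has its two ends joined by a path of these edges, which it closes to
  a cycle.\<close>

lemma dependent_cycle:
  assumes "F \<subseteq> E" "\<not> indep F"
  shows "\<exists>vs. is_cycle F vs"
proof -
  have "dependent (incidence ` F)" using assms by (simp add: indep_def)
  then obtain f where f: "f \<in> F" "incidence f \<in> span (incidence ` F - {incidence f})"
    by (auto simp: real_vector.dependent_def)
  let ?G = "F - {f}"
  have "incidence ` F - {incidence f} \<subseteq> incidence ` ?G" by blast
  then have in_cl: "incidence f \<in> cl ?G" using f(2) span_mono by blast
  have c2: "card e = 2" if "e \<in> F" for e using that assms(1) card_edge by blast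
  obtain a b where ab: "f = {a, b}" "a \<noteq> b" using c2[OF f(1)] by (auto simp: card_2_iff)
  have "finite ?G" using assms(1) finite_E finite_subset by blast
  then have "(a, b) \<in> (edge_rel ?G)\<^sup>*"
    using in_cl c2 ab by (intro span_edge_path) (auto simp: incidence_span_iff)
  from simple_path_exists[OF this] obtain vs where vs: "vs \<noteq> []" "distinct vs" "hd vs = a" "last vs = b"
    "\<And>i. Suc i < length vs \<Longrightarrow> {vs ! i, vs ! Suc i} \<in> ?G" by blast
  have ends: "vs ! 0 = a" "vs ! (length vs - 1) = b" using vs by (simp_all add: hd_conv_nth last_conv_nth)
  have "length vs \<noteq> 0" "length vs \<noteq> 1" "length vs \<noteq> 2"
    using vs(1) ends ab vs(5)[of 0] by (auto simp: numeral_2_eq_2)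
  then have "3 \<le> length vs" by linarith
  moreover have "{vs ! i, vs ! (Suc i mod length vs)} \<in> F" if i: "i < length vs" for i
  proof (cases "Suc i < length vs")
    case True
    then show ?thesis using vs(5) by auto
  next
    case False
    then have "Suc i = length vs" using i by simp
    then have "Suc i mod length vs = 0" "i = length vs - 1" by auto
    then have "{vs ! i, vs ! (Suc i mod length vs)} = f" using ends ab by auto
    then show ?thesis using f(1) by simp
  qed
  ultimately show ?thesis using vs(2) by (auto simp: is_cycle_def)
qed

lemma acyclic_iff_indep: "F \<subseteq> E \<Longrightarrow> acyclic_edges F \<longleftrightarrow> indep F"
  using cycle_dependent dependent_cycle unfolding acyclic_edges_def by blast

lemma spanning_forest_iff_basis: "spanning_forest E F \<longleftrightarrow> basis F"
proof
  assume F: "spanning_forest E F"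
  then have FE: "F \<subseteq> E" "indep F" using acyclic_iff_indep by (auto simp: spanning_forest_def)
  obtain J where J: "F \<subseteq> J" "J \<subseteq> E" "indep J" "incidence ` E \<subseteq> cl J"
    using extend_indep[OF FE(2,1) subset_refl] .
  then have "J = F" using F acyclic_iff_indep unfolding spanning_forest_def by blast
  then show "basis F" using J by (simp add: basis_def)
next
  assume F: "basis F"
  have "F' = F" if F': "F \<subseteq> F'" "F' \<subseteq> E" "acyclic_edges F'" for F'
  proof -
    have ind: "indep F'" using F' acyclic_iff_indep by blast
    show ?thesis
      using card_seteq[OF indep_finite[OF ind] F'(1) indep_card_le_basis[OF ind F]] by simp
  qed
  then show "spanning_forest E F"
    using acyclic_iff_indep[OF basis_subset[OF F]] basis_subset[OF F] basis_indep[OF F]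
    unfolding spanning_forest_def by blast
qed

text \<open>If \<open>a\<close> and \<open>b\<close> are joined by a path that avoids \<open>v\<close>, then modulo the edges that avoid \<open>v\<close> the
  edges \<open>va\<close> and \<open>vb\<close> become parallel, so each can replace the other in a suitable basis.\<close>

lemma adjacent_edges_exchange:
  assumes conn: "two_connected V E" and f: "{v, a} \<in> E" and g: "{v, b} \<in> E" and "a \<noteq> b"
  shows "({v, a}, {v, b}) \<in> exchange_rel"
proof -
  let ?f = "{v, a}" and ?g = "{v, b}"
  define X where "X = induced_edges E (V - {v})"
  have ne: "v \<noteq> a" "v \<noteq> b" using card_edge[OF f] card_edge[OF g] by auto
  have mem: "v \<in> V" "a \<in> V - {v}" "b \<in> V - {v}" using edge_subset[OF f] edge_subset[OF g] ne by auto
  have XE: "X \<subseteq> E" "\<And>e. e \<in> X \<Longrightarrow> v \<notin> e" by (auto simp: X_def induced_edges_def)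
  have "\<not> cut_vertex V E v" using conn by (auto simp: two_connected_def)
  then have "(a, b) \<in> (edge_rel X)\<^sup>*"
    using mem by (auto simp: cut_vertex_def disconnected_def X_def)
  then have ab: "vertex_vector a - vertex_vector b \<in> cl X"
    using XE(1) card_edge by (intro edge_path_span) auto
  obtain I where I: "I \<subseteq> X" "indep I" "incidence ` X \<subseteq> cl I"
    using extend_indep[of "{}" X] XE(1) by (metis empty_subsetI indep_def image_empty real_vector.independent_empty)
  have abI: "vertex_vector a - vertex_vector b \<in> cl I" using ab cl_trans[OF I(3)] by blast
  have "cl I \<subseteq> {u. u v = 0}"
  proof (rule span_minimal)
    show "subspace {u :: 'v \<Rightarrow> real. u v = 0}" by (rule subspaceI) auto
    show "incidence ` I \<subseteq> {u. u v = 0}"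
      using I(1) XE incidence_nonzero_iff card_edge by blast
  qed
  moreover have "incidence ?f v \<noteq> 0" using incidence_nonzero_iff[OF card_edge[OF f]] by blast
  ultimately have f_notin: "incidence ?f \<notin> cl I" by blast
  then have f_I: "?f \<notin> I" using cl_base by blast
  then have "indep (insert ?f I)" using indep_insert[OF I(2) f] f_notin by simp
  then obtain J where J: "insert ?f I \<subseteq> J" "J \<subseteq> E" "indep J" "incidence ` E \<subseteq> cl J"
    using extend_indep[of "insert ?f I" E] f I(1) XE(1) by (metis indep_def subset_refl)
  then have basJ: "basis J" by (simp add: basis_def)
  have shift: "incidence ?g \<in> span S \<longleftrightarrow> incidence ?f \<in> span S" if "cl I \<subseteq> span S" for S
  proof -
    have ab': "vertex_vector a - vertex_vector b \<in> span S" using abI that by blast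
    have "vertex_vector v - vertex_vector b = (vertex_vector v - vertex_vector a) + (vertex_vector a - vertex_vector b :: 'v \<Rightarrow> real)"
      "vertex_vector v - vertex_vector a = (vertex_vector v - vertex_vector b) - (vertex_vector a - vertex_vector b :: 'v \<Rightarrow> real)"
      by (simp_all only: telescope diff_diff_eq2 diff_add_cancel)
    then have "vertex_vector v - vertex_vector b \<in> span S \<longleftrightarrow> vertex_vector v - vertex_vector a \<in> span S"
      using ab' span_add span_diff by metis
    then show ?thesis using incidence_span_iff ne by blast
  qed
  have fg: "?f \<noteq> ?g" using \<open>a \<noteq> b\<close> ne by (auto simp: doubleton_eq_iff)
  have gJ: "?g \<notin> J"
  proof
    assume gin: "?g \<in> J"
    have "?g \<notin> I" using I(1) XE(2) by blast
    then have sub: "insert ?f I \<subseteq> J - {?g}" using J(1) fg by blast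
    have "incidence ?f \<in> cl (J - {?g})" using sub by (intro cl_base) blast
    moreover have "cl I \<subseteq> cl (J - {?g})" using sub by (intro cl_mono) blast
    ultimately have "incidence ?g \<in> cl (J - {?g})" using shift by blast
    moreover have "insert ?g (J - {?g}) = J" using gin by blast
    ultimately show False using indep_insert[of "J - {?g}" ?g] indep_subset[OF J(3), of "J - {?g}"] J(3) g by auto
  qed
  have fJ: "?f \<in> J" using J(1) by blast
  have ind_f: "indep (J - {?f})" using indep_subset[OF J(3)] by blast
  have "incidence ?f \<notin> cl (J - {?f})"
    using indep_insert[OF ind_f f] J(3) fJ by (simp add: insert_absorb)
  moreover have "cl I \<subseteq> cl (J - {?f})" using J(1) f_I by (intro cl_mono) blast
  ultimately have "incidence ?g \<notin> cl (J - {?f})" using shift by blast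
  then have "indep (insert ?g (J - {?f}))" using indep_insert[OF ind_f g] gJ by simp
  then have "?f \<in> supp J ?g" using fJ by (simp add: supp_def)
  then have "basis (insert ?g (J - {?f}))" using basis_exchange[OF basJ, of ?g] g gJ by blast
  then show ?thesis using f g basJ fJ gJ unfolding exchange_rel_def by blast
qed

text \<open>The edges that are linked to \<open>f\<close> by exchanges include, with an edge, all edges adjacent to it. Since the
  graph is connected, they are all edges.\<close>

lemma two_connected_matroid:
  assumes "two_connected V E"
  shows "connected"
  unfolding connected_def
proof clarify
  fix f g assume f: "f \<in> E" and g: "g \<in> E"
  define X where "X = {h\<in>E. (f, h) \<in> exchange_rel\<^sup>*}"
  have grow: "{x, y} \<in> X" if x: "x \<in> \<Union>X" and xy: "{x, y} \<in> E" for x y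
  proof -
    obtain h where h: "h \<in> X" "x \<in> h" using x by blast
    then have hE: "h \<in> E" by (simp add: X_def)
    obtain z where z: "h = {x, z}" using card_edge[OF hE] h(2) by (auto simp: card_2_iff)
    show ?thesis
    proof (cases "z = y")
      case True
      then show ?thesis using h z by simp
    next
      case False
      then have "(h, {x, y}) \<in> exchange_rel"
        using adjacent_edges_exchange[OF assms, of x z y] hE xy z by simp
      then show ?thesis using h(1) xy unfolding X_def by (blast intro: rtrancl_into_rtrancl)
    qed
  qed
  obtain a where a: "a \<in> f" using card_edge[OF f] by (auto simp: card_2_iff)
  obtain c d where c: "g = {c, d}" using card_edge[OF g] by (auto simp: card_2_iff)
  have "a \<in> V" "c \<in> V" using edge_subset f g a c by auto
  then have "(a, c) \<in> (edge_rel E)\<^sup>*"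
    using assms by (auto simp: two_connected_def connected_graph_def disconnected_def)
  then have "c \<in> \<Union>X"
  proof induction
    case base
    then show ?case using a f by (auto simp: X_def)
  next
    case (step y z)
    then have "{y, z} \<in> X" using grow by blast
    then show ?case by blast
  qed
  then have "g \<in> X" using grow g c by blast
  then show "(f, g) \<in> exchange_rel\<^sup>*" by (simp add: X_def)
qed

end

section \<open>Monoid rings and monomial ideals\<close>

abbreviation keys :: "('a \<Rightarrow>\<^sub>0 'b::zero) \<Rightarrow> 'a set" where
  "keys \<equiv> Poly_Mapping.keys"

abbreviation lookup :: "('a \<Rightarrow>\<^sub>0 'b::zero) \<Rightarrow> 'a \<Rightarrow> 'b" where
  "lookup \<equiv> Poly_Mapping.lookup"

abbreviation single :: "'a \<Rightarrow> 'b \<Rightarrow> ('a \<Rightarrow>\<^sub>0 'b::zero)" where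
  "single \<equiv> Poly_Mapping.single"

text \<open>The linear extension of a map between exponents.\<close>

definition push :: "('a \<Rightarrow> 'b) \<Rightarrow> ('a \<Rightarrow>\<^sub>0 'k) \<Rightarrow> ('b \<Rightarrow>\<^sub>0 'k::comm_monoid_add)" where
  "push \<alpha> f = (\<Sum>m\<in>keys f. single (\<alpha> m) (lookup f m))"

lemma push_superset:
  assumes "finite A" "keys f \<subseteq> A"
  shows "push \<alpha> f = (\<Sum>m\<in>A. single (\<alpha> m) (lookup f m))"
  unfolding push_def using assms by (intro sum.mono_neutral_left) (auto simp: in_keys_iff)

lemma push_zero [simp]: "push \<alpha> 0 = 0"
  by (simp add: push_def)

lemma push_add: "push \<alpha> (f + g) = push \<alpha> f + push \<alpha> g"
proof -
  let ?A = "keys f \<union> keys g"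
  have "keys (f + g) \<subseteq> ?A" by (rule Poly_Mapping.keys_add)
  then show ?thesis
    by (simp add: push_superset[of ?A] lookup_add single_add sum.distrib)
qed

lemma push_single [simp]: "push \<alpha> (single m c) = single (\<alpha> m) c"
  by (simp add: push_superset[of "{m}"])

lemma push_sum: "push \<alpha> (\<Sum>i\<in>I. f i) = (\<Sum>i\<in>I. push \<alpha> (f i))"
  by (induction I rule: infinite_finite_induct) (simp_all add: push_add)

lemma sum_of_monomials: "(\<Sum>m\<in>keys f. single m (lookup f m)) = f"
  by (intro poly_mapping_eqI) (simp add: lookup_sum lookup_single when_def in_keys_iff)

text \<open>Three maps, because the encoding of an exponent below depends on its degree, which adds up in a product.\<close>

lemma push_mult:
  fixes f g :: "'a::comm_monoid_add \<Rightarrow>\<^sub>0 'k::comm_semiring_0"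
    and \<alpha> \<beta> \<gamma> :: "'a \<Rightarrow> 'b::comm_monoid_add"
  assumes "\<And>m n. m \<in> keys f \<Longrightarrow> n \<in> keys g \<Longrightarrow> \<gamma> (m + n) = \<alpha> m + \<beta> n"
  shows "push \<gamma> (f * g) = push \<alpha> f * push \<beta> g"
proof -
  have "push \<gamma> (f * g) = push \<gamma> ((\<Sum>m\<in>keys f. single m (lookup f m)) *
      (\<Sum>n\<in>keys g. single n (lookup g n)))"
    by (simp add: sum_of_monomials)
  also have "\<dots> = (\<Sum>m\<in>keys f. \<Sum>n\<in>keys g.
      single (\<gamma> (m + n)) (lookup f m * lookup g n))"
    by (simp add: sum_product push_sum mult_single)
  also have "\<dots> = (\<Sum>m\<in>keys f. \<Sum>n\<in>keys g.
      single (\<alpha> m + \<beta> n) (lookup f m * lookup g n))"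
    using assms by simp
  also have "\<dots> = push \<alpha> f * push \<beta> g"
    by (simp add: push_def sum_product mult_single)
  finally show ?thesis .
qed

lemma keys_push: "keys (push \<alpha> f) \<subseteq> \<alpha> ` keys f"
proof
  fix x assume "x \<in> keys (push \<alpha> f)"
  then have "(\<Sum>m\<in>keys f. lookup (single (\<alpha> m) (lookup f m)) x) \<noteq> 0"
    by (simp add: push_def in_keys_iff lookup_sum)
  then obtain m where "m \<in> keys f" "lookup (single (\<alpha> m) (lookup f m)) x \<noteq> 0"
    by (rule sum.not_neutral_contains_not_neutral)
  then show "x \<in> \<alpha> ` keys f" by (auto simp: lookup_single when_def split: if_splits)
qed

lemma lookup_push:
  assumes "inj_on \<alpha> A" "keys f \<subseteq> A" "m \<in> A"
  shows "lookup (push \<alpha> f) (\<alpha> m) = lookup f m"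
proof -
  have "lookup (push \<alpha> f) (\<alpha> m) = (\<Sum>n\<in>keys f. if n = m then lookup f n else 0)"
    unfolding push_def lookup_sum using assms
    by (intro sum.cong) (auto simp: lookup_single when_def inj_on_def)
  also have "\<dots> = lookup f m" by (simp add: in_keys_iff)
  finally show ?thesis .
qed

definition monoid_ring :: "('a::comm_monoid_add) set \<Rightarrow> ('a \<Rightarrow>\<^sub>0 'k::field) ring" where
  "monoid_ring T = \<lparr>carrier = {p. keys p \<subseteq> T}, mult = (*), one = 1, zero = 0, add = (+)\<rparr>"

lemma monoid_ring_simps [simp]:
  "carrier (monoid_ring T) = {p. keys p \<subseteq> T}"
  "mult (monoid_ring T) = (*)" "one (monoid_ring T) = 1"
  "zero (monoid_ring T) = 0" "add (monoid_ring T) = (+)"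
  by (simp_all add: monoid_ring_def)

lemma poly_ring_eq_monoid_ring: "poly_ring X = monoid_ring {m. keys m \<subseteq> X}"
  unfolding poly_ring_def monoid_ring_def by (auto simp: subset_eq)

definition add_submonoid :: "'a::comm_monoid_add set \<Rightarrow> bool" where
  "add_submonoid T \<longleftrightarrow> 0 \<in> T \<and> (\<forall>m\<in>T. \<forall>n\<in>T. m + n \<in> T)"

lemma keys_mult_add_submonoid:
  assumes "add_submonoid T" "keys f \<subseteq> T" "keys g \<subseteq> T"
  shows "keys (f * g) \<subseteq> T"
  using Poly_Mapping.keys_mult[of f g] assms unfolding add_submonoid_def by blast

lemma monoid_ring_cring:
  assumes "add_submonoid T"
  shows "cring (monoid_ring T :: ('a::comm_monoid_add \<Rightarrow>\<^sub>0 'k::field) ring)"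
proof (rule cringI)
  show "abelian_group (monoid_ring T :: ('a \<Rightarrow>\<^sub>0 'k) ring)"
  proof (rule abelian_groupI)
    fix x :: "'a \<Rightarrow>\<^sub>0 'k" assume "x \<in> carrier (monoid_ring T)"
    then show "\<exists>y\<in>carrier (monoid_ring T). y \<oplus>\<^bsub>monoid_ring T\<^esub> x = \<zero>\<^bsub>monoid_ring T\<^esub>"
      by (intro bexI[of _ "- x"]) (auto simp: in_keys_iff)
  qed (use Poly_Mapping.keys_add in \<open>force simp: algebra_simps\<close>)+
  show "comm_monoid (monoid_ring T :: ('a \<Rightarrow>\<^sub>0 'k) ring)"
    using keys_mult_add_submonoid[OF assms] assms
    by (intro comm_monoidI) (auto simp: mult_ac add_submonoid_def)
qed (auto simp: algebra_simps)

lemma monoid_ring_finsum: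
  assumes "add_submonoid T" "\<And>i. i \<in> I \<Longrightarrow> keys (f i) \<subseteq> T"
  shows "finsum (monoid_ring T) f I = (\<Sum>i\<in>I. f i :: 'a::comm_monoid_add \<Rightarrow>\<^sub>0 'k::field)"
proof -
  interpret cring "monoid_ring T :: ('a \<Rightarrow>\<^sub>0 'k) ring" by (rule monoid_ring_cring[OF assms(1)])
  show ?thesis using assms(2)
    by (induction I rule: infinite_finite_induct) (simp_all add: finsum_infinite Pi_def)
qed

lemma keys_sum_subset:
  assumes "\<And>i. i \<in> I \<Longrightarrow> keys (f i) \<subseteq> T"
  shows "keys (\<Sum>i\<in>I. f i) \<subseteq> T"
  using assms by (induction I rule: infinite_finite_induct) (use Poly_Mapping.keys_add in force)+

definition monomial_ideal :: "'a::comm_monoid_add set \<Rightarrow> 'a set \<Rightarrow> ('a \<Rightarrow>\<^sub>0 'k::field) set" where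
  "monomial_ideal T W = {p. \<forall>m\<in>keys p. \<exists>u\<in>W. \<exists>v\<in>T. m = u + v}"

lemma monomial_ideal_carrier:
  assumes "add_submonoid T" "W \<subseteq> T"
  shows "monomial_ideal T W \<subseteq> carrier (monoid_ring T)"
  using assms unfolding monomial_ideal_def add_submonoid_def by fastforce

lemma monomial_ideal_closed:
  assumes "add_submonoid T"
  shows "0 \<in> monomial_ideal T W"
    and "p \<in> monomial_ideal T W \<Longrightarrow> q \<in> monomial_ideal T W \<Longrightarrow> p + q \<in> monomial_ideal T W"
    and "p \<in> monomial_ideal T W \<Longrightarrow> - p \<in> monomial_ideal T W"
    and "p \<in> monomial_ideal T W \<Longrightarrow> q \<in> monomial_ideal T W' \<Longrightarrow> p * q \<in> monomial_ideal T {u + u' | u u'. u \<in> W \<and> u' \<in> W'}"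
    and "p \<in> monomial_ideal T W \<Longrightarrow> keys q \<subseteq> T \<Longrightarrow> p * q \<in> monomial_ideal T W"
proof -
  show "0 \<in> monomial_ideal T W" by (simp add: monomial_ideal_def)
  show "p + q \<in> monomial_ideal T W" if "p \<in> monomial_ideal T W" "q \<in> monomial_ideal T W"
    using that Poly_Mapping.keys_add[of p q] unfolding monomial_ideal_def by blast
  show "- p \<in> monomial_ideal T W" if "p \<in> monomial_ideal T W"
    using that by (auto simp: monomial_ideal_def in_keys_iff)
  show "p * q \<in> monomial_ideal T {u + u' | u u'. u \<in> W \<and> u' \<in> W'}"
    if pq: "p \<in> monomial_ideal T W" "q \<in> monomial_ideal T W'"
    unfolding monomial_ideal_def
  proof clarify
    fix m assume "m \<in> keys (p * q)"
    then obtain a b where ab: "m = a + b" "a \<in> keys p" "b \<in> keys q"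
      using Poly_Mapping.keys_mult[of p q] by blast
    obtain u v where u: "u \<in> W" "v \<in> T" "a = u + v" using pq(1) ab(2) by (auto simp: monomial_ideal_def)
    obtain u' v' where u': "u' \<in> W'" "v' \<in> T" "b = u' + v'" using pq(2) ab(3) by (auto simp: monomial_ideal_def)
    have "m = (u + u') + (v + v')" using ab u u' by (simp add: ac_simps)
    moreover have "v + v' \<in> T" using assms u u' by (simp add: add_submonoid_def)
    ultimately show "\<exists>u\<in>{u + u' | u u'. u \<in> W \<and> u' \<in> W'}. \<exists>v\<in>T. m = u + v" using u u' by blast
  qed
  show "p * q \<in> monomial_ideal T W" if pq: "p \<in> monomial_ideal T W" "keys q \<subseteq> T"
    unfolding monomial_ideal_def
  proof clarify
    fix m assume "m \<in> keys (p * q)"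
    then obtain a b where ab: "m = a + b" "a \<in> keys p" "b \<in> keys q"
      using Poly_Mapping.keys_mult[of p q] by blast
    obtain u v where u: "u \<in> W" "v \<in> T" "a = u + v" using pq(1) ab(2) by (auto simp: monomial_ideal_def)
    have "m = u + (v + b)" using ab u by (simp add: ac_simps)
    moreover have "v + b \<in> T" using assms u ab pq by (auto simp: add_submonoid_def)
    ultimately show "\<exists>u\<in>W. \<exists>v\<in>T. m = u + v" using u by blast
  qed
qed

lemma monoid_ring_uminus:
  assumes "add_submonoid T" "keys (p :: 'a::comm_monoid_add \<Rightarrow>\<^sub>0 'k::field) \<subseteq> T"
  shows "\<ominus>\<^bsub>monoid_ring T\<^esub> p = - p"
proof -
  interpret cring "monoid_ring T :: ('a \<Rightarrow>\<^sub>0 'k) ring" by (rule monoid_ring_cring[OF assms(1)])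
  have "keys (- p) \<subseteq> T" using assms(2) by (auto simp: in_keys_iff)
  then show ?thesis using minus_equality[of "- p" p] assms(2) by simp
qed

lemma monomial_ideal_is_ideal:
  assumes "add_submonoid T" "W \<subseteq> T"
  shows "ideal (monomial_ideal T W) (monoid_ring T :: ('a::comm_monoid_add \<Rightarrow>\<^sub>0 'k::field) ring)"
proof -
  let ?R = "monoid_ring T :: ('a \<Rightarrow>\<^sub>0 'k) ring"
  interpret cring ?R by (rule monoid_ring_cring[OF assms(1)])
  note cl = monomial_ideal_closed[OF assms(1)]
  have car: "monomial_ideal T W \<subseteq> carrier ?R" by (rule monomial_ideal_carrier[OF assms])
  show ?thesis
  proof (rule idealI)
    show "ring ?R" by (rule ring_axioms)
    show "subgroup (monomial_ideal T W) (add_monoid ?R)"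
    proof (rule add.subgroupI)
      show "monomial_ideal T W \<subseteq> carrier ?R" by (rule car)
      show "monomial_ideal T W \<noteq> {}" using cl(1) by blast
      fix a b :: "'a \<Rightarrow>\<^sub>0 'k" assume a: "a \<in> monomial_ideal T W" and b: "b \<in> monomial_ideal T W"
      show "\<ominus>\<^bsub>?R\<^esub> a \<in> monomial_ideal T W"
        using monoid_ring_uminus[OF assms(1)] car a cl(3)[OF a] by force
      show "a \<oplus>\<^bsub>?R\<^esub> b \<in> monomial_ideal T W" using cl(2) a b by simp
    qed
  qed (use cl(5) in \<open>auto simp: mult.commute\<close>)
qed

lemma genideal_monomials:
  assumes "add_submonoid T" "W \<subseteq> T"
  shows "genideal (monoid_ring T :: ('a::comm_monoid_add \<Rightarrow>\<^sub>0 'k::field) ring) ((\<lambda>u. single u 1) ` W) = monomial_ideal T W"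
    (is "genideal ?R ?G = _")
proof
  interpret cring ?R by (rule monoid_ring_cring[OF assms(1)])
  have G: "?G \<subseteq> carrier ?R" using assms(2) by auto
  have "0 \<in> T" using assms(1) by (simp add: add_submonoid_def)
  then have "single u 1 \<in> monomial_ideal T W" if "u \<in> W" for u
    using that unfolding monomial_ideal_def by simp (metis add.right_neutral)
  then have "?G \<subseteq> monomial_ideal T W" by blast
  then show "genideal ?R ?G \<subseteq> monomial_ideal T W"
    by (rule genideal_minimal[OF monomial_ideal_is_ideal[OF assms]])
  interpret I: ideal "genideal ?R ?G" ?R by (rule genideal_ideal[OF G])
  have sum: "(\<Sum>i\<in>I. f i) \<in> genideal ?R ?G" if "\<And>i. i \<in> I \<Longrightarrow> f i \<in> genideal ?R ?G" for f :: "'a \<Rightarrow> 'a \<Rightarrow>\<^sub>0 'k" and I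
    using that I.a_closed I.zero_closed by (induction I rule: infinite_finite_induct) auto
  show "monomial_ideal T W \<subseteq> genideal ?R ?G"
  proof
    fix p :: "'a \<Rightarrow>\<^sub>0 'k" assume p: "p \<in> monomial_ideal T W"
    have "single m (lookup p m) \<in> genideal ?R ?G" if m: "m \<in> keys p" for m
    proof -
      obtain u v where uv: "u \<in> W" "v \<in> T" "m = u + v" using p m by (auto simp: monomial_ideal_def)
      have "single u 1 \<in> genideal ?R ?G" using genideal_self[OF G] uv(1) by blast
      then have "single u 1 \<otimes>\<^bsub>?R\<^esub> single v (lookup p m) \<in> genideal ?R ?G"
        using uv(2) by (intro I.I_r_closed) auto
      then show ?thesis by (simp add: mult_single uv(3))
    qed
    then have "(\<Sum>m\<in>keys p. single m (lookup p m)) \<in> genideal ?R ?G"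
      by (rule sum)
    then show "p \<in> genideal ?R ?G" by (simp add: sum_of_monomials)
  qed
qed

lemma ideal_prod_monomials:
  assumes "add_submonoid T" "W \<subseteq> T" "W' \<subseteq> T"
  shows "ideal_prod (monoid_ring T :: ('a::comm_monoid_add \<Rightarrow>\<^sub>0 'k::field) ring) (monomial_ideal T W) (monomial_ideal T W') =
    monomial_ideal T {u + u' | u u'. u \<in> W \<and> u' \<in> W'}"
    (is "ideal_prod ?R ?I ?J = ?K")
proof
  note cl = monomial_ideal_closed[OF assms(1)]
  have "p \<in> ?K" if "p \<in> ideal_prod ?R ?I ?J" for p
    using that by induction (use cl in auto)
  then show "ideal_prod ?R ?I ?J \<subseteq> ?K" by blast
  have "0 \<in> T" using assms(1) by (simp add: add_submonoid_def)
  have zero: "(0 :: 'a \<Rightarrow>\<^sub>0 'k) \<in> ideal_prod ?R ?I ?J"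
  proof -
    have "(0 :: 'a \<Rightarrow>\<^sub>0 'k) \<in> ?I" "(0 :: 'a \<Rightarrow>\<^sub>0 'k) \<in> ?J" by (rule cl(1))+
    then show ?thesis using ideal_prod.prod[of 0 ?I 0 ?J ?R] by simp
  qed
  have sum: "(\<Sum>i\<in>I. f i) \<in> ideal_prod ?R ?I ?J" if "\<And>i. i \<in> I \<Longrightarrow> f i \<in> ideal_prod ?R ?I ?J" for f :: "'a \<Rightarrow> 'a \<Rightarrow>\<^sub>0 'k" and I
    using that
  proof (induction I rule: infinite_finite_induct)
    case (insert x F)
    then show ?case using ideal_prod.sum[of "f x" ?R ?I ?J "sum f F"] by simp
  qed (use zero in simp_all)
  show "?K \<subseteq> ideal_prod ?R ?I ?J"
  proof
    fix p assume p: "p \<in> ?K"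
    have "single m (lookup p m) \<in> ideal_prod ?R ?I ?J" if m: "m \<in> keys p" for m
    proof -
      obtain u u' v where uv: "u \<in> W" "u' \<in> W'" "v \<in> T" "m = u + u' + v" using p m by (auto simp: monomial_ideal_def)
      have "single u 1 \<in> ?I" unfolding monomial_ideal_def
        using uv(1) \<open>0 \<in> T\<close> by simp (metis add.right_neutral)
      moreover have "single (u' + v) (lookup p m) \<in> ?J"
        using uv by (auto simp: monomial_ideal_def)
      ultimately have "single u 1 \<otimes>\<^bsub>?R\<^esub> single (u' + v) (lookup p m) \<in> ideal_prod ?R ?I ?J"
        by (rule ideal_prod.prod)
      then show ?thesis by (simp add: mult_single uv(4) add.assoc)
    qed
    then have "(\<Sum>m\<in>keys p. single m (lookup p m)) \<in> ideal_prod ?R ?I ?J"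
      by (rule sum)
    then show "p \<in> ideal_prod ?R ?I ?J" by (simp add: sum_of_monomials)
  qed
qed

definition restrict_keys :: "'a set \<Rightarrow> ('a \<Rightarrow>\<^sub>0 'k) \<Rightarrow> ('a \<Rightarrow>\<^sub>0 'k::comm_monoid_add)" where
  "restrict_keys A f = (\<Sum>m\<in>keys f \<inter> A. single m (lookup f m))"

lemma lookup_restrict_keys [simp]:
  "lookup (restrict_keys A f) m = (if m \<in> A then lookup f m else 0)"
  by (auto simp: restrict_keys_def lookup_sum lookup_single when_def in_keys_iff)

lemma keys_restrict_keys: "keys (restrict_keys A f) = keys f \<inter> A"
  by (auto simp: in_keys_iff split: if_splits)

lemma restrict_keys_add: "restrict_keys A (f + g) = restrict_keys A f + restrict_keys A g"
  by (intro poly_mapping_eqI) (simp add: lookup_add)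

lemma restrict_keys_sum: "restrict_keys A (\<Sum>i\<in>I. f i) = (\<Sum>i\<in>I. restrict_keys A (f i))"
  by (intro poly_mapping_eqI) (simp add: lookup_sum)

lemma restrict_keys_id: "keys f \<subseteq> A \<Longrightarrow> restrict_keys A f = f"
  by (intro poly_mapping_eqI) (auto simp: in_keys_iff)

lemma restrict_keys_0: "keys f \<inter> A = {} \<Longrightarrow> restrict_keys A f = 0"
  by (intro poly_mapping_eqI) (auto simp: in_keys_iff)

lemma restrict_keys_split: "f = restrict_keys A f + restrict_keys (- A) f"
  by (intro poly_mapping_eqI) (simp add: lookup_add)

section \<open>Powers of an ideal generated by monomials of the same degree\<close>

locale equigenerated =
  fixes X :: "'x set" and U :: "('x \<Rightarrow>\<^sub>0 nat) set" and r :: nat and idx :: "'x \<Rightarrow> nat"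
  assumes finX: "finite X" and finU: "finite U"
    and U_keys: "u \<in> U \<Longrightarrow> keys u \<subseteq> X"
    and U_degree: "u \<in> U \<Longrightarrow> (\<Sum>x\<in>X. lookup u x) = r"
    and idx_inj: "inj_on idx X" and idx_pos: "x \<in> X \<Longrightarrow> 0 < idx x"
begin

definition exps :: "('x \<Rightarrow>\<^sub>0 nat) set" where
  "exps = {m. keys m \<subseteq> X}"

definition wt :: "('x \<Rightarrow>\<^sub>0 nat) \<Rightarrow> nat" where
  "wt m = (\<Sum>x\<in>X. lookup m x)"

primrec ksums :: "nat \<Rightarrow> ('x \<Rightarrow>\<^sub>0 nat) set" where
  "ksums 0 = {0}"
| "ksums (Suc k) = {u + s | u s. u \<in> U \<and> s \<in> ksums k}"

lemma add_submonoid_exps: "add_submonoid exps"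
  unfolding add_submonoid_def exps_def using Poly_Mapping.keys_add by fastforce

lemma wt_add: "wt (m + n) = wt m + wt n"
  by (simp add: wt_def lookup_add sum.distrib)

lemma wt_zero_iff: "m \<in> exps \<Longrightarrow> wt m = 0 \<longleftrightarrow> m = 0"
  using finX by (auto simp: wt_def exps_def in_keys_iff intro!: poly_mapping_eqI)

lemma ksums_exps: "ksums k \<subseteq> exps"
proof (induction k)
  case (Suc k)
  have "U \<subseteq> exps" using U_keys by (auto simp: exps_def)
  then show ?case using add_submonoid_exps Suc unfolding add_submonoid_def by auto
qed (simp add: exps_def)

lemma ksums_wt: "s \<in> ksums k \<Longrightarrow> wt s = k * r"
proof (induction k arbitrary: s)
  case 0
  then show ?case by (simp add: wt_def)
next
  case (Suc k)
  then obtain u s' where "s = u + s'" "u \<in> U" "s' \<in> ksums k" by auto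
  then show ?case using Suc.IH[of s'] U_degree[of u] by (simp add: wt_add) (simp add: wt_def)
qed

lemma finite_ksums: "finite (ksums k)"
proof (induction k)
  case (Suc k)
  have "ksums (Suc k) = (\<lambda>(u, s). u + s) ` (U \<times> ksums k)" by auto
  then show ?case using Suc finU by simp
qed simp

lemma ksums_add: "a \<in> ksums k \<Longrightarrow> b \<in> ksums l \<Longrightarrow> a + b \<in> ksums (k + l)"
proof (induction k arbitrary: a)
  case (Suc k)
  then obtain u s where "a = u + s" "u \<in> U" "s \<in> ksums k" by auto
  then show ?case using Suc.IH[of s] Suc.prems by (auto simp: add.assoc)
qed simp

definition R :: "('x, 'k::field) mpol ring" where
  "R = poly_ring X"

definition I :: "('x, 'k::field) mpol set" where
  "I = genideal R ((\<lambda>u. single u 1) ` U)"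

definition mm :: "('x, 'k::field) mpol set" where
  "mm = genideal R (pvar ` X)"

lemma R_eq: "R = monoid_ring exps"
  by (simp add: R_def poly_ring_eq_monoid_ring exps_def)

lemma U_exps: "U \<subseteq> exps"
  using U_keys by (auto simp: exps_def)

lemma I_eq: "I = monomial_ideal exps U"
  unfolding I_def R_eq by (rule genideal_monomials[OF add_submonoid_exps U_exps])

lemma mm_eq: "mm = (monomial_ideal exps ((\<lambda>x. single x 1) ` X) :: ('x, 'k::field) mpol set)"
proof -
  have "(pvar ` X :: ('x, 'k) mpol set) = (\<lambda>u. single u (1::'k)) ` (\<lambda>x. single x 1) ` X"
    by (auto simp: pvar_def)
  moreover have "(\<lambda>x. single x 1) ` X \<subseteq> exps" by (auto simp: exps_def)
  ultimately show ?thesis unfolding mm_def R_eq using genideal_monomials[OF add_submonoid_exps] by simp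
qed

lemma ideal_power_eq: "ideal_power R I k = (monomial_ideal exps (ksums k) :: ('x, 'k::field) mpol set)"
proof (induction k)
  case 0
  show ?case by (auto simp: R_eq monomial_ideal_def)
next
  case (Suc k)
  have "ideal_power R I (Suc k) = ideal_prod R I (monomial_ideal exps (ksums k) :: ('x, 'k) mpol set)"
    using Suc by simp
  also have "\<dots> = monomial_ideal exps (ksums (Suc k))"
    unfolding R_eq I_eq using ideal_prod_monomials[OF add_submonoid_exps U_exps ksums_exps] by simp
  finally show ?case .
qed

lemma power_keys:
  assumes "p \<in> monomial_ideal exps (ksums k)" "w \<in> keys p"
  shows "w \<in> exps" "k * r \<le> wt w" "wt w = k * r \<longleftrightarrow> w \<in> ksums k"
proof -
  obtain s v where sv: "s \<in> ksums k" "v \<in> exps" "w = s + v" using assms by (auto simp: monomial_ideal_def)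
  show "w \<in> exps" using sv ksums_exps add_submonoid_exps by (auto simp: add_submonoid_def)
  show "k * r \<le> wt w" using sv ksums_wt by (simp add: wt_add)
  show "wt w = k * r \<longleftrightarrow> w \<in> ksums k"
  proof
    assume "wt w = k * r"
    then have "wt v = 0" using sv ksums_wt by (simp add: wt_add)
    then show "w \<in> ksums k" using wt_zero_iff sv by simp
  qed (rule ksums_wt)
qed

text \<open>The exponents \<open>ksums k\<close> are those of the least degree \<open>k r\<close> in the power \<open>I\<^sup>k\<close>, and every other monomial in it
  is divisible by one of these with a nontrivial quotient.\<close>

lemma mm_power_iff:
  "p \<in> ideal_prod R mm (ideal_power R I k) \<longleftrightarrow>
     p \<in> monomial_ideal exps (ksums k) \<and> restrict_keys (ksums k) p = (0 :: ('x, 'k::field) mpol)"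
proof -
  let ?X = "(\<lambda>x. single x (1::nat)) ` X"
  have XE: "?X \<subseteq> exps" by (auto simp: exps_def)
  have eq: "ideal_prod R mm (ideal_power R I k) = (monomial_ideal exps {u + s | u s. u \<in> ?X \<and> s \<in> ksums k} :: ('x, 'k) mpol set)"
    unfolding ideal_power_eq unfolding mm_eq R_eq by (rule ideal_prod_monomials[OF add_submonoid_exps XE ksums_exps])
  show ?thesis
  proof
    assume p: "p \<in> ideal_prod R mm (ideal_power R I k)"
    have *: "\<exists>s\<in>ksums k. \<exists>v\<in>exps. m = s + v \<and> v \<noteq> 0" if m: "m \<in> keys p" for m
    proof -
      obtain x s v where x: "x \<in> X" "s \<in> ksums k" "v \<in> exps" "m = (single x 1 + s) + v"
        using p m unfolding eq monomial_ideal_def by blast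
      have "wt (single x 1 + v) \<noteq> 0"
        using x(1) finX by (simp add: wt_add) (auto simp: wt_def lookup_single when_def)
      then have "single x 1 + v \<noteq> 0" by (auto simp: wt_def)
      moreover have "single x 1 + v \<in> exps" using x add_submonoid_exps XE by (auto simp: add_submonoid_def)
      moreover have "m = s + (single x 1 + v)" using x(4) by (simp add: ac_simps)
      ultimately show ?thesis using x(2) by blast
    qed
    have "p \<in> monomial_ideal exps (ksums k)" unfolding monomial_ideal_def using * by blast
    moreover have "m \<notin> ksums k" if m: "m \<in> keys p" for m
    proof -
      obtain s v where "s \<in> ksums k" "v \<in> exps" "m = s + v" "v \<noteq> 0" using *[OF m] by blast
      then show ?thesis using ksums_wt[of m k] ksums_wt[of s k] wt_zero_iff[of v] by (auto simp: wt_add)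
    qed
    ultimately show "p \<in> monomial_ideal exps (ksums k) \<and> restrict_keys (ksums k) p = 0"
      by (auto intro: restrict_keys_0)
  next
    assume p: "p \<in> monomial_ideal exps (ksums k) \<and> restrict_keys (ksums k) p = 0"
    show "p \<in> ideal_prod R mm (ideal_power R I k)"
      unfolding eq monomial_ideal_def
    proof clarify
      fix m assume m: "m \<in> keys p"
      obtain s v where sv: "s \<in> ksums k" "v \<in> exps" "m = s + v" using p m by (auto simp: monomial_ideal_def)
      have "keys p \<inter> ksums k = {}" using p keys_restrict_keys[of "ksums k" p] by simp
      then have "m \<notin> ksums k" using m by blast
      then have "v \<noteq> 0" using sv by auto
      then obtain x where x: "x \<in> keys v" by (metis keys_eq_empty equals0I)
      have xX: "x \<in> X" using x sv by (auto simp: exps_def)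
      define v' where "v' = v - single x 1"
      have v: "v = single x 1 + v'"
        using x by (intro poly_mapping_eqI) (auto simp: v'_def lookup_add lookup_minus lookup_single when_def in_keys_iff)
      have "v' \<in> exps" using sv(2) by (auto simp: exps_def v'_def in_keys_iff lookup_minus)
      moreover have "m = (single x 1 + s) + v'" unfolding sv(3) v by (simp add: ac_simps)
      moreover have "single x 1 + s \<in> {u + s | u s. u \<in> ?X \<and> s \<in> ksums k}"
        using xX sv(1) by blast
      ultimately show "\<exists>u\<in>{u + s | u s. u \<in> ?X \<and> s \<in> ksums k}. \<exists>v\<in>exps. m = u + v" by blast
    qed
  qed
qed

text \<open>Index \<open>0\<close> records the degree \<open>k\<close>, which is why the variables are numbered by positive integers.\<close>

definition enc :: "nat \<Rightarrow> ('x \<Rightarrow>\<^sub>0 nat) \<Rightarrow> nat \<Rightarrow>\<^sub>0 nat" where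
  "enc k w = single 0 k + (\<Sum>x\<in>X. single (idx x) (lookup w x))"

lemma enc_add: "enc (k + l) (v + w) = enc k v + enc l w"
  by (simp add: enc_def lookup_add single_add sum.distrib ac_simps)

lemma enc_zero: "enc 0 0 = 0"
  by (simp add: enc_def)

lemma lookup_enc_0: "lookup (enc k w) 0 = k"
proof -
  have "(\<Sum>x\<in>X. lookup (single (idx x) (lookup w x)) 0) = 0"
  proof (intro sum.neutral ballI)
    fix x assume "x \<in> X"
    then have "idx x \<noteq> 0" using idx_pos by force
    then show "lookup (single (idx x) (lookup w x)) 0 = 0"
      by (simp add: lookup_single)
  qed
  then show ?thesis by (simp add: enc_def lookup_add lookup_sum)
qed

lemma lookup_enc: "x \<in> X \<Longrightarrow> lookup (enc k w) (idx x) = lookup w x"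
proof -
  assume x: "x \<in> X"
  have "(\<Sum>y\<in>X. lookup (single (idx y) (lookup w y)) (idx x)) =
      (\<Sum>y\<in>X. if y = x then lookup w y else 0)"
    using idx_inj x by (intro sum.cong) (auto simp: lookup_single when_def inj_on_def)
  then show ?thesis using x finX idx_pos[OF x] by (simp add: enc_def lookup_add lookup_sum lookup_single)
qed

lemma enc_inj: "v \<in> exps \<Longrightarrow> w \<in> exps \<Longrightarrow> enc k v = enc l w \<Longrightarrow> k = l \<and> v = w"
proof -
  assume a: "v \<in> exps" "w \<in> exps" "enc k v = enc l w"
  have "k = l" using lookup_enc_0 a(3) by metis
  moreover have "lookup v x = lookup w x" for x
  proof (cases "x \<in> X")
    case True
    then show ?thesis using lookup_enc a(3) by metis
  next
    case False
    then have "x \<notin> keys v" "x \<notin> keys w" using a by (auto simp: exps_def)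
    then show ?thesis by (simp add: in_keys_iff)
  qed
  ultimately show ?thesis by (auto intro: poly_mapping_eqI)
qed

definition level :: "nat \<Rightarrow> (nat \<Rightarrow>\<^sub>0 nat) set" where
  "level k = enc k ` ksums k"

definition graded_exps :: "(nat \<Rightarrow>\<^sub>0 nat) set" where
  "graded_exps = (\<Union>k. level k)"

lemma card_level: "card (level k) = card (ksums k)"
  unfolding level_def using enc_inj ksums_exps by (intro card_image inj_onI) blast

lemma finite_level: "finite (level k)"
  by (simp add: level_def finite_ksums)

lemma add_submonoid_graded_exps: "add_submonoid graded_exps"
proof -
  have "m + n \<in> graded_exps" if "m \<in> graded_exps" "n \<in> graded_exps" for m n
  proof -
    obtain k v l w where "m = enc k v" "v \<in> ksums k" "n = enc l w" "w \<in> ksums l"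
      using \<open>m \<in> graded_exps\<close> \<open>n \<in> graded_exps\<close> by (auto simp: graded_exps_def level_def)
    then have "m + n = enc (k + l) (v + w)" "v + w \<in> ksums (k + l)" by (simp_all add: enc_add ksums_add)
    then show ?thesis by (auto simp: graded_exps_def level_def)
  qed
  moreover have "0 \<in> level 0" by (simp add: level_def enc_zero)
  then have "0 \<in> graded_exps" unfolding graded_exps_def by blast
  ultimately show ?thesis by (simp add: add_submonoid_def)
qed

text \<open>The lowest part of an element of \<open>I\<^sup>k\<close>. Its encoding remembers \<open>k\<close>.\<close>

definition initial :: "nat \<Rightarrow> ('x, 'k::field) mpol \<Rightarrow> (nat, 'k) mpol" where
  "initial k p = push (enc k) (restrict_keys (ksums k) p)"

lemma initial_add: "initial k (p + q) = initial k p + initial k q"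
  by (simp add: initial_def restrict_keys_add push_add)

lemma initial_sum: "initial k (\<Sum>i\<in>A. f i) = (\<Sum>i\<in>A. initial k (f i))"
  by (simp add: initial_def restrict_keys_sum push_sum)

lemma initial_zero [simp]: "initial k 0 = 0"
  by (simp add: initial_def restrict_keys_def)

lemma keys_initial: "keys (initial k p) \<subseteq> level k"
  using keys_push[of "enc k" "restrict_keys (ksums k) p"] by (auto simp: initial_def keys_restrict_keys level_def)

lemma lookup_initial:
  assumes "w \<in> ksums k"
  shows "lookup (initial k p) (enc k w) = lookup p w"
proof -
  have "inj_on (enc k) (ksums k)" using enc_inj ksums_exps by (intro inj_onI) blast
  then show ?thesis unfolding initial_def
    using assms by (subst lookup_push[of "enc k" "ksums k"]) (auto simp: keys_restrict_keys)
qed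

text \<open>A product of two monomials has the least degree \<open>(k + l) r\<close> only if both factors have the least degree.\<close>

lemma initial_mult:
  assumes p: "p \<in> monomial_ideal exps (ksums k)" and q: "q \<in> monomial_ideal exps (ksums l)"
  shows "initial (k + l) (p * q) = initial k p * (initial l q :: (nat, 'k::field) mpol)"
proof -
  define a a' where "a = restrict_keys (ksums k) p" and "a' = restrict_keys (- ksums k) p"
  define b b' where "b = restrict_keys (ksums l) q" and "b' = restrict_keys (- ksums l) q"
  have pq: "p = a + a'" "q = b + b'"
    unfolding a_def a'_def b_def b'_def by (rule restrict_keys_split)+
  have ka: "keys a \<subseteq> ksums k" and kb: "keys b \<subseteq> ksums l"
    by (auto simp: a_def b_def keys_restrict_keys)
  have la: "k * r < wt m" if "m \<in> keys a'" for m
    using power_keys(2,3)[OF p, of m] that by (auto simp: a'_def keys_restrict_keys le_less)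
  have lb: "l * r < wt m" if "m \<in> keys b'" for m
    using power_keys(2,3)[OF q, of m] that by (auto simp: b'_def keys_restrict_keys le_less)
  have ab: "keys (a * b) \<subseteq> ksums (k + l)"
    using Poly_Mapping.keys_mult[of a b] ka kb ksums_add by blast
  have off: "restrict_keys (ksums (k + l)) (f * g) = 0"
    if big: "\<And>m n. m \<in> keys f \<Longrightarrow> n \<in> keys g \<Longrightarrow> (k + l) * r < wt m + wt n"
    for f g :: "('x, 'k) mpol"
  proof (rule restrict_keys_0)
    have "m + n \<notin> ksums (k + l)" if "m \<in> keys f" "n \<in> keys g" for m n
      using big[OF that] ksums_wt[of "m + n" "k + l"] by (auto simp: wt_add)
    then show "keys (f * g) \<inter> ksums (k + l) = {}" using Poly_Mapping.keys_mult[of f g] by blast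
  qed
  have "restrict_keys (ksums (k + l)) (p * q) = restrict_keys (ksums (k + l)) (a * b) +
     restrict_keys (ksums (k + l)) (a * b') + restrict_keys (ksums (k + l)) (a' * b) + restrict_keys (ksums (k + l)) (a' * b')"
    unfolding pq by (simp add: algebra_simps restrict_keys_add)
  also have "restrict_keys (ksums (k + l)) (a * b') = 0"
    using ka lb ksums_wt by (intro off) (fastforce simp: add_mult_distrib)
  also have "restrict_keys (ksums (k + l)) (a' * b) = 0"
    using kb la ksums_wt by (intro off) (fastforce simp: add_mult_distrib)
  also have "restrict_keys (ksums (k + l)) (a' * b') = 0"
    using lb la by (intro off) (fastforce simp: add_mult_distrib)
  also have "restrict_keys (ksums (k + l)) (a * b) = a * b" by (rule restrict_keys_id[OF ab])
  finally have "restrict_keys (ksums (k + l)) (p * q) = a * b" by simp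
  then show ?thesis unfolding initial_def a_def b_def by (simp add: push_mult enc_add)
qed

section \<open>The fiber cone as a semigroup ring\<close>

abbreviation cf :: "(nat \<Rightarrow> ('x, 'k::field) mpol) \<Rightarrow> nat \<Rightarrow> ('x, 'k) mpol" where
  "cf \<equiv> up_ring.coeff (UP R)"

lemma R_cring: "cring (R :: ('x, 'k::field) mpol ring)"
  unfolding R_eq by (rule monoid_ring_cring[OF add_submonoid_exps])

lemma cf_bounded:
  assumes "p \<in> carrier (UP (R :: ('x, 'k::field) mpol ring))"
  shows "\<exists>N. \<forall>k>N. cf p k = 0"
  using assms by (auto simp: UP_def up_def bound_def R_eq)

definition rees :: "(('x, 'k::field) mpol, nat \<Rightarrow> ('x, 'k) mpol) up_ring" where
  "rees = rees_algebra R I"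

lemma rees_simps:
  "carrier rees = {p \<in> carrier (UP R). \<forall>k. cf p k \<in> monomial_ideal exps (ksums k)}"
  "mult rees = mult (UP R)" "add rees = add (UP R)" "one rees = one (UP R)" "zero rees = zero (UP R)"
  by (simp_all add: rees_def rees_algebra_def ideal_power_eq)

lemma UP_cring_R: "UP_cring (R :: ('x, 'k::field) mpol ring)"
  by (intro UP_cring.intro R_cring)

lemma R_simps:
  "carrier (R :: ('x, 'k::field) mpol ring) = {p. keys p \<subseteq> exps}"
  "mult (R :: ('x, 'k) mpol ring) = (*)" "add (R :: ('x, 'k) mpol ring) = (+)"
  "one (R :: ('x, 'k) mpol ring) = 1" "zero (R :: ('x, 'k) mpol ring) = 0"
  by (simp_all add: R_eq)

lemma R_finsum:
  "(\<And>i. i \<in> A \<Longrightarrow> keys (f i) \<subseteq> exps) \<Longrightarrow> finsum R f A = (\<Sum>i\<in>A. f i :: ('x, 'k::field) mpol)"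
  unfolding R_eq by (rule monoid_ring_finsum[OF add_submonoid_exps])

lemma ideal_sums:
  assumes "\<And>i. i \<in> A \<Longrightarrow> f i \<in> monomial_ideal exps W"
  shows "(\<Sum>i\<in>A. f i) \<in> monomial_ideal exps W"
  using assms
  by (induction A rule: infinite_finite_induct)
    (simp_all add: monomial_ideal_closed(1,2)[OF add_submonoid_exps])

lemma power_mult:
  assumes "p \<in> monomial_ideal exps (ksums k)" "q \<in> monomial_ideal exps (ksums l)"
  shows "p * q \<in> (monomial_ideal exps (ksums (k + l)) :: ('x, 'k::field) mpol set)"
proof -
  have "{u + u' | u u'. u \<in> ksums k \<and> u' \<in> ksums l} \<subseteq> ksums (k + l)" using ksums_add by blast
  then show ?thesis
    using monomial_ideal_closed(4)[OF add_submonoid_exps assms] unfolding monomial_ideal_def by blast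
qed

lemma power_carrier: "p \<in> monomial_ideal exps (ksums k) \<Longrightarrow> keys p \<subseteq> exps"
  using monomial_ideal_carrier[OF add_submonoid_exps ksums_exps] by auto

lemma cf_mult:
  assumes "p \<in> carrier rees" "q \<in> carrier (rees :: (('x, 'k::field) mpol, _) up_ring)"
  shows "cf (p \<otimes>\<^bsub>rees\<^esub> q) n = (\<Sum>i\<le>n. cf p i * cf q (n - i))"
proof -
  interpret UP_cring "R :: ('x, 'k) mpol ring" "UP R" by (rule UP_cring_R)
  have "cf (p \<otimes>\<^bsub>rees\<^esub> q) n = finsum R (\<lambda>i. cf p i \<otimes>\<^bsub>R\<^esub> cf q (n - i)) {..n}"
    using assms by (simp add: rees_simps)
  also have "\<dots> = (\<Sum>i\<le>n. cf p i * cf q (n - i))"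
    unfolding R_simps(2)
  proof (rule R_finsum)
    show "keys (cf p i * cf q (n - i)) \<subseteq> exps" for i
      using assms power_carrier[of "cf p i" i] power_carrier[of "cf q (n - i)" "n - i"]
      by (intro keys_mult_add_submonoid[OF add_submonoid_exps]) (auto simp: rees_simps)
  qed
  finally show ?thesis .
qed

lemma cf_simps:
  fixes p q :: "nat \<Rightarrow> ('x, 'k::field) mpol" and a :: "('x, 'k) mpol"
  shows "p \<in> carrier rees \<Longrightarrow> q \<in> carrier rees \<Longrightarrow> cf (p \<oplus>\<^bsub>rees\<^esub> q) n = cf p n + cf q n"
    and "cf (\<one>\<^bsub>rees\<^esub> :: nat \<Rightarrow> ('x, 'k) mpol) n = (if n = 0 then 1 else 0)"
    and "a \<in> monomial_ideal exps (ksums k) \<Longrightarrow> cf (up_ring.monom (UP R) a k) n = (if n = k then a else 0)"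
    and "a \<in> monomial_ideal exps (ksums k) \<Longrightarrow> up_ring.monom (UP R) a k \<in> carrier rees"
proof -
  interpret UP_cring "R :: ('x, 'k) mpol ring" "UP R" by (rule UP_cring_R)
  show "p \<in> carrier rees \<Longrightarrow> q \<in> carrier rees \<Longrightarrow> cf (p \<oplus>\<^bsub>rees\<^esub> q) n = cf p n + cf q n"
    by (simp add: rees_simps R_simps)
  show "cf (\<one>\<^bsub>rees\<^esub> :: nat \<Rightarrow> ('x, 'k) mpol) n = (if n = 0 then 1 else 0)"
    by (simp add: rees_simps R_simps)
  assume a: "a \<in> monomial_ideal exps (ksums k)"
  then have aR: "a \<in> carrier R" using power_carrier[of a k] by (simp add: R_simps)
  show co: "cf (up_ring.monom (UP R) a k) n = (if n = k then a else 0)" for n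
    using coeff_monom[OF aR, of k n] by (simp add: R_simps)
  show "up_ring.monom (UP R) a k \<in> carrier rees"
    using a monom_closed[OF aR] by (simp add: rees_simps co monomial_ideal_closed(1)[OF add_submonoid_exps])
qed

lemma rees_ring: "ring (rees :: (('x, 'k::field) mpol, _) up_ring)"
proof -
  interpret UP_cring "R :: ('x, 'k) mpol ring" "UP R" by (rule UP_cring_R)
  let ?H = "carrier (rees :: (('x, 'k) mpol, _) up_ring)"
  have "subring ?H (UP R)"
  proof (rule P.subringI)
    show "?H \<subseteq> carrier (UP R)" by (auto simp: rees_simps)
    have "1 \<in> (monomial_ideal exps (ksums 0) :: ('x, 'k) mpol set)"
      by (auto simp: monomial_ideal_def exps_def)
    then show "\<one>\<^bsub>UP R\<^esub> \<in> ?H"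
      using cf_simps(2)[where 'k = 'k] P.one_closed
      by (simp add: rees_simps monomial_ideal_closed(1)[OF add_submonoid_exps] del: coeff_one)
  next
    fix p :: "nat \<Rightarrow> ('x, 'k) mpol" assume p: "p \<in> ?H"
    have "cf (\<ominus>\<^bsub>UP R\<^esub> p) k = - cf p k" for k
    proof -
      have "cf (\<ominus>\<^bsub>UP R\<^esub> p) k = \<ominus>\<^bsub>R\<^esub> cf p k" using p by (intro coeff_a_inv) (simp add: rees_simps)
      also have "\<dots> = - cf p k"
        unfolding R_eq using p power_carrier
        by (intro monoid_ring_uminus[OF add_submonoid_exps]) (auto simp: rees_simps R_eq)
      finally show ?thesis .
    qed
    then show "\<ominus>\<^bsub>UP R\<^esub> p \<in> ?H"
      using p by (simp add: rees_simps monomial_ideal_closed(3)[OF add_submonoid_exps] del: coeff_a_inv)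
  next
    fix p q :: "nat \<Rightarrow> ('x, 'k) mpol" assume p: "p \<in> ?H" and q: "q \<in> ?H"
    have "cf p i * cf q (n - i) \<in> monomial_ideal exps (ksums n)" if "i \<le> n" for i n
      using power_mult[of "cf p i" i "cf q (n - i)" "n - i"] p q that by (simp add: rees_simps)
    then have "cf (p \<otimes>\<^bsub>rees\<^esub> q) n \<in> monomial_ideal exps (ksums n)" for n
      unfolding cf_mult[OF p q] by (intro ideal_sums) simp
    then show "p \<otimes>\<^bsub>UP R\<^esub> q \<in> ?H"
      using p q by (simp add: rees_simps del: coeff_mult)
    show "p \<oplus>\<^bsub>UP R\<^esub> q \<in> ?H"
      using cf_simps(1)[OF p q] p q
      by (simp add: rees_simps monomial_ideal_closed(2)[OF add_submonoid_exps] del: coeff_add)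
  qed
  then have "ring ((UP R)\<lparr>carrier := ?H\<rparr>)" by (rule P.subring_is_ring)
  moreover have "(UP R)\<lparr>carrier := ?H\<rparr> = (rees :: (('x, 'k) mpol, _) up_ring)"
    by (simp add: rees_def rees_algebra_def)
  ultimately show ?thesis by simp
qed

lemma rees_cring: "cring (rees :: (('x, 'k::field) mpol, _) up_ring)"
proof (intro cring.intro rees_ring)
  interpret UP_cring "R :: ('x, 'k) mpol ring" "UP R" by (rule UP_cring_R)
  interpret rees: ring "rees :: (('x, 'k) mpol, _) up_ring" by (rule rees_ring)
  show "comm_monoid (rees :: (('x, 'k) mpol, _) up_ring)"
    by (rule rees.monoid_comm_monoidI) (simp add: rees_simps P.m_comm)
qed

definition Psi :: "(nat \<Rightarrow> ('x, 'k::field) mpol) \<Rightarrow> (nat, 'k) mpol" where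
  "Psi p = (\<Sum>k | cf p k \<noteq> 0. initial k (cf p k))"

lemma Psi_bound: "(\<And>k. k > N \<Longrightarrow> cf p k = 0) \<Longrightarrow> Psi p = (\<Sum>k\<le>N. initial k (cf p k))"
  unfolding Psi_def by (rule sum.mono_neutral_left) (auto simp: not_less[symmetric])

lemma rees_bounded: "p \<in> carrier rees \<Longrightarrow> \<exists>N. \<forall>k>N. cf p k = 0"
  using cf_bounded by (auto simp: rees_simps)

lemma Psi_add:
  assumes "p \<in> carrier rees" "q \<in> carrier rees"
  shows "Psi (p \<oplus>\<^bsub>rees\<^esub> q) = Psi p + (Psi q :: (nat, 'k::field) mpol)"
proof -
  obtain M N where "\<forall>k>M. cf p k = 0" "\<forall>k>N. cf q k = 0" using rees_bounded assms by blast
  then show ?thesis using assms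
    by (simp add: Psi_bound[of "max M N"] cf_simps initial_add sum.distrib)
qed

lemma Psi_mult:
  assumes p: "p \<in> carrier rees" and q: "q \<in> carrier rees"
  shows "Psi (p \<otimes>\<^bsub>rees\<^esub> q) = Psi p * (Psi q :: (nat, 'k::field) mpol)"
proof -
  obtain M N where MN: "\<And>k. k > M \<Longrightarrow> cf p k = 0" "\<And>k. k > N \<Longrightarrow> cf q k = 0"
    using rees_bounded assms by blast
  define a b where "a i = initial i (cf p i)" and "b i = initial i (cf q i)" for i
  have a0: "a i = 0" if "\<not> i \<le> M" for i using MN(1)[of i] that by (simp add: a_def)
  have b0: "b i = 0" if "\<not> i \<le> N" for i using MN(2)[of i] that by (simp add: b_def)
  have prod: "initial n (cf (p \<otimes>\<^bsub>rees\<^esub> q) n) = (\<Sum>i\<le>n. a i * b (n - i))" for n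
  proof -
    have "initial n (cf p i * cf q (n - i)) = a i * b (n - i)" if "i \<le> n" for i
      using initial_mult[of "cf p i" i "cf q (n - i)" "n - i"] p q that by (simp add: rees_simps a_def b_def)
    then show ?thesis unfolding cf_mult[OF assms] by (simp add: initial_sum)
  qed
  have "cf (p \<otimes>\<^bsub>rees\<^esub> q) n = 0" if "n > M + N" for n
    unfolding cf_mult[OF assms]
  proof (intro sum.neutral ballI)
    fix i assume "i \<in> {..n}"
    then have "i > M \<or> n - i > N" using that by auto
    then show "cf p i * cf q (n - i) = 0" using MN by auto
  qed
  then have "Psi (p \<otimes>\<^bsub>rees\<^esub> q) = (\<Sum>n\<le>M + N. \<Sum>i\<le>n. a i * b (n - i))"
    by (simp add: Psi_bound[of "M + N"] prod)
  also have "\<dots> = (\<Sum>(i, j)\<in>{(i, j). i + j \<le> M + N}. a i * b j)"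
    by (rule sum.triangle_reindex_eq[symmetric])
  also have "\<dots> = (\<Sum>(i, j)\<in>{..M} \<times> {..N}. a i * b j)"
  proof (rule sum.mono_neutral_right)
    show "finite {(i, j). i + j \<le> M + N}"
      by (rule finite_subset[of _ "{..M + N} \<times> {..M + N}"]) auto
    show "\<forall>x\<in>{(i, j). i + j \<le> M + N} - {..M} \<times> {..N}. (case x of (i, j) \<Rightarrow> a i * b j) = 0"
      by clarsimp (metis a0 b0)
  qed auto
  also have "\<dots> = (\<Sum>i\<le>M. a i) * (\<Sum>j\<le>N. b j)"
    by (simp add: sum_product sum.cartesian_product)
  also have "\<dots> = Psi p * Psi q"
    using MN by (simp add: Psi_bound[of M p] Psi_bound[of N q] a_def b_def)
  finally show ?thesis .
qed

lemma lookup_Psi: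
  assumes p: "p \<in> carrier rees" and w: "w \<in> ksums j"
  shows "lookup (Psi p) (enc j w) = lookup (cf p j) w"
proof -
  obtain N where N: "\<forall>k>N. cf p k = 0" using rees_bounded p by blast
  have other: "lookup (initial k (cf p k)) (enc j w) = (if k = j then lookup (cf p j) w else 0)" for k
  proof (cases "k = j")
    case False
    have "enc j w \<notin> level k"
    proof
      assume "enc j w \<in> level k"
      then obtain v where "v \<in> ksums k" "enc j w = enc k v" by (auto simp: level_def)
      then show False using enc_inj[of w v j k] w ksums_exps False by blast
    qed
    then show ?thesis using keys_initial[of k "cf p k"] False by (auto simp: in_keys_iff)
  qed (simp add: lookup_initial[OF w])
  have "Psi p = (\<Sum>k\<le>max N j. initial k (cf p k))" using N by (intro Psi_bound) auto
  then show ?thesis by (simp add: lookup_sum other)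
qed

lemma keys_Psi: "keys (Psi p) \<subseteq> graded_exps"
  unfolding Psi_def using keys_initial by (intro keys_sum_subset) (auto simp: graded_exps_def)

lemma Psi_monom:
  assumes "a \<in> monomial_ideal exps (ksums k)"
  shows "Psi (up_ring.monom (UP R) a k) = (initial k a :: (nat, 'k::field) mpol)"
proof -
  have "Psi (up_ring.monom (UP R) a k) = (\<Sum>j\<le>k. initial j (if j = k then a else 0))"
    by (subst Psi_bound[of k]) (simp_all add: cf_simps(3)[OF assms])
  also have "\<dots> = (\<Sum>j\<le>k. if j = k then initial k a else 0)" by (intro sum.cong) auto
  finally show ?thesis by simp
qed

lemma initial_image: "initial k ` monomial_ideal exps (ksums k) = {f :: (nat, 'k::field) mpol. keys f \<subseteq> level k}"
proof (intro equalityI subsetI)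
  fix f :: "(nat, 'k) mpol" assume "f \<in> {f. keys f \<subseteq> level k}"
  then have f: "keys f \<subseteq> level k" by simp
  define a where "a = (\<Sum>w\<in>ksums k. single w (lookup f (enc k w)))"
  have la: "lookup a w = (if w \<in> ksums k then lookup f (enc k w) else 0)" for w
    by (simp add: a_def lookup_sum lookup_single when_def finite_ksums)
  have "keys a \<subseteq> ksums k" by (auto simp: in_keys_iff la split: if_splits)
  moreover have "0 \<in> exps" by (simp add: exps_def)
  ultimately have aI: "a \<in> monomial_ideal exps (ksums k)"
    unfolding monomial_ideal_def by simp (metis add.right_neutral subsetD)
  have "lookup (initial k a) m = lookup f m" for m
  proof (cases "m \<in> level k")
    case True
    then show ?thesis by (auto simp: level_def lookup_initial la)
  next
    case False
    then have "m \<notin> keys (initial k a)" "m \<notin> keys f"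
      using keys_initial[of k a] f by blast+
    then show ?thesis by (simp add: in_keys_iff)
  qed
  then have "initial k a = f" by (rule poly_mapping_eqI)
  then show "f \<in> initial k ` monomial_ideal exps (ksums k)" using aI by blast
qed (use keys_initial in auto)

definition Q :: "(nat, 'k::field) mpol ring" where
  "Q = monoid_ring graded_exps"

lemma Psi_hom: "ring_hom_ring rees (Q :: (nat, 'k::field) mpol ring) Psi"
proof (rule ring_hom_ringI2)
  show "ring (rees :: (('x, 'k) mpol, _) up_ring)" by (rule rees_ring)
  show "ring (Q :: (nat, 'k) mpol ring)"
    using monoid_ring_cring[OF add_submonoid_graded_exps] cring.axioms(1) unfolding Q_def by blast
  show "Psi \<in> ring_hom rees (Q :: (nat, 'k) mpol ring)"
  proof (rule ring_hom_memI)
    have "\<one>\<^bsub>rees\<^esub> \<in> carrier (rees :: (('x, 'k) mpol, _) up_ring)"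
      using rees_ring by (rule ring.ring_simprules(6))
    have "Psi (\<one>\<^bsub>rees\<^esub>) = (\<Sum>k\<le>0. initial k (if k = 0 then 1 else 0) :: (nat, 'k) mpol)"
      by (subst Psi_bound[of 0]) (simp_all add: cf_simps(2))
    also have "\<dots> = (1 :: (nat, 'k) mpol)"
      using restrict_keys_id[of "1 :: ('x, 'k) mpol" "{0}"] push_single[of "enc 0" 0 "1::'k"]
      by (simp add: initial_def enc_zero)
    finally show "Psi \<one>\<^bsub>rees\<^esub> = (\<one>\<^bsub>Q\<^esub> :: (nat, 'k) mpol)" by (simp add: Q_def)
  qed (use keys_Psi Psi_add Psi_mult in \<open>simp_all add: Q_def\<close>)
qed

lemma Psi_surj: "Psi ` carrier rees = carrier (Q :: (nat, 'k::field) mpol ring)"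
proof (intro equalityI subsetI)
  fix f :: "(nat, 'k) mpol" assume "f \<in> carrier Q"
  then have f: "keys f \<subseteq> graded_exps" by (simp add: Q_def)
  interpret ring_hom_ring rees "Q :: (nat, 'k) mpol ring" Psi by (rule Psi_hom)
  have mono: "single m c \<in> Psi ` carrier rees" if m: "m \<in> graded_exps" for m and c :: 'k
  proof -
    obtain k where k: "m \<in> level k" using m by (auto simp: graded_exps_def)
    then have "single m c \<in> initial k ` monomial_ideal exps (ksums k)"
      unfolding initial_image by auto
    then obtain a where "a \<in> monomial_ideal exps (ksums k)" "single m c = initial k a" by blast
    then have "single m c = Psi (up_ring.monom (UP R) a k)" "up_ring.monom (UP R) a k \<in> carrier rees"
      using Psi_monom[of a k] cf_simps(4)[of a k] by simp_all
    then show ?thesis by blast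
  qed
  have "(\<Sum>m\<in>A. single m (lookup f m)) \<in> Psi ` carrier rees"
    if "finite A" "A \<subseteq> graded_exps" for A
    using that
  proof (induction A rule: finite_induct)
    case empty
    have "Psi \<zero>\<^bsub>rees\<^esub> = (0 :: (nat, 'k) mpol)" using hom_zero by (simp add: Q_def)
    then show ?case unfolding sum.empty using R.zero_closed by (intro image_eqI[OF sym])
  next
    case (insert m A)
    have "single m (lookup f m) \<in> Psi ` carrier rees"
      using insert.prems by (intro mono) simp
    then obtain p where p: "p \<in> carrier rees" "single m (lookup f m) = Psi p" by (rule imageE)
    have "(\<Sum>m\<in>A. single m (lookup f m)) \<in> Psi ` carrier rees"
      using insert by blast
    then obtain q where q: "q \<in> carrier rees" "(\<Sum>m\<in>A. single m (lookup f m)) = Psi q" by (rule imageE)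
    have "(\<Sum>m\<in>insert m A. single m (lookup f m)) = Psi (p \<oplus>\<^bsub>rees\<^esub> q)"
      using insert.hyps p q by (simp add: Psi_add Q_def)
    then show ?case using R.a_closed[OF p(1) q(1)] by blast
  qed
  from this[OF _ f] show "f \<in> Psi ` carrier rees" by (simp add: sum_of_monomials)
qed (use keys_Psi in \<open>auto simp: Q_def\<close>)

lemma Psi_kernel: "a_kernel rees (Q :: (nat, 'k::field) mpol ring) Psi = fiber_ideal R mm I"
proof (intro equalityI subsetI)
  fix p :: "nat \<Rightarrow> ('x, 'k) mpol" assume "p \<in> a_kernel rees Q Psi"
  then have p: "p \<in> carrier rees" "Psi p = 0" by (auto simp: a_kernel_def' Q_def)
  have "restrict_keys (ksums k) (cf p k) = 0" for k
    using lookup_Psi[OF p(1), of _ k] p(2) by (intro poly_mapping_eqI) simp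
  then show "p \<in> fiber_ideal R mm I"
    using p(1) mm_power_iff by (auto simp: fiber_ideal_def rees_simps)
next
  fix p :: "nat \<Rightarrow> ('x, 'k) mpol" assume p: "p \<in> fiber_ideal R mm I"
  then have "p \<in> carrier rees" "\<And>k. restrict_keys (ksums k) (cf p k) = 0"
    using mm_power_iff by (auto simp: fiber_ideal_def rees_simps)
  then show "p \<in> a_kernel rees Q Psi" by (simp add: a_kernel_def' Q_def Psi_def initial_def)
qed

lemma cring_cong:
  assumes "cring S" "carrier S' = carrier S" "mult S' = mult S" "add S' = add S" "one S' = one S" "zero S' = zero S"
  shows "cring S'"
proof -
  interpret S: cring S by fact
  show ?thesis
  proof (rule cringI)
    show "abelian_group S'"
    proof (rule abelian_groupI)
      show "\<exists>y\<in>carrier S'. y \<oplus>\<^bsub>S'\<^esub> x = \<zero>\<^bsub>S'\<^esub>" if "x \<in> carrier S'" for x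
        using that assms S.l_neg S.a_inv_closed by auto
    qed (simp_all add: assms(2-) S.a_ac)
    show "comm_monoid S'" by (rule comm_monoidI) (simp_all add: assms(2-) S.m_ac)
  qed (simp add: assms(2-) S.l_distr)
qed

text \<open>The homomorphism theorem for \<open>Psi\<close>, which is onto the semigroup ring and whose kernel is the fiber ideal
  by \<open>mm_power_iff\<close>.\<close>

theorem fiber_cone_iso:
  fixes F :: "((nat \<Rightarrow> ('x, 'k::field) mpol) set, 'k) graded_algebra"
  assumes "F = fiber_cone R pconst mm I"
  shows "cring F" "embed F c \<in> carrier F" "component F k \<subseteq> carrier F"
    "\<exists>H. H \<in> ring_iso F (monoid_ring graded_exps) \<and> (\<forall>c. H (embed F c) = pconst c) \<and>
    (\<forall>k. H ` component F k = {f. keys f \<subseteq> level k})"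
proof -
  interpret ring_hom_ring rees "Q :: (nat, 'k) mpol ring" Psi by (rule Psi_hom)
  let ?J = "a_kernel rees (Q :: (nat, 'k) mpol ring) Psi"
  define H where "H Y = the_elem (Psi ` Y)" for Y :: "(nat \<Rightarrow> ('x, 'k) mpol) set"
  have iso: "H \<in> ring_iso (rees Quot ?J) Q"
    unfolding H_def using FactRing_iso_set[OF Psi_surj] .
  have F: "carrier F = carrier (rees Quot ?J)" "mult F = mult (rees Quot ?J)" "add F = add (rees Quot ?J)"
      "one F = one (rees Quot ?J)"
      "embed F c = ?J +>\<^bsub>rees\<^esub> up_ring.monom (UP R) (pconst c) 0"
      "zero F = zero (rees Quot ?J)"
      "component F k = {?J +>\<^bsub>rees\<^esub> up_ring.monom (UP R) a k | a. a \<in> monomial_ideal exps (ksums k)}" for c k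
    unfolding assms fiber_cone_def Psi_kernel rees_def[symmetric] ideal_power_eq[symmetric]
    by (simp_all add: ring.defs Let_def)
  have J: "ideal ?J (rees :: (('x, 'k) mpol, _) up_ring)" by (rule kernel_is_ideal)
  show "cring F"
    by (rule cring_cong[OF ideal.quotient_is_cring[OF J rees_cring]]) (simp_all add: F)
  have coset: "?J +>\<^bsub>rees\<^esub> x \<in> carrier F" if "x \<in> carrier rees" for x
    using ring_hom_closed[OF ideal.rcos_ring_hom[OF J] that] by (simp add: F(1))
  have const: "pconst c \<in> (monomial_ideal exps (ksums 0) :: ('x, 'k) mpol set)" for c :: 'k
    by (auto simp: monomial_ideal_def exps_def pconst_def split: if_splits)
  show "embed F c \<in> carrier F" unfolding F(5) by (intro coset cf_simps(4)[OF const])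
  show "component F k \<subseteq> carrier F" unfolding F(7) using coset cf_simps(4) by blast
  have "H \<in> ring_iso F Q" using iso unfolding ring_iso_def ring_hom_def F by simp
  moreover have cls: "H (?J +>\<^bsub>rees\<^esub> up_ring.monom (UP R) a k) = initial k a" if "a \<in> monomial_ideal exps (ksums k)" for a k
    using the_elem_simp[OF cf_simps(4)[OF that]] Psi_monom[OF that] by (simp add: H_def)
  have "H (embed F c) = pconst c" for c
  proof -
    have "initial 0 (pconst c) = pconst c"
      using restrict_keys_id[of "pconst c :: ('x, 'k) mpol" "{0}"] push_single[of "enc 0" 0 c]
      by (simp add: initial_def enc_zero pconst_def split: if_splits)
    then show ?thesis using cls[OF const] F(5) by simp
  qed
  moreover have "H ` component F k = {f. keys f \<subseteq> level k}" for k
  proof -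
    have "H ` component F k = initial k ` monomial_ideal exps (ksums k)"
    proof -
      have "component F k = (\<lambda>a. ?J +>\<^bsub>rees\<^esub> up_ring.monom (UP R) a k) ` monomial_ideal exps (ksums k)"
        unfolding F(7) by blast
      then show ?thesis by (simp add: image_image cls)
    qed
    then show ?thesis by (simp add: initial_image)
  qed
  ultimately show "\<exists>H. H \<in> ring_iso F (monoid_ring graded_exps) \<and> (\<forall>c. H (embed F c) = pconst c) \<and>
    (\<forall>k. H ` component F k = {f. keys f \<subseteq> level k})"
    unfolding Q_def by blast
qed

end

section \<open>An upper bound for the Krull dimension\<close>

lemma krull_dim_ring_iso:
  fixes A :: "('a, 'c) ring_scheme" and B :: "('b, 'd) ring_scheme"
  assumes A: "cring A" and B: "cring B" and H: "H \<in> ring_iso A B"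
  shows "krull_dim A = krull_dim B"
proof -
  have half: "\<exists>P'. (\<forall>i\<le>l. primeideal (P' i) B') \<and> (\<forall>i<l. P' i \<subset> P' (Suc i))"
    if A': "cring A'" and B': "cring B'" and G: "G \<in> ring_iso B' A'"
      and P: "\<forall>i\<le>l. primeideal (P i) A'" "\<forall>i<l. P i \<subset> P (Suc i)"
    for A' :: "('e, 'f) ring_scheme" and B' :: "('g, 'h) ring_scheme" and G and P :: "nat \<Rightarrow> 'e set" and l
  proof -
    interpret A': cring A' by fact
    interpret B': cring B' by fact
    have "G \<in> ring_hom B' A'" and bij: "bij_betw G (carrier B') (carrier A')" using G by (auto simp: ring_iso_def)
    then interpret ring_hom_ring B' A' G by (intro ring_hom_ringI2 A'.ring_axioms B'.ring_axioms)
    define P' where "P' i = {r \<in> carrier B'. G r \<in> P i}" for i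
    have "primeideal (P' i) B'" if "i \<le> l" for i
      unfolding P'_def using that P(1) by (intro primeideal_vimage B') simp
    moreover have "P' i \<subset> P' (Suc i)" if i: "i < l" for i
    proof -
      obtain x where x: "x \<in> P (Suc i)" "x \<notin> P i" using P(2) i by blast
      have "primeideal (P (Suc i)) A'" using P(1) i by simp
      then have "x \<in> carrier A'" using x(1) by (meson additive_subgroup.a_Hcarr ideal.axioms(1) primeideal.axioms(1))
      then have "x \<in> G ` carrier B'" using bij by (simp add: bij_betw_def)
      then obtain y where y: "y \<in> carrier B'" "G y = x" by blast
      then have "y \<in> P' (Suc i)" "y \<notin> P' i" using x by (auto simp: P'_def)
      then show ?thesis using P(2) i by (auto simp: P'_def)
    qed
    ultimately show ?thesis by blast
  qed
  have H': "inv_into (carrier A) H \<in> ring_iso B A"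
    using ring_iso_set_sym[OF cring.axioms(1)[OF A] H] .
  have "(\<exists>P. (\<forall>i\<le>l. primeideal (P i) A) \<and> (\<forall>i<l. P i \<subset> P (Suc i))) \<longleftrightarrow>
      (\<exists>P. (\<forall>i\<le>l. primeideal (P i) B) \<and> (\<forall>i<l. P i \<subset> P (Suc i)))" for l
  proof
    assume "\<exists>P. (\<forall>i\<le>l. primeideal (P i) A) \<and> (\<forall>i<l. P i \<subset> P (Suc i))"
    then obtain P where "\<forall>i\<le>l. primeideal (P i) A" "\<forall>i<l. P i \<subset> P (Suc i)" by (elim exE conjE)
    then show "\<exists>P. (\<forall>i\<le>l. primeideal (P i) B) \<and> (\<forall>i<l. P i \<subset> P (Suc i))" by (rule half[OF A B H'])
  next
    assume "\<exists>P. (\<forall>i\<le>l. primeideal (P i) B) \<and> (\<forall>i<l. P i \<subset> P (Suc i))"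
    then obtain P where "\<forall>i\<le>l. primeideal (P i) B" "\<forall>i<l. P i \<subset> P (Suc i)" by (elim exE conjE)
    then show "\<exists>P. (\<forall>i\<le>l. primeideal (P i) A) \<and> (\<forall>i<l. P i \<subset> P (Suc i))" by (rule half[OF B A H])
  qed
  then show ?thesis unfolding krull_dim_def by simp
qed

lemma krull_dim_eqI:
  fixes A :: "('a, 'c) ring_scheme" and P :: "nat \<Rightarrow> 'a set"
  assumes "\<And>i. i \<le> d \<Longrightarrow> primeideal (P i) A" "\<And>i. i < d \<Longrightarrow> P i \<subset> P (Suc i)"
    and "\<And>l (P' :: nat \<Rightarrow> 'a set). \<forall>i\<le>l. primeideal (P' i) A \<Longrightarrow> \<forall>i<l. P' i \<subset> P' (Suc i) \<Longrightarrow> l \<le> d"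
  shows "krull_dim A = enat d"
  unfolding krull_dim_def
proof (rule antisym)
  show "Sup {enat l | l. \<exists>P. (\<forall>i\<le>l. primeideal (P i) A) \<and> (\<forall>i<l. P i \<subset> P (Suc i))} \<le> enat d"
    using assms(3) by (intro Sup_least) auto
  show "enat d \<le> Sup {enat l | l. \<exists>P. (\<forall>i\<le>l. primeideal (P i) A) \<and> (\<forall>i<l. P i \<subset> P (Suc i))}"
    using assms(1,2) by (intro Sup_upper) blast
qed

text \<open>All terms but \<open>h 0\<close> are multiples of \<open>f\<close>, so \<open>h 0\<close> lies in \<open>P'\<close> and vanishes. Then \<open>f\<close> can be cancelled modulo
  the prime \<open>P\<close>, which leaves a shorter sum.\<close>

lemma prime_powers_independent:
  fixes P P' :: "('a::comm_monoid_add \<Rightarrow>\<^sub>0 'k::field) set"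
  assumes T: "add_submonoid T" and P: "primeideal P (monoid_ring T)" and P': "primeideal P' (monoid_ring T)"
    and "P \<subseteq> P'" and f: "f \<in> P'" "f \<notin> P"
    and h: "\<And>i. keys (h i) \<subseteq> T" "\<And>i. h i \<in> P' \<Longrightarrow> h i = 0"
    and s: "(\<Sum>i\<le>M. f ^ i * h i) \<in> P"
  shows "i \<le> M \<Longrightarrow> h i = 0"
  using h s
proof (induction M arbitrary: h i)
  interpret P: primeideal P "monoid_ring T" by fact
  interpret P': primeideal P' "monoid_ring T" by fact
  {
    case 0
    then have "h 0 \<in> P'" using \<open>P \<subseteq> P'\<close> by auto
    then show ?case using 0 by auto
  next
    case (Suc M)
    let ?t = "\<Sum>i\<le>M. f ^ i * h (Suc i)"
    have fT: "keys f \<subseteq> T" using P'.a_Hcarr[OF f(1)] by simp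
    have pow: "keys (f ^ j) \<subseteq> T" for j
      using T fT by (induction j) (auto simp: add_submonoid_def dest: keys_mult_add_submonoid[OF T, THEN subsetD, rotated -1])
    have tT: "keys ?t \<subseteq> T"
      using Suc.prems(2) pow by (intro keys_sum_subset keys_mult_add_submonoid[OF T]) auto
    have eq: "(\<Sum>i\<le>Suc M. f ^ i * h i) = h 0 + f * ?t"
      by (simp only: sum.atMost_Suc_shift) (simp add: sum_distrib_left mult.assoc)
    have "f * ?t \<in> P'" using P'.I_r_closed[OF f(1), of ?t] tT by simp
    moreover have "h 0 + f * ?t \<in> P'" using Suc.prems(4) \<open>P \<subseteq> P'\<close> unfolding eq by blast
    moreover have "- (f * ?t) \<in> P'"
      using P'.a_inv_closed[OF calculation(1)] monoid_ring_uminus[OF T, of "f * ?t"] keys_mult_add_submonoid[OF T fT tT] by simp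
    ultimately have "(h 0 + f * ?t) + - (f * ?t) \<in> P'" using P'.a_closed by fastforce
    then have h0: "h 0 = 0" using Suc.prems(3) by simp
    then have "f * ?t \<in> P" using Suc.prems(4) unfolding eq by simp
    then have "?t \<in> P" using P.I_prime[of f ?t] fT tT f(2) by auto
    then have "h (Suc j) = 0" if "j \<le> M" for j
      using Suc.IH[of j "\<lambda>i. h (Suc i)"] Suc.prems(2,3) that by blast
    then show ?case using h0 Suc.prems(1) by (cases i) auto
  }
qed

lemma zero_in_prime: "primeideal P (monoid_ring T) \<Longrightarrow> 0 \<in> P"
  using additive_subgroup.zero_closed[OF ideal.axioms(1)[OF primeideal.axioms(1)]] by fastforce

definition tuples :: "nat \<Rightarrow> nat \<Rightarrow> nat list set" where
  "tuples l N = {xs. set xs \<subseteq> {..N} \<and> length xs = l}"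

lemma finite_tuples: "finite (tuples l N)"
  unfolding tuples_def by (rule finite_lists_length_eq) simp

lemma card_tuples: "card (tuples l N) = (N + 1) ^ l"
  unfolding tuples_def by (subst card_lists_length_eq) auto

lemma tuples_Suc: "tuples (Suc l) N = (\<lambda>(x, xs). x # xs) ` ({..N} \<times> tuples l N)"
  by (auto simp: tuples_def length_Suc_conv image_iff)

text \<open>Elements \<open>f\<^sub>i\<close> of \<open>P (Suc i) - P i\<close> are algebraically independent modulo \<open>P 0\<close>. Here \<open>g xs\<close> is the product of
  their powers with exponents \<open>xs\<close>, and \<open>s\<close> bounds the growth of its support.\<close>

lemma chain_independent:
  fixes P :: "nat \<Rightarrow> ('a::comm_monoid_add \<Rightarrow>\<^sub>0 'k::field) set" and gr :: "'a \<Rightarrow> nat"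
  assumes T: "add_submonoid T" and gr: "\<And>m n. gr (m + n) = gr m + gr n"
    and P: "\<forall>i\<le>l. primeideal (P i) (monoid_ring T)" "\<forall>i<l. P i \<subset> P (Suc i)"
  shows "\<exists>g s. (\<forall>xs. length xs = l \<longrightarrow> keys (g xs) \<subseteq> {m\<in>T. gr m \<le> s * sum_list xs}) \<and>
    (\<forall>N c. (\<Sum>xs\<in>tuples l N. single 0 (c xs) * g xs) \<in> P 0 \<longrightarrow> (\<forall>xs\<in>tuples l N. c xs = 0))"
  using P
proof (induction l arbitrary: P)
  case 0
  interpret primeideal "P 0" "monoid_ring T" using 0 by simp
  have "gr 0 = 0" using gr[of 0 0] by simp
  have "0 \<in> T" using T by (simp add: add_submonoid_def)
  have t: "tuples 0 N = {[]}" for N by (auto simp: tuples_def)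
  have "c = 0" if c: "single 0 c \<in> P 0" for c
  proof (rule ccontr)
    assume "c \<noteq> 0"
    have "single 0 c * single 0 (1 / c) \<in> P 0"
      using I_r_closed[OF c, of "single 0 (1 / c)"] \<open>0 \<in> T\<close> by simp
    then have "1 \<in> P 0" using \<open>c \<noteq> 0\<close> by (simp add: mult_single)
    then have "P 0 = carrier (monoid_ring T)" using one_imp_carrier by simp
    then show False using I_notcarr by simp
  qed
  then show ?case using \<open>gr 0 = 0\<close> \<open>0 \<in> T\<close> t by (intro exI[of _ "\<lambda>_. 1"] exI[of _ 0]) auto
next
  case (Suc l)
  have "\<forall>i\<le>l. primeideal (P (Suc i)) (monoid_ring T)" "\<forall>i<l. P (Suc i) \<subset> P (Suc (Suc i))"
    using Suc.prems by auto
  from Suc.IH[OF this] obtain g s where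
    g: "\<And>xs. length xs = l \<Longrightarrow> keys (g xs) \<subseteq> {m\<in>T. gr m \<le> s * sum_list xs}" and
    ind: "\<And>N c. (\<Sum>xs\<in>tuples l N. single 0 (c xs) * g xs) \<in> P (Suc 0) \<Longrightarrow> \<forall>xs\<in>tuples l N. c xs = 0"
    by blast
  interpret P1: primeideal "P (Suc 0)" "monoid_ring T" using Suc.prems by simp
  have P0: "primeideal (P 0) (monoid_ring T)" using Suc.prems by simp
  have sub: "P 0 \<subset> P (Suc 0)" using Suc.prems by simp
  then obtain f where f: "f \<in> P (Suc 0)" "f \<notin> P 0" by blast
  have fT: "keys f \<subseteq> T" using P1.a_Hcarr[OF f(1)] by simp
  have "0 \<in> T" using T by (simp add: add_submonoid_def)
  have gr0: "gr 0 = 0" using gr[of 0 0] by simp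
  define s0 where "s0 = (\<Sum>m\<in>keys f. gr m)"
  have s0: "gr m \<le> s0" if "m \<in> keys f" for m
    unfolding s0_def by (rule member_le_sum[OF that]) auto
  have pow: "keys (f ^ x) \<subseteq> {m\<in>T. gr m \<le> s0 * x}" for x
  proof (induction x)
    case 0
    then show ?case using \<open>0 \<in> T\<close> gr0 by simp
  next
    case (Suc x)
    show ?case
    proof
      fix m assume "m \<in> keys (f ^ Suc x)"
      then obtain a b where "m = a + b" "a \<in> keys f" "b \<in> keys (f ^ x)"
        using Poly_Mapping.keys_mult[of f "f ^ x"] by auto
      moreover from this have "gr a \<le> s0" "a \<in> T" "gr b \<le> s0 * x" "b \<in> T" using s0 fT Suc by auto
      ultimately show "m \<in> {m\<in>T. gr m \<le> s0 * Suc x}" using T by (auto simp: gr add_submonoid_def)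
    qed
  qed
  define g' where "g' xs = f ^ hd xs * g (tl xs)" for xs
  have "keys (g' xs) \<subseteq> {m\<in>T. gr m \<le> (s0 + s) * sum_list xs}" if len: "length xs = Suc l" for xs
  proof
    obtain x ys where xs: "xs = x # ys" "length ys = l" using len by (auto simp: length_Suc_conv)
    fix m assume "m \<in> keys (g' xs)"
    then obtain a b where ab: "m = a + b" "a \<in> keys (f ^ x)" "b \<in> keys (g ys)"
      using Poly_Mapping.keys_mult[of "f ^ x" "g ys"] by (auto simp: g'_def xs)
    then have *: "a \<in> T" "b \<in> T" "gr a \<le> s0 * x" "gr b \<le> s * sum_list ys" using pow g[OF xs(2)] by blast+
    have "gr m \<le> s0 * x + s * sum_list ys" using * ab(1) by (simp add: gr)
    also have "\<dots> \<le> (s0 + s) * sum_list xs" by (simp add: xs algebra_simps)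
    finally show "m \<in> {m\<in>T. gr m \<le> (s0 + s) * sum_list xs}" using * ab(1) T by (auto simp: add_submonoid_def)
  qed
  moreover have "\<forall>xs\<in>tuples (Suc l) N. c xs = 0"
    if c: "(\<Sum>xs\<in>tuples (Suc l) N. single 0 (c xs) * g' xs) \<in> P 0" for N c
  proof -
    define h where "h x = (\<Sum>ys\<in>tuples l N. single 0 (c (x # ys)) * g ys)" for x
    have "(\<Sum>xs\<in>tuples (Suc l) N. single 0 (c xs) * g' xs) = (\<Sum>x\<le>N. f ^ x * h x)"
    proof -
      have "inj_on (\<lambda>(x, xs). x # xs) ({..N} \<times> tuples l N)" by (auto simp: inj_on_def)
      then have "(\<Sum>xs\<in>tuples (Suc l) N. single 0 (c xs) * g' xs) =
          (\<Sum>(x, ys)\<in>{..N} \<times> tuples l N. single 0 (c (x # ys)) * (f ^ x * g ys))"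
        unfolding tuples_Suc by (subst sum.reindex) (auto simp: g'_def case_prod_unfold)
      also have "\<dots> = (\<Sum>x\<le>N. \<Sum>ys\<in>tuples l N. single 0 (c (x # ys)) * (f ^ x * g ys))"
        by (rule sum.cartesian_product[symmetric])
      also have "\<dots> = (\<Sum>x\<le>N. f ^ x * h x)"
        by (simp add: h_def sum_distrib_left mult.left_commute)
      finally show ?thesis .
    qed
    then have in0: "(\<Sum>x\<le>N. f ^ x * h x) \<in> P 0" using c by simp
    have coeffs: "c (x # ys) = 0" if "h x \<in> P (Suc 0)" "ys \<in> tuples l N" for x ys
      using ind[of "\<lambda>ys. c (x # ys)" N] that by (auto simp: h_def)
    have hT: "keys (h x) \<subseteq> T" for x
      unfolding h_def
    proof (intro keys_sum_subset keys_mult_add_submonoid[OF T])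
      fix ys assume "ys \<in> tuples l N"
      then have "length ys = l" by (simp add: tuples_def)
      then show "keys (g ys) \<subseteq> T" using g by blast
      show "keys (single 0 (c (x # ys))) \<subseteq> T" using \<open>0 \<in> T\<close> by simp
    qed
    have h0: "h x = 0" if "h x \<in> P (Suc 0)" for x
      unfolding h_def using coeffs[OF that] by (intro sum.neutral) simp
    have "h x = 0" if "x \<le> N" for x
      using prime_powers_independent[OF T P0 P1.primeideal_axioms _ f hT h0 in0 that] sub by blast
    moreover have "0 \<in> P (Suc 0)" by (rule zero_in_prime[OF P1.primeideal_axioms])
    ultimately have "c (x # ys) = 0" if "x \<le> N" "ys \<in> tuples l N" for x ys using coeffs that by metis
    then show ?thesis by (auto simp: tuples_Suc)
  qed
  ultimately show ?case by blast
qed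

lemma dependent_family:
  fixes g :: "'j \<Rightarrow> ('a::comm_monoid_add \<Rightarrow>\<^sub>0 'k::field)"
  assumes "finite M" "finite J" "card M < card J" "\<And>j. j \<in> J \<Longrightarrow> keys (g j) \<subseteq> M"
  shows "\<exists>c. (\<exists>j\<in>J. c j \<noteq> 0) \<and> (\<Sum>j\<in>J. single 0 (c j) * g j) = 0"
proof -
  interpret vs: vector_space "\<lambda>(c :: 'k) f. single (0 :: 'a) c * f"
    by unfold_locales (simp_all add: algebra_simps single_add mult_single flip: mult.assoc)
  show ?thesis
  proof (cases "inj_on g J")
    case False
    then obtain i j where ij: "i \<in> J" "j \<in> J" "i \<noteq> j" "g i = g j" by (auto simp: inj_on_def)
    define c where "c k = (if k = i then 1 else if k = j then - 1 else 0 :: 'k)" for k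
    have "(\<Sum>k\<in>J. single 0 (c k) * g k) = (\<Sum>k\<in>{i, j}. single 0 (c k) * g k)"
      using ij assms(2) by (intro sum.mono_neutral_right) (auto simp: c_def)
    also have "\<dots> = 0" using ij by (simp add: c_def single_uminus)
    finally show ?thesis using ij(1) by (intro exI[of _ c]) (auto simp: c_def)
  next
    case True
    have "g ` J \<subseteq> vs.span ((\<lambda>m. single m 1) ` M)"
    proof clarify
      fix j assume j: "j \<in> J"
      have "(\<Sum>m\<in>keys (g j). single 0 (lookup (g j) m) * single m 1)
          \<in> vs.span ((\<lambda>m. single m 1) ` M)"
        using assms(4)[OF j] by (intro vs.span_sum vs.span_scale vs.span_base) auto
      then show "g j \<in> vs.span ((\<lambda>m. single m 1) ` M)" by (simp add: mult_single sum_of_monomials)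
    qed
    moreover have "card ((\<lambda>m. single m (1::'k)) ` M) < card (g ` J)"
      using card_image[OF True] card_image_le[OF assms(1), of "\<lambda>m. single m (1::'k)"] assms(3) by simp
    ultimately have "vs.dependent (g ` J)"
      using vs.independent_span_bound[of "(\<lambda>m. single m 1) ` M" "g ` J"] assms(1) by force
    then obtain u where u: "\<exists>v\<in>g ` J. u v \<noteq> 0" "(\<Sum>v\<in>g ` J. single 0 (u v) * v) = 0"
      using vs.dependent_finite[of "g ` J"] assms(2) by blast
    then show ?thesis using True by (intro exI[of _ "\<lambda>j. u (g j)"]) (simp add: sum.reindex)
  qed
qed

text \<open>The products with exponents at most \<open>N\<close> are \<open>(N + 1) ^ l\<close> independent elements with support in a set of at most
  \<open>(s l N + 1) ^ d\<close> exponents, which is impossible for large \<open>N\<close> if \<open>l > d\<close>.\<close>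

theorem chain_length_le:
  fixes P :: "nat \<Rightarrow> ('a::comm_monoid_add \<Rightarrow>\<^sub>0 'k::field) set" and gr :: "'a \<Rightarrow> nat"
  assumes T: "add_submonoid T" and gr: "\<And>m n. gr (m + n) = gr m + gr n"
    and growth: "\<And>N. finite {m\<in>T. gr m \<le> N}" "\<And>N. card {m\<in>T. gr m \<le> N} \<le> (N + 1) ^ d"
    and P: "\<forall>i\<le>l. primeideal (P i) (monoid_ring T)" "\<forall>i<l. P i \<subset> P (Suc i)"
  shows "l \<le> d"
proof (rule ccontr)
  assume "\<not> l \<le> d"
  obtain g s where
    g: "\<And>xs. length xs = l \<Longrightarrow> keys (g xs) \<subseteq> {m\<in>T. gr m \<le> s * sum_list xs}" and
    ind: "\<And>N c. (\<Sum>xs\<in>tuples l N. single 0 (c xs) * g xs) \<in> P 0 \<Longrightarrow> \<forall>xs\<in>tuples l N. c xs = 0"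
    using chain_independent[OF T gr P] by blast
  have bound: "(N + 1) ^ l \<le> (s * (l * N) + 1) ^ d" for N
  proof (rule ccontr)
    let ?M = "{m\<in>T. gr m \<le> s * (l * N)}"
    assume "\<not> ?thesis"
    then have lt: "card ?M < card (tuples l N)" using growth(2)[of "s * (l * N)"] by (simp add: card_tuples)
    have keys: "keys (g xs) \<subseteq> ?M" if xs: "xs \<in> tuples l N" for xs
    proof -
      have "sum_list xs \<le> l * N"
        using xs sum_list_mono[of xs "\<lambda>x. x" "\<lambda>_. N"] by (auto simp: tuples_def sum_list_triv)
      then have "s * sum_list xs \<le> s * (l * N)" by simp
      then have "{m\<in>T. gr m \<le> s * sum_list xs} \<subseteq> ?M" using order_trans by blast
      moreover have "keys (g xs) \<subseteq> {m\<in>T. gr m \<le> s * sum_list xs}"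
        using xs by (intro g) (simp add: tuples_def)
      ultimately show ?thesis by blast
    qed
    have "\<exists>c. (\<exists>xs\<in>tuples l N. c xs \<noteq> 0) \<and> (\<Sum>xs\<in>tuples l N. single 0 (c xs) * g xs) = 0"
      by (rule dependent_family[OF growth(1) finite_tuples lt keys])
    then obtain c where c: "\<exists>xs\<in>tuples l N. c xs \<noteq> 0" "(\<Sum>xs\<in>tuples l N. single 0 (c xs) * g xs) = 0"
      by (elim exE conjE)
    have "primeideal (P 0) (monoid_ring T)" using P(1) by simp
    then have "(\<Sum>xs\<in>tuples l N. single 0 (c xs) * g xs) \<in> P 0"
      unfolding c(2) by (rule zero_in_prime)
    then show False using ind[of c N] c(1) by blast
  qed
  \<comment> \<open>Large enough for \<open>(N + 1) ^ (d + 1)\<close> to exceed \<open>((s l + 1) (N + 1)) ^ d\<close>.\<close>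
  define N where "N = (s * l + 1) ^ d"
  have "(N + 1) ^ (d + 1) \<le> (N + 1) ^ l" using \<open>\<not> l \<le> d\<close> by (intro power_increasing) auto
  also have "\<dots> \<le> (s * (l * N) + 1) ^ d" by (rule bound)
  also have "\<dots> \<le> ((s * l + 1) * (N + 1)) ^ d" by (intro power_mono) (auto simp: algebra_simps)
  also have "\<dots> = N * (N + 1) ^ d" by (simp only: power_mult_distrib N_def)
  finally show False by simp
qed

section \<open>A chain of primes\<close>

lemma push_push: "push \<beta> (push \<alpha> f) = push (\<beta> \<circ> \<alpha>) f"
  unfolding push_def[of \<alpha>] push_def[of "\<beta> \<circ> \<alpha>"] by (simp add: push_sum)

lemma push_id_on: "(\<And>m. m \<in> keys f \<Longrightarrow> \<alpha> m = m) \<Longrightarrow> push \<alpha> f = f"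
  unfolding push_def by (simp add: sum_of_monomials)

definition erase :: "nat \<Rightarrow> (nat \<Rightarrow>\<^sub>0 nat) \<Rightarrow> (nat \<Rightarrow>\<^sub>0 nat)" where
  "erase k m = restrict_keys {k..} m"

text \<open>Setting the variables with indices below \<open>k\<close> to \<open>1\<close> is a homomorphism into a polynomial ring, so its kernel
  is prime.\<close>

definition erase_kernel :: "(nat \<Rightarrow>\<^sub>0 nat) set \<Rightarrow> nat \<Rightarrow> (nat, 'k::field) mpol set" where
  "erase_kernel T k = {f. keys f \<subseteq> T \<and> push (erase k) f = 0}"

lemma erase_kernel_prime:
  assumes T: "add_submonoid T"
  shows "primeideal (erase_kernel T k) (monoid_ring T :: (nat, 'k::field) mpol ring)"
proof -
  let ?Q = "monoid_ring T :: (nat, 'k) mpol ring"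
  interpret cring ?Q by (rule monoid_ring_cring[OF T])
  have mult: "push (erase k) (f * g) = push (erase k) f * push (erase k) g" for f g :: "(nat, 'k) mpol"
    by (rule push_mult) (simp add: erase_def restrict_keys_add)
  have one: "push (erase k) 1 = (1 :: (nat, 'k) mpol)"
    using push_single[of "erase k" 0 "1 :: 'k"] by (simp add: erase_def restrict_keys_def)
  have neg: "push (erase k) (- f) = - push (erase k) f" for f :: "(nat, 'k) mpol"
    using push_add[of "erase k" f "- f"] by (simp add: eq_neg_iff_add_eq_0 add.commute)
  show ?thesis
  proof (rule primeidealI)
    show "ideal (erase_kernel T k) ?Q"
    proof (rule idealI)
      show "ring ?Q" by (rule ring_axioms)
      show "subgroup (erase_kernel T k) (add_monoid ?Q)"
      proof (rule add.subgroupI)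
        show "erase_kernel T k \<subseteq> carrier ?Q" by (auto simp: erase_kernel_def)
        have "0 \<in> (erase_kernel T k :: (nat, 'k) mpol set)" by (simp add: erase_kernel_def)
        then show "(erase_kernel T k :: (nat, 'k) mpol set) \<noteq> {}" by blast
      next
        fix f g :: "(nat, 'k) mpol" assume f: "f \<in> erase_kernel T k" and g: "g \<in> erase_kernel T k"
        show "\<ominus>\<^bsub>?Q\<^esub> f \<in> erase_kernel T k"
          using f monoid_ring_uminus[OF T, of f] by (auto simp: erase_kernel_def neg in_keys_iff)
        show "f \<oplus>\<^bsub>?Q\<^esub> g \<in> erase_kernel T k"
          using f g Poly_Mapping.keys_add[of f g] by (auto simp: erase_kernel_def push_add)
      qed
    qed (use keys_mult_add_submonoid[OF T] in \<open>auto simp: erase_kernel_def mult\<close>)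
    have "(1 :: (nat, 'k) mpol) \<notin> erase_kernel T k" by (simp add: erase_kernel_def one)
    moreover have "1 \<in> carrier ?Q" using one_closed by simp
    ultimately show "carrier ?Q \<noteq> erase_kernel T k" by blast
  qed (use is_cring in \<open>auto simp: erase_kernel_def mult\<close>)
qed

text \<open>The difference of the monomials with exponents \<open>a\<close> and \<open>b\<close> vanishes as soon as the variable with index \<open>k\<close> is also set
  to \<open>1\<close>, and not before.\<close>

lemma erase_kernel_chain:
  assumes T: "add_submonoid T" and ab: "a \<in> T" "b \<in> T"
    and differ: "lookup a k \<noteq> lookup b k"
      "\<And>j. j > k \<Longrightarrow> lookup a j = lookup b j"
  shows "(erase_kernel T k :: (nat, 'k::field) mpol set) \<subset> erase_kernel T (Suc k)"
proof -
  have comp: "erase (Suc k) \<circ> erase k = erase (Suc k)"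
    by (rule ext, rule poly_mapping_eqI) (simp add: erase_def)
  have "erase_kernel T k \<subseteq> (erase_kernel T (Suc k) :: (nat, 'k) mpol set)"
  proof
    fix f :: "(nat, 'k) mpol" assume f: "f \<in> erase_kernel T k"
    have "push (erase (Suc k)) f = push (erase (Suc k)) (push (erase k) f)" by (simp add: push_push comp)
    then show "f \<in> erase_kernel T (Suc k)" using f by (simp add: erase_kernel_def)
  qed
  moreover define f where "f = single a 1 + single b (- 1 :: 'k)"
  have keys: "keys f \<subseteq> T" using Poly_Mapping.keys_add[of "single a 1" "single b (- 1 :: 'k)"] ab by (auto simp: f_def)
  have "erase (Suc k) a = erase (Suc k) b" using differ(2) by (intro poly_mapping_eqI) (simp add: erase_def)
  then have "push (erase (Suc k)) f = 0" by (simp add: f_def push_add single_add[symmetric])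
  moreover have "push (erase k) f \<noteq> 0"
  proof
    assume "push (erase k) f = 0"
    then have "single (erase k a) (1::'k) + single (erase k b) (- 1) = 0"
      by (simp only: f_def push_add push_single)
    then have "single (erase k a) (1::'k) = - single (erase k b) (- 1)"
      by (rule eq_neg_iff_add_eq_0[THEN iffD2])
    then have "single (erase k a) (1::'k) = single (erase k b) 1"
      by (simp add: single_uminus)
    then have "keys (single (erase k a) (1::'k)) = keys (single (erase k b) (1::'k))" by simp
    then have "erase k a = erase k b" by simp
    then have "lookup (erase k a) k = lookup (erase k b) k" by simp
    then show False using differ(1) by (simp add: erase_def)
  qed
  ultimately have "f \<in> erase_kernel T (Suc k)" "f \<notin> erase_kernel T k" using keys by (auto simp: erase_kernel_def)
  then show ?thesis using \<open>erase_kernel T k \<subseteq> _\<close> by blast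
qed

section \<open>Graded algebras isomorphic to a semigroup ring\<close>

locale semigroup_algebra =
  fixes A :: "('a, 'k::field) graded_algebra" and T :: "(nat \<Rightarrow>\<^sub>0 nat) set" and lev :: "nat \<Rightarrow> (nat \<Rightarrow>\<^sub>0 nat) set"
    and H :: "'a \<Rightarrow> (nat, 'k) mpol"
  assumes cring_A: "cring A" and T: "add_submonoid T" and H_iso: "H \<in> ring_iso A (monoid_ring T)"
    and embed_carrier: "embed A c \<in> carrier A" and H_embed: "H (embed A c) = pconst c"
    and component_carrier: "component A k \<subseteq> carrier A"
    and H_component: "H ` component A k = {f. keys f \<subseteq> lev k}"
    and lev_T: "lev k \<subseteq> T" and finite_lev: "finite (lev k)"
begin

abbreviation Q :: "(nat, 'k) mpol ring" where
  "Q \<equiv> monoid_ring T"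

sublocale Q: cring Q
  by (rule monoid_ring_cring[OF T])

sublocale A: cring A
  by (rule cring_A)

definition G :: "(nat, 'k) mpol \<Rightarrow> 'a" where
  "G = inv_into (carrier A) H"

lemma G_iso: "G \<in> ring_iso Q A"
  unfolding G_def by (rule ring_iso_set_sym[OF A.ring_axioms H_iso])

sublocale G: ring_hom_ring Q A G
  using G_iso by (intro ring_hom_ringI2) (auto simp: ring_iso_def A.ring_axioms Q.ring_axioms)

lemma G_H: "x \<in> carrier A \<Longrightarrow> G (H x) = x"
  unfolding G_def using H_iso by (intro inv_into_f_f) (auto simp: ring_iso_def bij_betw_def)

lemma zero_T: "0 \<in> T"
  using T by (simp add: add_submonoid_def)

lemma constants_subfield: "subfield (range pconst) Q"
proof (rule Q.subfieldI)
  show "subcring (range pconst) Q"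
  proof (rule Q.subcringI')
    show "subring (range pconst) Q"
    proof (rule Q.subringI)
      show "range pconst \<subseteq> carrier Q" using zero_T by (auto simp: pconst_def split: if_splits)
      show "\<one>\<^bsub>Q\<^esub> \<in> range pconst" by (auto simp: pconst_def intro: image_eqI[of _ _ 1])
      fix f g :: "(nat, 'k) mpol" assume "f \<in> range pconst" "g \<in> range pconst"
      then obtain c d where cd: "f = pconst c" "g = pconst d" by blast
      have "f \<in> carrier Q" using cd zero_T by (auto simp: pconst_def)
      then have "\<ominus>\<^bsub>Q\<^esub> f = pconst (- c)" using monoid_ring_uminus[OF T, of f] cd by (simp add: pconst_def single_uminus)
      then show "\<ominus>\<^bsub>Q\<^esub> f \<in> range pconst" by simp
      have "f \<otimes>\<^bsub>Q\<^esub> g = pconst (c * d)" "f \<oplus>\<^bsub>Q\<^esub> g = pconst (c + d)"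
        using cd by (simp_all add: pconst_def mult_single single_add)
      then show "f \<otimes>\<^bsub>Q\<^esub> g \<in> range pconst" "f \<oplus>\<^bsub>Q\<^esub> g \<in> range pconst" by simp_all
    qed
  qed
  show "Units (Q\<lparr>carrier := range pconst\<rparr>) = range pconst - {\<zero>\<^bsub>Q\<^esub>}"
  proof (intro equalityI subsetI)
    fix f assume "f \<in> Units (Q\<lparr>carrier := range pconst\<rparr>)"
    then show "f \<in> range pconst - {\<zero>\<^bsub>Q\<^esub>}" by (auto simp: Units_def)
  next
    fix f assume "f \<in> range pconst - {\<zero>\<^bsub>Q\<^esub>}"
    then obtain c where "f = pconst c" "f \<noteq> 0" by auto
    then have c: "f = pconst c" "c \<noteq> 0" by (auto simp: pconst_def)
    have "pconst (1 / c) * f = 1" "f * pconst (1 / c) = 1" using c by (simp_all add: pconst_def mult_single)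
    then show "f \<in> Units (Q\<lparr>carrier := range pconst\<rparr>)" using c by (auto simp: Units_def)
  qed
qed

lemma dimension_span:
  assumes "finite W" "W \<subseteq> T"
  shows "Q.dimension (card W) (range pconst) {f. keys f \<subseteq> W}"
  using assms
proof (induction W rule: finite_induct)
  case empty
  have "{f :: (nat, 'k) mpol. keys f \<subseteq> {}} = {\<zero>\<^bsub>Q\<^esub>}" by auto
  then show ?case by (metis Q.zero_dim card.empty)
next
  case (insert w W)
  let ?E = "{f :: (nat, 'k) mpol. keys f \<subseteq> W}" and ?v = "single w (1::'k)"
  have "Q.line_extension (range pconst) ?v ?E = {f. keys f \<subseteq> insert w W}"
  proof (intro equalityI subsetI)
    fix f assume "f \<in> Q.line_extension (range pconst) ?v ?E"
    then obtain c e where "f = pconst c * ?v + e" "keys e \<subseteq> W"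
      by (auto simp: Q.line_extension_mem_iff)
    then show "f \<in> {f. keys f \<subseteq> insert w W}"
      using Poly_Mapping.keys_add[of "single w c" e] by (auto simp: pconst_def mult_single split: if_splits)
  next
    fix f :: "(nat, 'k) mpol" assume f: "f \<in> {f. keys f \<subseteq> insert w W}"
    have "f = pconst (lookup f w) * ?v + restrict_keys W f"
      using insert.hyps f
      by (intro poly_mapping_eqI) (auto simp: pconst_def mult_single lookup_add lookup_single when_def in_keys_iff)
    moreover have "restrict_keys W f \<in> ?E" by (simp add: keys_restrict_keys)
    ultimately show "f \<in> Q.line_extension (range pconst) ?v ?E" unfolding Q.line_extension_mem_iff by auto
  qed
  moreover have "?v \<in> carrier Q" "?v \<notin> ?E" using insert by auto
  ultimately show ?case using Q.Suc_dim[of ?v ?E "card W" "range pconst"] insert by simp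
qed

theorem hilbert_function_eq: "hilbert_function A k = card (lev k)"
proof -
  have one_zero: "\<one>\<^bsub>A\<^esub> \<noteq> \<zero>\<^bsub>A\<^esub>"
  proof
    assume "\<one>\<^bsub>A\<^esub> = \<zero>\<^bsub>A\<^esub>"
    then have "G \<one>\<^bsub>Q\<^esub> = G \<zero>\<^bsub>Q\<^esub>" by (simp only: G.hom_one G.hom_zero)
    moreover have "inj_on G (carrier Q)" using G_iso by (auto simp: ring_iso_def bij_betw_def)
    ultimately have "\<one>\<^bsub>Q\<^esub> = \<zero>\<^bsub>Q\<^esub>"
      using inj_onD[of G "carrier Q"] Q.one_closed Q.zero_closed by blast
    then show False by simp
  qed
  let ?E = "{f :: (nat, 'k) mpol. keys f \<subseteq> lev k}"
  have "inj_on G ?E"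
  proof (rule inj_on_subset)
    show "inj_on G (carrier Q)" using G_iso by (simp add: ring_iso_def bij_betw_def)
    show "?E \<subseteq> carrier Q" using lev_T[of k] by auto
  qed
  from G.inj_hom_dimension[OF constants_subfield one_zero this dimension_span[OF finite_lev lev_T]]
  have "A.dimension (card (lev k)) (G ` range pconst) (G ` ?E)" .
  moreover have "G ` range pconst = range (embed A)"
    unfolding image_image H_embed[symmetric] G_H[OF embed_carrier] by (rule refl)
  moreover have "G ` ?E = component A k"
  proof -
    have "G ` ?E = (\<lambda>x. G (H x)) ` component A k" by (simp only: H_component[symmetric] image_image)
    also have "\<dots> = (\<lambda>x. x) ` component A k"
      using component_carrier[of k] by (intro image_cong refl G_H) blast
    finally show ?thesis by simp
  qed
  moreover have "subfield (G ` range pconst) A"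
    by (rule G.img_is_subfield(2)[OF constants_subfield one_zero])
  ultimately show ?thesis using A.dimI[of "range (embed A)" "card (lev k)" "component A k"]
    by (simp add: hilbert_function_def over_def)
qed

theorem krull_dim_eq:
  assumes gr: "\<And>m n. gr (m + n) = gr m + gr n"
    and growth: "\<And>N. finite {m\<in>T. gr m \<le> N}" "\<And>N. card {m\<in>T. gr m \<le> N} \<le> (N + 1) ^ d"
    and differ: "\<And>k. 1 \<le> k \<Longrightarrow> k \<le> d \<Longrightarrow> \<exists>a\<in>T. \<exists>b\<in>T. lookup a k \<noteq> lookup b k \<and>
        (\<forall>j>k. lookup a j = lookup b j)"
  shows "krull_dim A = enat d"
proof -
  have "krull_dim Q = enat d"
  proof (rule krull_dim_eqI[of d "\<lambda>i. erase_kernel T (Suc i)"])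
    show "primeideal (erase_kernel T (Suc i)) Q" for i by (rule erase_kernel_prime[OF T])
    show "erase_kernel T (Suc i) \<subset> (erase_kernel T (Suc (Suc i)) :: (nat, 'k) mpol set)" if i: "i < d" for i
    proof -
      obtain a b where "a \<in> T" "b \<in> T" "lookup a (Suc i) \<noteq> lookup b (Suc i)"
        "\<forall>j>Suc i. lookup a j = lookup b j"
        using differ[of "Suc i"] i by auto
      then show ?thesis using erase_kernel_chain[OF T, of a b "Suc i"] by blast
    qed
    show "l \<le> d" if "\<forall>i\<le>l. primeideal (P' i) Q" "\<forall>i<l. P' i \<subset> P' (Suc i)" for l P'
      using chain_length_le[where gr = gr, OF T gr growth that] .
  qed
  then show ?thesis using krull_dim_ring_iso[OF cring_A Q.is_cring H_iso] by simp
qed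

text \<open>The hypotheses say that \<open>T\<close> is a free commutative monoid on \<open>s\<close> generators.\<close>

theorem polynomial_ringI:
  fixes \<kappa> :: "(nat \<Rightarrow>\<^sub>0 nat) \<Rightarrow> (nat \<Rightarrow>\<^sub>0 nat)"
  assumes add: "\<And>m n. \<kappa> (m + n) = \<kappa> m + \<kappa> n"
    and bij: "bij_betw \<kappa> {m. keys m \<subseteq> {..<s}} T"
  shows "is_polynomial_ring A"
proof -
  let ?D = "{m :: nat \<Rightarrow>\<^sub>0 nat. keys m \<subseteq> {..<s}}"
  have zero: "\<kappa> 0 = 0" using add[of 0 0] by simp
  have img: "\<kappa> ` ?D = T" and inj: "inj_on \<kappa> ?D" using bij by (auto simp: bij_betw_def)
  have "push \<kappa> \<in> ring_iso (monoid_ring ?D :: (nat, 'k) mpol ring) Q"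
    unfolding ring_iso_def
  proof (intro CollectI conjI ring_hom_memI)
    fix f g :: "(nat, 'k) mpol"
    assume "f \<in> carrier (monoid_ring ?D)"
    then have "\<kappa> ` keys f \<subseteq> T" using img by auto
    then show "push \<kappa> f \<in> carrier Q" using keys_push[of \<kappa> f] by auto
    show "push \<kappa> (f \<otimes>\<^bsub>monoid_ring ?D\<^esub> g) = push \<kappa> f \<otimes>\<^bsub>Q\<^esub> push \<kappa> g"
      by (simp add: push_mult[of f g \<kappa> \<kappa> \<kappa>] add)
    show "push \<kappa> (f \<oplus>\<^bsub>monoid_ring ?D\<^esub> g) = push \<kappa> f \<oplus>\<^bsub>Q\<^esub> push \<kappa> g"
      by (simp add: push_add)
  next
    show "push \<kappa> \<one>\<^bsub>monoid_ring ?D\<^esub> = \<one>\<^bsub>Q\<^esub>"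
      using push_single[of \<kappa> 0 "1 :: 'k"] by (simp add: zero)
    define \<kappa>' where "\<kappa>' = inv_into ?D \<kappa>"
    show "bij_betw (push \<kappa>) (carrier (monoid_ring ?D :: (nat, 'k) mpol ring)) (carrier Q)"
    proof (rule bij_betw_byWitness[where f' = "push \<kappa>'"])
      show "\<forall>f\<in>carrier (monoid_ring ?D :: (nat, 'k) mpol ring). push \<kappa>' (push \<kappa> f) = f"
        unfolding push_push using inj by (auto intro!: push_id_on simp: \<kappa>'_def inv_into_f_f subset_eq)
      show "\<forall>f\<in>carrier Q. push \<kappa> (push \<kappa>' f) = f"
        unfolding push_push using img by (auto intro!: push_id_on simp: \<kappa>'_def f_inv_into_f)
      show "push \<kappa> ` carrier (monoid_ring ?D :: (nat, 'k) mpol ring) \<subseteq> carrier Q"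
        using keys_push[of \<kappa>] img by fastforce
      show "push \<kappa>' ` carrier Q \<subseteq> carrier (monoid_ring ?D :: (nat, 'k) mpol ring)"
      proof clarify
        fix f :: "(nat, 'k) mpol" assume f: "f \<in> carrier Q"
        have "\<kappa>' m \<in> ?D" if "m \<in> T" for m
          unfolding \<kappa>'_def by (rule inv_into_into) (simp add: img that)
        then have "\<kappa>' ` T \<subseteq> ?D" by blast
        then have "\<kappa>' ` keys f \<subseteq> ?D" using f by auto
        then have "keys (push \<kappa>' f) \<subseteq> ?D" using keys_push[of \<kappa>' f] by (rule order_trans[rotated])
        then show "push \<kappa>' f \<in> carrier (monoid_ring ?D)" by simp
      qed
    qed
  qed
  then have iso: "G \<circ> push \<kappa> \<in> ring_iso (poly_ring {..<s} :: (nat, 'k) mpol ring) A"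
    unfolding poly_ring_eq_monoid_ring using G_iso by (rule ring_iso_set_trans)
  have "(G \<circ> push \<kappa>) (pconst c) = embed A c" for c
    using G_H[OF embed_carrier, of c] by (simp add: H_embed pconst_def zero)
  then show ?thesis unfolding is_polynomial_ring_def using iso by blast
qed

end

section \<open>The semigroup of the bases\<close>

definition indicator_vector :: "'x set \<Rightarrow> 'x \<Rightarrow> real" where
  "indicator_vector B = (\<lambda>x. of_bool (x \<in> B))"

definition basis_exp :: "'x set \<Rightarrow> 'x \<Rightarrow>\<^sub>0 nat" where
  "basis_exp B = (\<Sum>x\<in>B. single x 1)"

lemma lookup_basis_exp: "finite B \<Longrightarrow> lookup (basis_exp B) x = of_bool (x \<in> B)"
  by (simp add: basis_exp_def lookup_sum lookup_single when_def)

lemma prod_pvar: "finite B \<Longrightarrow> (\<Prod>x\<in>B. pvar x :: ('x, 'k::field) mpol) = single (basis_exp B) 1"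
  by (induction B rule: finite_induct) (simp_all add: basis_exp_def pvar_def mult_single)

lemma indicator_vector_inj: "indicator_vector B = indicator_vector C \<Longrightarrow> B = C"
  unfolding indicator_vector_def fun_eq_iff by (auto simp: of_bool_eq_iff)

lemma independent_family:
  fixes v :: "'i \<Rightarrow> 'w::real_vector"
  assumes "finite J" "\<And>c. (\<Sum>i\<in>J. c i *\<^sub>R v i) = 0 \<Longrightarrow> \<forall>i\<in>J. c i = 0"
  shows "inj_on v J" "independent (v ` J)"
proof -
  show inj: "inj_on v J"
  proof (rule inj_onI, rule ccontr)
    fix i j assume ij: "i \<in> J" "j \<in> J" "v i = v j" "i \<noteq> j"
    define c where "c k = (if k = i then 1 else if k = j then - 1 else 0 :: real)" for k
    have "(\<Sum>k\<in>J. c k *\<^sub>R v k) = (\<Sum>k\<in>{i, j}. c k *\<^sub>R v k)"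
      using ij assms(1) by (intro sum.mono_neutral_right) (auto simp: c_def)
    also have "\<dots> = 0" using ij by (simp add: c_def)
    finally have "c i = 0" using assms(2)[of c] ij(1) by blast
    then show False by (simp add: c_def)
  qed
  show "independent (v ` J)"
  proof (rule independent_if_scalars_zero)
    show "finite (v ` J)" using assms(1) by simp
    fix f x assume "(\<Sum>x\<in>v ` J. f x *\<^sub>R x) = 0" "x \<in> v ` J"
    then show "f x = 0" using assms(2)[of "\<lambda>i. f (v i)"] by (auto simp: sum.reindex[OF inj])
  qed
qed

locale matroid_algebra = linear_matroid E \<rho> for E :: "'x set" and \<rho> :: "'x \<Rightarrow> 'v::real_vector" +
  fixes r :: nat and idx :: "'x \<Rightarrow> nat"
  assumes rank: "basis B \<Longrightarrow> card B = r" and idx_bij: "bij_betw idx E {1..card E}"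
begin

lemma bases_basis: "B \<in> bases \<Longrightarrow> basis B"
  by (simp add: bases_def)

lemma bases_finite: "B \<in> bases \<Longrightarrow> finite B" and bases_subset: "B \<in> bases \<Longrightarrow> B \<subseteq> E"
  using basis_finite basis_subset by (auto simp: bases_def)

sublocale equigenerated E "basis_exp ` bases" r idx
proof
  show "finite E" by (rule finE)
  show "finite (basis_exp ` bases)" using finite_bases by simp
  show "inj_on idx E" using idx_bij by (simp add: bij_betw_def)
  show "0 < idx x" if "x \<in> E" for x using bij_betwE[OF idx_bij] that by fastforce
  fix u assume "u \<in> basis_exp ` bases"
  then obtain B where "u = basis_exp B" "B \<in> bases" by blast
  note B = \<open>u = basis_exp B\<close> bases_basis[OF \<open>B \<in> bases\<close>]
  have lB: "lookup u x = of_bool (x \<in> B)" for x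
    unfolding B(1) by (rule lookup_basis_exp[OF basis_finite[OF B(2)]])
  show "keys u \<subseteq> E" using basis_subset[OF B(2)] by (auto simp: in_keys_iff lB)
  have "(\<Sum>x\<in>E. lookup u x) = card B"
    using basis_subset[OF B(2)] finE by (simp add: lB of_bool_def sum.If_cases Int_absorb1)
  then show "(\<Sum>x\<in>E. lookup u x) = r" using rank[OF B(2)] by simp
qed

lemma base_ring_eq:
  "(base_ring (E, bases) :: ((nat \<Rightarrow> ('x, 'k::field) mpol) set, 'k) graded_algebra) = fiber_cone R pconst mm I"
proof -
  have "{\<Prod>x\<in>B. pvar x :: ('x, 'k) mpol | B. B \<in> bases} = (\<lambda>u. single u (1 :: 'k)) ` basis_exp ` bases"
    unfolding Setcompr_eq_image image_image by (intro image_cong refl prod_pvar bases_finite)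
  then show ?thesis by (simp add: base_ring_def matroidal_ideal_def R_def I_def mm_def)
qed

lemma ksums_combination:
  assumes "finite S" "S \<subseteq> bases"
  shows "(\<Sum>x\<in>E. single x (\<Sum>B\<in>S. n B * of_bool (x \<in> B))) \<in> ksums (\<Sum>B\<in>S. n B)"
  using assms
proof (induction S rule: finite_induct)
  case (insert B S)
  have one: "(\<Sum>x\<in>E. single x (j * of_bool (x \<in> B))) \<in> ksums j" for j
  proof (induction j)
    case (Suc j)
    have "basis_exp B = (\<Sum>x\<in>E. single x (of_bool (x \<in> B)))"
      unfolding basis_exp_def using finE bases_subset[of B] insert.prems by (intro sum.mono_neutral_cong_left) auto
    then have "(\<Sum>x\<in>E. single x (Suc j * of_bool (x \<in> B))) =
        basis_exp B + (\<Sum>x\<in>E. single x (j * of_bool (x \<in> B)))"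
      by (simp add: single_add sum.distrib)
    then show ?case using Suc insert.prems by auto
  qed simp
  have "(\<Sum>x\<in>E. single x (\<Sum>B\<in>insert B S. n B * of_bool (x \<in> B))) =
      (\<Sum>x\<in>E. single x (n B * of_bool (x \<in> B))) + (\<Sum>x\<in>E. single x (\<Sum>B\<in>S. n B * of_bool (x \<in> B)))"
    by (simp only: sum.insert[OF insert.hyps] single_add sum.distrib)
  then show ?case using ksums_add[OF one insert.IH] insert.hyps insert.prems by simp
qed simp

lemma lookup_ksums_le: "w \<in> ksums k \<Longrightarrow> lookup w x \<le> k"
proof (induction k arbitrary: w)
  case (Suc k)
  then obtain B s where B: "w = basis_exp B + s" "B \<in> bases" "s \<in> ksums k" by auto
  have "lookup (basis_exp B) x \<le> 1" using lookup_basis_exp[OF bases_finite[OF B(2)]] by simp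
  then show ?case using Suc.IH[OF B(3)] B(1) by (simp add: lookup_add)
qed simp

lemma exps_expansion: "w \<in> exps \<Longrightarrow> (\<Sum>x\<in>E. single x (lookup w x)) = w"
  using finE by (intro poly_mapping_eqI) (auto simp: lookup_sum lookup_single when_def exps_def in_keys_iff)

text \<open>An encoded exponent is determined by its entries on \<open>E\<close>, because the degree is their sum divided by \<open>r\<close>, and
  the entries are at most the degree.\<close>

lemma growth:
  assumes "0 < r"
  shows "finite {m\<in>graded_exps. lookup m 0 \<le> N}"
    and "card {m\<in>graded_exps. lookup m 0 \<le> N} \<le> (N + 1) ^ card E"
proof -
  let ?P = "E \<rightarrow>\<^sub>E {..N}"
  define \<phi> where "\<phi> f = enc ((\<Sum>x\<in>E. f x) div r) (\<Sum>x\<in>E. single x (f x))" for f :: "'x \<Rightarrow> nat"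
  have sub: "{m\<in>graded_exps. lookup m 0 \<le> N} \<subseteq> \<phi> ` ?P"
  proof
    fix m assume "m \<in> {m\<in>graded_exps. lookup m 0 \<le> N}"
    then obtain k w where m: "m = enc k w" "w \<in> ksums k" "k \<le> N"
      by (auto simp: graded_exps_def level_def lookup_enc_0)
    let ?f = "restrict (lookup w) E"
    have "(\<Sum>x\<in>E. ?f x) = k * r" using ksums_wt[OF m(2)] by (simp add: wt_def)
    moreover have "(\<Sum>x\<in>E. single x (?f x)) = w"
      using exps_expansion[of w] m(2) ksums_exps by auto
    ultimately have "\<phi> ?f = m" using assms by (simp add: \<phi>_def m(1))
    moreover have "?f \<in> ?P" using lookup_ksums_le[OF m(2)] m(3) by (auto intro: order_trans)
    ultimately show "m \<in> \<phi> ` ?P" by blast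
  qed
  have fP: "finite ?P" using finE by (intro finite_PiE) auto
  show "finite {m\<in>graded_exps. lookup m 0 \<le> N}" using sub fP finite_surj by blast
  have "card {m\<in>graded_exps. lookup m 0 \<le> N} \<le> card ?P" using surj_card_le[OF fP sub] .
  then show "card {m\<in>graded_exps. lookup m 0 \<le> N} \<le> (N + 1) ^ card E"
    using finE by (simp add: card_PiE)
qed

lemma lookup_enc_outside: "j \<noteq> 0 \<Longrightarrow> j \<notin> idx ` E \<Longrightarrow> lookup (enc k w) j = 0"
  by (auto simp: enc_def lookup_add lookup_sum lookup_single when_def intro!: sum.neutral)

text \<open>Write \<open>r\<close> times the unit vector at the element with number \<open>k\<close> as an integer combination of bases. Its positive and
  negative parts are the two exponents; apart from the degree they differ only at \<open>k\<close>.\<close>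

lemma exponents_differ:
  assumes con: "connected" and "0 < r" and k: "1 \<le> k" "k \<le> card E"
  shows "\<exists>a\<in>graded_exps. \<exists>b\<in>graded_exps. lookup a k \<noteq> lookup b k \<and>
    (\<forall>j>k. lookup a j = lookup b j)"
proof -
  have "k \<in> idx ` E" using idx_bij k by (simp add: bij_betw_def)
  then obtain f where f: "f \<in> E" "idx f = k" by blast
  obtain B where B: "basis B" using ex_basis by blast
  obtain m where m: "\<And>x. int r * of_bool (x = f) = (\<Sum>B\<in>bases. m B * of_bool (x \<in> B))"
    using connected_unit_multiple[OF con f(1) B] rank[OF B] unfolding lattice_def by auto
  define w where "w s = (\<Sum>x\<in>E. single x (\<Sum>B\<in>bases. nat (s * m B) * of_bool (x \<in> B)))" for s :: int
  define a where "a s = enc (\<Sum>B\<in>bases. nat (s * m B)) (w s)" for s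
  have aG: "a s \<in> graded_exps" for s
    using ksums_combination[OF finite_bases subset_refl, of "\<lambda>B. nat (s * m B)"]
    by (auto simp: a_def w_def graded_exps_def level_def)
  have la: "lookup (a s) (idx x) = (\<Sum>B\<in>bases. nat (s * m B) * of_bool (x \<in> B))" if "x \<in> E" for x s
    using that finE by (simp add: a_def lookup_enc w_def lookup_sum lookup_single when_def)
  have diff: "int (lookup (a 1) (idx x)) - int (lookup (a (- 1)) (idx x)) = int r * of_bool (x = f)" if "x \<in> E" for x
  proof -
    have "int (lookup (a 1) (idx x)) - int (lookup (a (- 1)) (idx x)) =
        (\<Sum>B\<in>bases. int (nat (m B)) * of_bool (x \<in> B) - int (nat (- m B)) * of_bool (x \<in> B))"
      unfolding la[OF that] by (simp add: sum_subtractf)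
    also have "\<dots> = (\<Sum>B\<in>bases. m B * of_bool (x \<in> B))" by (intro sum.cong) auto
    finally show ?thesis using m by simp
  qed
  have "lookup (a 1) k \<noteq> lookup (a (- 1)) k" using diff[OF f(1)] f(2) \<open>0 < r\<close> by auto
  moreover have "lookup (a 1) j = lookup (a (- 1)) j" if "j > k" for j
  proof (cases "j \<in> idx ` E")
    case True
    then obtain x where x: "x \<in> E" "j = idx x" by blast
    then have "x \<noteq> f" using f(2) that by auto
    then show ?thesis using diff[OF x(1)] x(2) by simp
  next
    case False
    then show ?thesis using that lookup_enc_outside[of j] by (simp add: a_def)
  qed
  ultimately show ?thesis using aG by blast
qed

section \<open>The cone of the bases\<close>

abbreviation BV :: "('x \<Rightarrow> real) set" where
  "BV \<equiv> indicator_vector ` bases"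

definition height :: "('x \<Rightarrow> real) \<Rightarrow> real" where
  "height u = (\<Sum>x\<in>E. u x) / real r"

definition lat :: "('x \<Rightarrow> real) set" where
  "lat = {u. (\<forall>x. u x \<in> \<int>) \<and> (\<forall>x. x \<notin> E \<longrightarrow> u x = 0) \<and> height u \<in> \<int>}"

definition emb :: "('x \<Rightarrow>\<^sub>0 nat) \<Rightarrow> 'x \<Rightarrow> real" where
  "emb w = (\<lambda>x. real (lookup w x))"

lemma emb_add: "emb (v + w) = emb v + emb w"
  by (auto simp: emb_def lookup_add)

lemma emb_basis_exp: "finite B \<Longrightarrow> emb (basis_exp B) = indicator_vector B"
  by (auto simp: emb_def lookup_basis_exp indicator_vector_def)

lemma emb_inj: "inj emb"
  by (intro injI poly_mapping_eqI) (auto simp: emb_def fun_eq_iff)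

lemma linear_height: "linear height"
  by (rule linearI) (simp_all add: height_def sum.distrib add_divide_distrib flip: sum_distrib_left)

lemma height_basis:
  assumes "0 < r" "B \<in> bases"
  shows "height (indicator_vector B) = 1"
proof -
  have "(\<Sum>x\<in>E. of_bool (x \<in> B) :: real) = real (card B)"
    using bases_subset[OF assms(2)] finE by (simp add: of_bool_def sum.If_cases Int_absorb1)
  then show ?thesis using rank assms by (simp add: height_def indicator_vector_def bases_def)
qed

lemma finite_BV: "finite BV"
  using finite_bases by simp

lemma sum_BV: "(\<Sum>a\<in>BV. f a) = (\<Sum>B\<in>bases. f (indicator_vector B))"
proof -
  have "inj_on indicator_vector bases" by (rule inj_onI) (rule indicator_vector_inj)
  then show ?thesis by (simp add: sum.reindex)
qed

lemma cone_BV_apply: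
  "(\<Sum>a\<in>BV. l a *\<^sub>R a) x = (\<Sum>B\<in>bases. l (indicator_vector B) * of_bool (x \<in> B))"
  unfolding sum_BV sum_fun_apply by (simp add: indicator_vector_def)

lemma emb_ksums:
  assumes "0 < r" "w \<in> ksums k"
  shows "emb w \<in> lat" "emb w \<in> cone_hull BV" "height (emb w) = real k"
proof -
  have "emb w \<in> cone_hull BV \<and> height (emb w) = real k" using assms(2)
  proof (induction k arbitrary: w)
    case 0
    then have w: "emb w = 0" by (auto simp: emb_def)
    show ?case unfolding w using linear_0[OF linear_height] cone_hull_zero by (simp only: of_nat_0 simp_thms)
  next
    case (Suc k)
    then obtain B s where B: "w = basis_exp B + s" "B \<in> bases" "s \<in> ksums k" by auto
    have w: "emb w = indicator_vector B + emb s" using B(1) emb_basis_exp[OF bases_finite[OF B(2)]] by (simp add: emb_add)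
    have "indicator_vector B \<in> cone_hull BV" using B(2) finite_BV by (intro cone_hull_base) auto
    then have "indicator_vector B + emb s \<in> cone_hull BV" using Suc.IH[OF B(3)] by (intro cone_hull_add) auto
    moreover have "height (indicator_vector B + emb s) = real (Suc k)"
      unfolding linear_add[OF linear_height] using Suc.IH[OF B(3)] height_basis[OF assms(1) B(2)] by simp
    ultimately show ?case unfolding w by (rule conjI)
  qed
  then show "emb w \<in> cone_hull BV" "height (emb w) = real k" by auto
  moreover have "emb w x = 0" if "x \<notin> E" for x
  proof -
    have "keys w \<subseteq> E" using ksums_exps[of k] assms(2) unfolding exps_def by blast
    then have "x \<notin> keys w" using that by blast
    then show ?thesis by (simp add: emb_def in_keys_iff)
  qed
  ultimately show "emb w \<in> lat" by (auto simp: lat_def) (auto simp: emb_def)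
qed

lemma lattice_slice:
  assumes r: "0 < r"
  shows "{u \<in> lat \<inter> cone_hull BV. height u = real k} = emb ` ksums k"
proof (intro equalityI subsetI)
  fix u assume u: "u \<in> {u \<in> lat \<inter> cone_hull BV. height u = real k}"
  then obtain l where l: "\<forall>a\<in>BV. 0 \<le> l a" "u = (\<Sum>a\<in>BV. l a *\<^sub>R a)" by (auto simp: cone_hull_def)
  define l' where "l' B = l (indicator_vector B)" for B
  have ux: "u x = (\<Sum>B\<in>bases. l' B * of_bool (x \<in> B))" for x
    unfolding l(2) l'_def by (rule cone_BV_apply)
  have l'_pos: "0 \<le> l' B" if "B \<in> bases" for B using l(1) that by (auto simp: l'_def)
  have u_nonneg: "0 \<le> u x" for x unfolding ux using l'_pos by (intro sum_nonneg) auto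
  define n where "n x = nat \<lfloor>u x\<rfloor>" for x
  have n: "u x = real (n x)" for x using u u_nonneg[of x] by (auto simp: lat_def n_def elim!: Ints_cases)
  have "height u = (\<Sum>a\<in>BV. l a * height a)"
    unfolding l(2) by (simp add: linear_sum[OF linear_height] linear_scale[OF linear_height])
  also have "\<dots> = (\<Sum>B\<in>bases. l' B)" unfolding sum_BV l'_def using height_basis[OF r] by simp
  finally have "(\<Sum>B\<in>bases. l' B) = real k" using u by simp
  from integer_decomposition[OF l'_pos this, of n] n ux
  obtain J where J: "\<forall>i<k. J i \<in> bases" "\<forall>x\<in>E. n x = cover k J x" by metis
  have sums: "(\<Sum>i<j. basis_exp (J i)) \<in> ksums j" if "j \<le> k" for j
    using that
  proof (induction j)
    case (Suc j)
    then have "(\<Sum>i<j. basis_exp (J i)) \<in> ksums j" "J j \<in> bases" using J(1) by simp_all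
    then have "basis_exp (J j) + (\<Sum>i<j. basis_exp (J i)) \<in> ksums (Suc j)" unfolding ksums.simps by blast
    then show ?case by (simp only: sum.lessThan_Suc add.commute)
  qed simp
  have "emb (\<Sum>i<k. basis_exp (J i)) x = u x" for x
  proof -
    have "lookup (\<Sum>i<k. basis_exp (J i)) x = cover k J x"
      unfolding lookup_sum cover_def using J(1) bases_finite by (intro sum.cong) (auto simp: lookup_basis_exp)
    moreover have "cover k J x = n x"
    proof (cases "x \<in> E")
      case False
      then have "u x = 0" using u by (simp add: lat_def)
      then have "n x = 0" using n[of x] by simp
      moreover have "cover k J x = 0" using J(1) bases_subset False by (auto simp: cover_def intro!: sum.neutral)
      ultimately show ?thesis by simp
    qed (use J(2) in simp)
    ultimately show ?thesis using n by (simp add: emb_def)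
  qed
  then have "u = emb (\<Sum>i<k. basis_exp (J i))" by auto
  then show "u \<in> emb ` ksums k" using sums by blast
next
  fix u assume "u \<in> emb ` ksums k"
  then show "u \<in> {u \<in> lat \<inter> cone_hull BV. height u = real k}" using emb_ksums[OF r] by auto
qed

lemma dim_BV:
  assumes con: "connected" and r: "0 < r"
  shows "dim BV = card E"
proof -
  let ?e = "\<lambda>f. indicator_vector {f}"
  have inj: "inj_on ?e E" by (auto intro!: inj_onI dest: indicator_vector_inj)
  have ind: "independent (?e ` E)"
  proof (rule independent_if_scalars_zero)
    show "finite (?e ` E)" using finE by simp
    fix c a assume s: "(\<Sum>a\<in>?e ` E. c a *\<^sub>R a) = 0" and "a \<in> ?e ` E"
    then obtain f where f: "f \<in> E" "a = ?e f" by blast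
    have "(\<Sum>g\<in>E. c (?e g) *\<^sub>R ?e g) f = 0" using s by (simp add: sum.reindex[OF inj])
    moreover have "(\<Sum>g\<in>E. c (?e g) *\<^sub>R ?e g) f = (\<Sum>g\<in>E. if g = f then c (?e g) else 0)"
      unfolding sum_fun_apply by (intro sum.cong) (auto simp: indicator_vector_def)
    ultimately have "(\<Sum>g\<in>E. if g = f then c (?e g) else 0) = 0" by simp
    then show "c a = 0" using f finE by simp
  qed
  have "?e f \<in> span BV" if f: "f \<in> E" for f
  proof -
    obtain B where B: "basis B" using ex_basis by blast
    obtain m where m: "\<And>x. int r * of_bool (x = f) = (\<Sum>B\<in>bases. m B * of_bool (x \<in> B))"
      using connected_unit_multiple[OF con f B] rank[OF B] unfolding lattice_def by auto
    have "?e f = (1 / real r) *\<^sub>R (\<Sum>B\<in>bases. real_of_int (m B) *\<^sub>R indicator_vector B)"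
    proof
      fix x
      have "real r * of_bool (x = f) = real_of_int (int r * of_bool (x = f))" by simp
      also have "\<dots> = (\<Sum>B\<in>bases. real_of_int (m B) * of_bool (x \<in> B))" unfolding m by simp
      finally show "?e f x = ((1 / real r) *\<^sub>R (\<Sum>B\<in>bases. real_of_int (m B) *\<^sub>R indicator_vector B)) x"
        using r by (simp add: sum_fun_apply indicator_vector_def field_simps)
    qed
    also have "\<dots> \<in> span BV" by (intro span_scale span_sum span_base) auto
    finally show ?thesis .
  qed
  moreover have "indicator_vector B \<in> span (?e ` E)" if B: "B \<in> bases" for B
  proof -
    have "indicator_vector B = (\<Sum>f\<in>B. ?e f)"
      using bases_finite[OF B] by (auto simp: sum_fun_apply indicator_vector_def)
    also have "\<dots> \<in> span (?e ` E)" using bases_subset[OF B] by (intro span_sum span_base) auto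
    finally show ?thesis .
  qed
  ultimately have "span (?e ` E) = span BV" by (intro span_eq[THEN iffD2]) auto
  then have "dim BV = card (?e ` E)" using real_vector.dim_eq_card[OF _ ind] by metis
  then show ?thesis using card_image[OF inj] by simp
qed

lemma lat_zero: "0 \<in> lat"
  using linear_0[OF linear_height] by (simp add: lat_def)

lemma lat_diff: "u \<in> lat \<Longrightarrow> v \<in> lat \<Longrightarrow> u - v \<in> lat"
proof -
  assume "u \<in> lat" "v \<in> lat"
  moreover have "height (u - v) = height u - height v" by (rule linear_diff[OF linear_height])
  ultimately show ?thesis unfolding lat_def mem_Collect_eq by (metis (no_types, lifting) Ints_diff diff_zero minus_apply)
qed

lemma lat_add: "u \<in> lat \<Longrightarrow> v \<in> lat \<Longrightarrow> u + v \<in> lat"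
proof -
  assume "u \<in> lat" "v \<in> lat"
  moreover have "height (u + v) = height u + height v" by (rule linear_add[OF linear_height])
  ultimately show ?thesis unfolding lat_def mem_Collect_eq by (metis (no_types, lifting) Ints_add add_0 plus_fun_apply)
qed

lemma BV_lat:
  assumes "0 < r"
  shows "BV \<subseteq> lat"
proof clarify
  fix B assume B: "B \<in> bases"
  then show "indicator_vector B \<in> lat"
    using bases_subset[OF B] height_basis[OF assms B] by (auto simp: lat_def indicator_vector_def)
qed

text \<open>All bases have the same size, so a basis other than \<open>A\<close> has an element outside \<open>A\<close>, at which the right-hand
  side vanishes.\<close>

lemma BV_extreme:
  assumes a: "a \<in> BV" and m: "\<And>b. b \<in> BV \<Longrightarrow> 0 \<le> m b" and s: "(\<Sum>b\<in>BV. m b *\<^sub>R b) = s *\<^sub>R a"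
    and d: "d \<in> BV" "d \<noteq> a"
  shows "m d = 0"
proof -
  obtain A D where AD: "A \<in> bases" "a = indicator_vector A" "D \<in> bases" "d = indicator_vector D" using a d by blast
  have "\<not> D \<subseteq> A"
    using AD d(2) rank card_seteq[OF bases_finite[OF AD(1)], of D] by (auto simp: bases_def)
  then obtain x where x: "x \<in> D" "x \<notin> A" by blast
  have "(\<Sum>B\<in>bases. m (indicator_vector B) * of_bool (x \<in> B)) = 0"
    using s x(2) cone_BV_apply[of m x] by (simp add: AD(2) indicator_vector_def)
  then have "m (indicator_vector D) * of_bool (x \<in> D) = 0"
    using sum_nonneg_eq_0_iff[OF finite_bases, of "\<lambda>B. m (indicator_vector B) * of_bool (x \<in> B)"] m AD(3) by force
  then show "m d = 0" using x(1) AD(4) by simp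
qed

section \<open>Base rings that are polynomial rings\<close>

lemma semigroup_algebra_base_ring:
  fixes F :: "((nat \<Rightarrow> ('x, 'k::field) mpol) set, 'k) graded_algebra"
  assumes "F = base_ring (E, bases)"
  shows "\<exists>H. semigroup_algebra F graded_exps level H"
proof -
  have F: "F = fiber_cone R pconst mm I" using assms by (simp add: base_ring_eq)
  obtain H where H: "H \<in> ring_iso F (monoid_ring graded_exps)" "\<And>c. H (embed F c) = pconst c"
      "\<And>k. H ` component F k = {f. keys f \<subseteq> level k}"
    using fiber_cone_iso(4)[OF F] by blast
  have "semigroup_algebra F graded_exps level H"
  proof (rule semigroup_algebra.intro)
    show "level k \<subseteq> graded_exps" for k unfolding graded_exps_def by blast
  qed (rule fiber_cone_iso(1-3)[OF F] H finite_level add_submonoid_graded_exps)+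
  then show ?thesis by blast
qed

text \<open>The bases span a space of dimension \<open>card E\<close>.\<close>

lemma independent_bases:
  assumes "connected" "0 < r" "card bases \<le> card E"
  shows "independent BV"
proof -
  interpret C: cone_frames BV by unfold_locales (rule finite_BV)
  obtain \<sigma> where \<sigma>: "\<sigma> \<in> C.frames"
    using C.extend_to_frame[of "{}"] real_vector.independent_empty by blast
  have "card BV \<le> card \<sigma>"
    using C.frameD(5)[OF \<sigma>] dim_BV[OF assms(1,2)] assms(3) card_image_le[OF finite_bases, of indicator_vector] by simp
  then have "\<sigma> = BV" using C.frameD(1)[OF \<sigma>] finite_BV by (intro card_seteq) auto
  then show ?thesis using C.frameD(2)[OF \<sigma>] by simp
qed

text \<open>Sums of linearly independent bases have unique summands, so the semigroup is free on the bases. A single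
  basis can be empty, and its indicator vector is then zero; but its multiples are told apart by their degrees.\<close>

lemma polynomial_ring_if_few_bases:
  fixes F :: "((nat \<Rightarrow> ('x, 'k::field) mpol) set, 'k) graded_algebra"
  assumes F: "F = base_ring (E, bases)" and few: "card bases \<le> 1 \<or> independent BV"
  shows "is_polynomial_ring F"
proof -
  obtain H where "semigroup_algebra F graded_exps level H" using semigroup_algebra_base_ring[OF F] by blast
  then interpret S: semigroup_algebra F graded_exps level H .
  define s where "s = card bases"
  obtain bs where bs: "bij_betw bs {..<s} bases"
    using ex_bij_betw_nat_finite[OF finite_bases] by (auto simp: s_def atLeast0LessThan)
  have bsB: "bs j \<in> bases" if "j < s" for j using bij_betwE[OF bs] that by auto
  define ex where "ex m = (\<Sum>x\<in>E. single x (\<Sum>j<s. lookup m j * of_bool (x \<in> bs j)))" for m :: "nat \<Rightarrow>\<^sub>0 nat"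
  define \<kappa> where "\<kappa> m = enc (\<Sum>j<s. lookup m j) (ex m)" for m
  have ex_add: "ex (m + n) = ex m + ex n" for m n
    by (simp only: ex_def lookup_add distrib_right sum.distrib single_add)
  have add: "\<kappa> (m + n) = \<kappa> m + \<kappa> n" for m n
    unfolding \<kappa>_def ex_add lookup_add sum.distrib by (rule enc_add)
  have exK: "ex m \<in> ksums (\<Sum>j<s. lookup m j)" for m
  proof -
    define n where "n B = lookup m (inv_into {..<s} bs B)" for B
    have n: "n (bs j) = lookup m j" if "j < s" for j
      using bs that by (simp add: n_def bij_betw_def)
    have re: "(\<Sum>B\<in>bases. n B * f B) = (\<Sum>j<s. lookup m j * f (bs j))" for f
      using sum.reindex_bij_betw[OF bs, of "\<lambda>B. n B * f B"] n by simp
    show ?thesis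
      using ksums_combination[OF finite_bases subset_refl, of n] re[of "\<lambda>_. 1"] by (simp add: re ex_def)
  qed
  let ?D = "{m :: nat \<Rightarrow>\<^sub>0 nat. keys m \<subseteq> {..<s}}"
  have "inj_on \<kappa> ?D"
  proof (rule inj_onI)
    fix m n assume m: "m \<in> ?D" and n: "n \<in> ?D" and eq: "\<kappa> m = \<kappa> n"
    have "ex m \<in> exps" "ex n \<in> exps" using exK ksums_exps by blast+
    then have tot: "(\<Sum>j<s. lookup m j) = (\<Sum>j<s. lookup n j)" and exq: "ex m = ex n"
      using enc_inj eq unfolding \<kappa>_def by blast+
    have lex: "lookup (ex m) x = (\<Sum>j<s. lookup m j * of_bool (x \<in> bs j))" if "x \<in> E" for x m
      using that finE by (simp add: ex_def lookup_sum lookup_single when_def)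
    have "lookup m j = lookup n j" if j: "j < s" for j
    proof (cases "card bases \<le> 1")
      case True
      then have "{..<s} = {j}" using j by (auto simp: s_def)
      then show ?thesis using tot by simp
    next
      case False
      then have ind: "independent BV" using few by simp
      define c where "c a = real (lookup m (inv_into {..<s} (\<lambda>j. indicator_vector (bs j)) a)) -
          real (lookup n (inv_into {..<s} (\<lambda>j. indicator_vector (bs j)) a))" for a
      have inj: "inj_on (\<lambda>j. indicator_vector (bs j)) {..<s}"
        using bs by (auto simp: bij_betw_def inj_on_def dest: indicator_vector_inj)
      have img: "(\<lambda>j. indicator_vector (bs j)) ` {..<s} = BV"
        using bs by (simp add: bij_betw_def flip: image_image)
      have cj: "c (indicator_vector (bs j)) = real (lookup m j) - real (lookup n j)" if "j < s" for j
        using inv_into_f_f[OF inj, of j] that by (simp add: c_def)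
      have "(\<Sum>a\<in>BV. c a *\<^sub>R a) = (\<Sum>j<s. (real (lookup m j) - real (lookup n j)) *\<^sub>R indicator_vector (bs j))"
        unfolding img[symmetric] sum.reindex[OF inj] using cj by (intro sum.cong) simp_all
      also have "\<dots> = 0"
      proof
        fix x
        have "(\<Sum>j<s. (real (lookup m j) - real (lookup n j)) * of_bool (x \<in> bs j)) = 0"
        proof (cases "x \<in> E")
          case True
          then have "real (lookup (ex m) x) - real (lookup (ex n) x) = 0" using exq by simp
          then show ?thesis unfolding lex[OF True] by (simp add: left_diff_distrib sum_subtractf)
        next
          case False
          then have "x \<notin> bs j" if "j < s" for j using bases_subset[OF bsB[OF that]] by blast
          then show ?thesis by (intro sum.neutral) simp
        qed
        then show "(\<Sum>j<s. (real (lookup m j) - real (lookup n j)) *\<^sub>R indicator_vector (bs j)) x = 0 x"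
          unfolding sum_fun_apply by (simp add: indicator_vector_def)
      qed
      finally have "c a = 0" if "a \<in> BV" for a
        using that ind finite_BV real_vector.dependent_finite[of BV] by blast
      then have "c (indicator_vector (bs j)) = 0" using bsB[OF j] by blast
      then show ?thesis using cj[OF j] by simp
    qed
    moreover have "lookup m j = 0" "lookup n j = 0" if "\<not> j < s" for j
      using m n that by (auto simp: in_keys_iff subset_eq)
    ultimately show "m = n" by (intro poly_mapping_eqI) metis
  qed
  moreover have "\<kappa> ` ?D = graded_exps"
  proof (intro equalityI subsetI)
    fix t assume "t \<in> \<kappa> ` ?D"
    then show "t \<in> graded_exps" using exK by (auto simp: \<kappa>_def graded_exps_def level_def)
  next
    fix t assume "t \<in> graded_exps"
    then obtain k w where t: "t = enc k w" "w \<in> ksums k" by (auto simp: graded_exps_def level_def)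
    have "enc k w \<in> \<kappa> ` ?D" using t(2)
    proof (induction k arbitrary: w)
      case 0
      have "\<kappa> 0 = 0" using add[of 0 0] by simp
      then show ?case using 0 by (auto simp: enc_zero intro!: image_eqI[of _ _ 0])
    next
      case (Suc k)
      then obtain B v where B: "w = basis_exp B + v" "B \<in> bases" "v \<in> ksums k" by auto
      obtain m where m: "m \<in> ?D" "enc k v = \<kappa> m" using Suc.IH[OF B(3)] by blast
      have "B \<in> bs ` {..<s}" using bs B(2) by (simp add: bij_betw_def)
      then obtain j where j: "j < s" "bs j = B" by blast
      let ?m = "single j 1 :: nat \<Rightarrow>\<^sub>0 nat"
      have "(\<Sum>i<s. lookup ?m i * f i) = f j" for f :: "nat \<Rightarrow> nat"
      proof -
        have "(\<Sum>i<s. lookup ?m i * f i) = (\<Sum>i<s. if i = j then f i else 0)"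
          by (intro sum.cong) (auto simp: lookup_single when_def)
        then show ?thesis using j(1) by simp
      qed
      note sum_m = this
      have "ex ?m = basis_exp B"
        unfolding ex_def sum_m j(2) basis_exp_def using finE bases_subset[OF B(2)]
        by (intro sum.mono_neutral_cong_right) auto
      moreover have "(\<Sum>i<s. lookup ?m i) = 1" using sum_m[of "\<lambda>_. 1"] by simp
      ultimately have "\<kappa> ?m = enc 1 (basis_exp B)" by (simp add: \<kappa>_def)
      then have "\<kappa> (?m + m) = enc (Suc k) w" unfolding add using m(2) enc_add[of 1 k "basis_exp B" v] B(1) by simp
      moreover have "?m + m \<in> ?D" using m(1) j(1) Poly_Mapping.keys_add[of ?m m] by auto
      ultimately show ?case by (metis imageI)
    qed
    then show "t \<in> \<kappa> ` ?D" using t(1) by simp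
  qed
  ultimately have "bij_betw \<kappa> ?D graded_exps" by (simp add: bij_betw_def)
  then show ?thesis by (rule S.polynomial_ringI[OF add])
qed

section \<open>Bounds for the regularity\<close>

text \<open>The point is the scaled sum of the core, plus the bases that complete its independent part to a
  frame. All coordinates with respect to this frame contribute positively, which leaves room for \<open>- e q\<close>.\<close>

lemma core_interior_point:
  assumes con: "connected" and r: "0 < r" and core: "core b m"
  obtains u where "2 < card E" "u \<in> lat" "height u = real (card E - 2)"
    "\<And>q. q \<in> span BV \<Longrightarrow> \<forall>\<^sub>F e in at_right 0. u - e *\<^sub>R q \<in> cone_hull BV"
proof -
  interpret cone_frames BV by unfold_locales (rule finite_BV)
  define v where "v i = indicator_vector (b i)" for i
  have bb: "b i \<in> bases" if "i < 6" for i using core that by (auto simp: core_def bases_def)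
  have m: "m + 2 \<le> 6" "0 < m" using core by (auto simp: core_def)
  have vBV: "v i \<in> BV" if "i < 6" for i using bb[OF that] by (simp add: v_def)
  let ?J = "{..<m + 2}"
  have fam: "\<forall>i\<in>?J. c i = 0" if "(\<Sum>i\<in>?J. c i *\<^sub>R v i) = 0" for c
  proof -
    have "(\<Sum>i<m + 2. c i * of_bool (x \<in> b i)) = 0" for x
      using fun_cong[OF that, of x] unfolding sum_fun_apply by (simp add: v_def indicator_vector_def)
    then show ?thesis using core unfolding core_def by blast
  qed
  note inj = independent_family(1)[OF finite_lessThan fam] and ind = independent_family(2)[OF finite_lessThan fam]
  let ?I = "v ` ?J"
  have "?I \<subseteq> BV" using vBV m(1) by auto
  then obtain \<sigma> where \<sigma>: "\<sigma> \<in> frames" "?I \<subseteq> \<sigma>" using extend_to_frame[OF _ ind] by blast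
  note S = frameD[OF \<sigma>(1)]
  have card_I: "card ?I = m + 2" using card_image[OF inj] by simp
  have card_\<sigma>: "card \<sigma> = card E" using S(5) dim_BV[OF con r] by simp
  define u0 where "u0 = (\<Sum>i<6. (real m / 6) *\<^sub>R v i)"
  define u where "u = u0 + (\<Sum>a\<in>\<sigma> - ?I. a)"
  have ht_v: "height (v i) = 1" if "i < 6" for i using height_basis[OF r bb[OF that]] by (simp add: v_def)
  have "height u0 = (\<Sum>i<6. real m / 6 * height (v i))"
    unfolding u0_def by (simp only: linear_sum[OF linear_height] linear_scale[OF linear_height] real_scaleR_def)
  also have "\<dots> = real m" using ht_v by simp
  finally have ht_u0: "height u0 = real m" .
  have u0_lat: "u0 \<in> lat"
  proof -
    have u0x: "u0 x = real m / 6 * real (\<Sum>i<6. of_bool (x \<in> b i))" for x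
      unfolding u0_def sum_fun_apply of_nat_sum sum_distrib_left
      by (rule sum.cong) (auto simp: v_def indicator_vector_def)
    have "u0 x \<in> \<int>" for x
    proof -
      have "6 dvd m * (\<Sum>i<6. of_bool (x \<in> b i))" using core unfolding core_def by blast
      then obtain t where "m * (\<Sum>i<6. of_bool (x \<in> b i)) = 6 * t" by (rule dvdE)
      then have "real (m * (\<Sum>i<6. of_bool (x \<in> b i))) = real (6 * t)" by (simp only:)
      then have "u0 x = real t" unfolding u0x of_nat_mult by (simp del: of_nat_sum)
      then show ?thesis by simp
    qed
    moreover have "u0 x = 0" if "x \<notin> E" for x
    proof -
      have "(\<Sum>i<6. of_bool (x \<in> b i)) = (0::nat)" using bb bases_subset that by (intro sum.neutral) auto
      then show ?thesis unfolding u0x by simp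
    qed
    ultimately show ?thesis using ht_u0 by (simp add: lat_def)
  qed
  have sum_lat: "(\<Sum>a\<in>K. a) \<in> lat" if "K \<subseteq> BV" for K
    using that
  proof (induction K rule: infinite_finite_induct)
    case empty
    show ?case unfolding sum.empty by (rule lat_zero)
  qed (use finite_BV finite_subset BV_lat[OF r] lat_add in auto)
  have u_lat: "u \<in> lat" unfolding u_def using S(1) by (intro lat_add u0_lat sum_lat) auto
  have card_diff: "card (\<sigma> - ?I) = card E - (m + 2)"
    using card_Diff_subset[of ?I \<sigma>] \<sigma>(2) card_I card_\<sigma> by simp
  have mE: "m + 2 \<le> card E" using card_mono[OF S(3) \<sigma>(2)] card_I card_\<sigma> by simp
  have ht_u: "height u = real (card E - 2)"
  proof -
    have "height (\<Sum>a\<in>\<sigma> - ?I. a) = (\<Sum>a\<in>\<sigma> - ?I. height a)" by (rule linear_sum[OF linear_height])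
    also have "\<dots> = (\<Sum>a\<in>\<sigma> - ?I. 1)" using S(1) height_basis[OF r] by (intro sum.cong) auto
    finally have "height (\<Sum>a\<in>\<sigma> - ?I. a) = real (card E - (m + 2))" using card_diff by simp
    then have "height u = real m + real (card E - (m + 2))" unfolding u_def linear_add[OF linear_height] ht_u0 by simp
    then show ?thesis using mE by simp
  qed
  have "\<forall>\<^sub>F e in at_right 0. u - e *\<^sub>R q \<in> cone_hull BV" if qA: "q \<in> span BV" for q
  proof -
    define qc where "qc = representation \<sigma> q"
    have "\<forall>\<^sub>F e in at_right 0. e * qc a < real m / 6" for a
    proof -
      have "((\<lambda>e. e * qc a) \<longlongrightarrow> 0 * qc a) (at_right 0)" by (intro tendsto_intros)
      then show ?thesis using order_tendstoD(2)[of _ _ _ "real m / 6"] m(2) by fastforce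
    qed
    then have "\<forall>\<^sub>F e in at_right 0. \<forall>a\<in>\<sigma>. e * qc a < real m / 6" using S(3) by (intro eventually_ball_finite) auto
    then show ?thesis
    proof eventually_elim
      case (elim e)
      have q: "q = (\<Sum>a\<in>\<sigma> - ?I. qc a *\<^sub>R a) + (\<Sum>i\<in>?J. qc (v i) *\<^sub>R v i)"
      proof -
        have "q = (\<Sum>a\<in>\<sigma>. qc a *\<^sub>R a)" unfolding qc_def using coord_sum[OF \<sigma>(1) qA] by (rule sym)
        also have "\<dots> = (\<Sum>a\<in>\<sigma> - ?I. qc a *\<^sub>R a) + (\<Sum>a\<in>?I. qc a *\<^sub>R a)"
          by (rule sum.subset_diff[OF \<sigma>(2) S(3)])
        also have "(\<Sum>a\<in>?I. qc a *\<^sub>R a) = (\<Sum>i\<in>?J. qc (v i) *\<^sub>R v i)" by (rule sum.reindex_cong[OF inj]) auto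
        finally show ?thesis .
      qed
      have u0_split: "u0 = (\<Sum>i\<in>{..<6} - ?J. (real m / 6) *\<^sub>R v i) + (\<Sum>i\<in>?J. (real m / 6) *\<^sub>R v i)"
        unfolding u0_def using m(1) by (intro sum.subset_diff) auto
      have e1: "(\<Sum>a\<in>\<sigma> - ?I. (1 - e * qc a) *\<^sub>R a) = (\<Sum>a\<in>\<sigma> - ?I. a) - e *\<^sub>R (\<Sum>a\<in>\<sigma> - ?I. qc a *\<^sub>R a)"
        by (simp only: scaleR_diff_left sum_subtractf scaleR_one scaleR_sum_right scaleR_scaleR)
      have e2: "(\<Sum>i\<in>?J. (real m / 6 - e * qc (v i)) *\<^sub>R v i) =
          (\<Sum>i\<in>?J. (real m / 6) *\<^sub>R v i) - e *\<^sub>R (\<Sum>i\<in>?J. qc (v i) *\<^sub>R v i)"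
        by (simp only: scaleR_diff_left sum_subtractf scaleR_sum_right scaleR_scaleR)
      have abel: "(w1 + w2 + w3) - (x1 + x2) = w1 + ((w2 - x2) + (w3 - x1))" for w1 w2 w3 x1 x2 :: "'x \<Rightarrow> real"
        by (simp only: algebra_simps)
      have eq: "u - e *\<^sub>R q = (\<Sum>i\<in>{..<6} - ?J. (real m / 6) *\<^sub>R v i) +
          ((\<Sum>i\<in>?J. (real m / 6 - e * qc (v i)) *\<^sub>R v i) + (\<Sum>a\<in>\<sigma> - ?I. (1 - e * qc a) *\<^sub>R a))"
        unfolding u_def u0_split q e1 e2 scaleR_add_right by (rule abel)
      have scale: "t *\<^sub>R a \<in> cone_hull BV" if "0 \<le> t" "a \<in> BV" for t a
        using that finite_BV by (intro cone_hull_scale cone_hull_base)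
      have "0 \<le> 1 - e * qc a" if "a \<in> \<sigma>" for a using elim that m(1) by fastforce
      moreover have "0 \<le> real m / 6 - e * qc (v i)" if "i \<in> ?J" for i using elim \<sigma>(2) that by fastforce
      ultimately show ?case unfolding eq using S(1) vBV m(1)
        by (intro cone_hull_add cone_hull_sum scale) auto
    qed
  qed
  then show thesis using that u_lat ht_u mE m(2) by auto
qed

text \<open>If the corank were at most one, or the rank zero, there would be so few bases that the base ring is a polynomial
  ring. In all other cases there is a core, and the two estimates for the degree of the numerator apply.\<close>

theorem reg_base_ring_bounds:
  fixes F :: "((nat \<Rightarrow> ('x, 'k::field) mpol) set, 'k) graded_algebra"
  assumes F: "F = base_ring (E, bases)" and np: "\<not> is_polynomial_ring F"
    and con: "connected"
    and simple: "\<And>f g. f \<in> E \<Longrightarrow> g \<in> E \<Longrightarrow> f \<noteq> g \<Longrightarrow> \<rho> g \<notin> cl {f}" "\<And>f. f \<in> E \<Longrightarrow> \<rho> f \<noteq> 0"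
  shows "3 \<le> reg F" "reg F + 1 \<le> card E"
proof -
  obtain H where "semigroup_algebra F graded_exps level H" using semigroup_algebra_base_ring[OF F] by blast
  then interpret S: semigroup_algebra F graded_exps level H .
  have many: "\<not> card bases \<le> 1" using polynomial_ring_if_few_bases[OF F] np by blast
  have r: "0 < r"
  proof (rule ccontr)
    assume "\<not> 0 < r"
    then have "bases \<subseteq> {{}}" using rank bases_finite by (auto simp: bases_def)
    then show False using many card_mono[of "{{}}" bases] by simp
  qed
  obtain B0 where B0: "basis B0" using ex_basis by blast
  have "card B0 + 2 \<le> card E"
  proof (rule ccontr)
    assume "\<not> ?thesis"
    then have "card bases \<le> card E" using few_bases[OF B0] many by linarith
    then show False using polynomial_ring_if_few_bases[OF F] independent_bases[OF con r] np by blast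
  qed
  then obtain b m where core: "core b m" using core_exists[OF simple con B0] by blast
  interpret CF: cone_frames BV by unfold_locales (rule finite_BV)
  obtain c where c: "\<And>\<sigma> v. \<sigma> \<in> CF.frames \<Longrightarrow> v \<in> BV - \<sigma> \<Longrightarrow> (\<Sum>b\<in>\<sigma>. representation \<sigma> v b * c b) \<noteq> c v"
    using CF.exists_generic_weights by blast
  obtain g where g: "\<And>a. a \<in> BV \<Longrightarrow> 0 < g a" "CF.generic (\<Sum>a\<in>BV. g a *\<^sub>R a)"
    using CF.exists_generic_point by blast
  interpret C: lattice_cone BV height c lat g
  proof (intro lattice_cone.intro weighted_cone.intro weighted_cone_axioms.intro lattice_cone_axioms.intro
      CF.cone_frames_axioms)
    show "linear height" by (rule linear_height)
    show "height a = 1" if "a \<in> BV" for a using that height_basis[OF r] by blast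
    show "height u \<in> \<int>" if "u \<in> lat" for u using that by (simp add: lat_def)
    show "finite {u \<in> lat \<inter> cone_hull BV. height u = real k}" for k
      unfolding lattice_slice[OF r] using finite_ksums by simp
  qed (use BV_lat[OF r] lat_zero lat_diff c g in auto)
  have dimE: "dim BV = card E" by (rule dim_BV[OF con r])
  have slice: "C.slice k = emb ` ksums k" for k unfolding C.slice_def by (rule lattice_slice[OF r])
  have hilb: "hilbert_series F = Abs_fps (\<lambda>k. int (card (C.slice k)))"
    unfolding hilbert_series_def S.hilbert_function_eq slice
    by (simp add: card_level card_image[OF inj_on_subset[OF emb_inj]])
  have krull: "krull_dim F = enat (card E)"
    by (rule S.krull_dim_eq[where gr = "\<lambda>m. lookup m 0"])
      (use growth[OF r] exponents_differ[OF con r] in \<open>auto simp: lookup_add\<close>)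
  have h: "h_polynomial F = C.h_poly"
    unfolding h_polynomial_def
  proof (rule the_equality)
    show "\<exists>d. krull_dim F = enat d \<and> hilbert_series F * (1 - fps_X) ^ d = fps_of_poly C.h_poly"
      using krull C.slice_series hilb dimE by auto
    fix h assume "\<exists>d. krull_dim F = enat d \<and> hilbert_series F * (1 - fps_X) ^ d = fps_of_poly h"
    then have "fps_of_poly h = fps_of_poly C.h_poly" using krull C.slice_series hilb dimE by auto
    then show "h = C.h_poly" by (simp add: fps_of_poly_eq_iff)
  qed
  have "\<exists>B1 B2. B1 \<in> bases \<and> B2 \<in> bases \<and> B1 \<noteq> B2"
    using many card_le_Suc0_iff_eq[OF finite_bases] by auto
  then obtain B1 B2 where B12: "B1 \<in> bases" "B2 \<in> bases" "B1 \<noteq> B2" by blast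
  have "Polynomial.degree C.h_poly + 2 \<le> dim BV"
  proof (rule C.degree_h_poly_le)
    show "indicator_vector B1 \<in> BV" "indicator_vector B2 \<in> BV" "indicator_vector B1 \<noteq> indicator_vector B2"
      using B12 indicator_vector_inj by blast+
    fix u assume "u \<in> lat" "u \<in> cone_hull BV" "height u = 1"
    then have "u \<in> emb ` ksums 1" using lattice_slice[OF r, of 1] by auto
    then obtain B where "B \<in> bases" "u = emb (basis_exp B)" by auto
    then show "u \<in> BV" using emb_basis_exp[OF bases_finite] by blast
  qed (rule BV_extreme)
  then show "reg F + 1 \<le> card E" by (simp add: reg_def h dimE)
  obtain u where u: "2 < card E" "u \<in> lat" "height u = real (card E - 2)"
    "\<forall>\<^sub>F e in at_right 0. u - e *\<^sub>R C.q \<in> cone_hull BV"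
    using core_interior_point[OF con r core] C.q_span by metis
  then have "dim BV - (card E - 2) \<le> Polynomial.degree C.h_poly"
    using C.degree_h_poly_ge[OF u(2,3)] dimE by simp
  then show "3 \<le> reg F" using u(1) dimE by (simp add: reg_def h)
qed

end

theorem theorem2p13:
  fixes n :: nat and E :: "nat set set"
    and F :: "((nat \<Rightarrow> (nat set, 'k::field) mpol) set, 'k) graded_algebra"
  assumes "simple_graph {1..n} E"
    and "two_connected {1..n} E"
    and "F = base_ring (cycle_matroid E)"
    and "\<not> is_polynomial_ring F"
  shows "3 \<le> reg F \<and> int (reg F) \<le> int (card E) - 1"
proof -
  interpret simple_graph_matroid "{1..n}" E by unfold_locales (rule assms(1))
  obtain B0 where B0: "basis B0" using ex_basis by blast
  obtain f where f: "bij_betw f E {0..<card E}" using ex_bij_betw_finite_nat[OF finite_E] by blast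
  have "bij_betw Suc {0..<card E} {1..card E}" by (auto simp: bij_betw_def image_Suc_atLeastLessThan)
  from bij_betw_trans[OF f this] interpret matroid_algebra E incidence "card B0" "Suc \<circ> f"
    by unfold_locales (auto intro: basis_card B0)
  have "cycle_matroid E = (E, bases)"
    by (simp add: cycle_matroid_def bases_def spanning_forest_iff_basis)
  then have F: "F = base_ring (E, bases)" using assms(3) by simp
  have "3 \<le> reg F" "reg F + 1 \<le> card E"
    using reg_base_ring_bounds[OF F assms(4) two_connected_matroid[OF assms(2)]]
      incidence_not_parallel incidence_nonzero by blast+
  then show ?thesis by simp
qed

end
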